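(* ${\mathrm{eLDT}}$ polynomially simulates ${\mathrm{LK}}$, and hence ${\mathrm{eLNDT}}$ also polynomially simulates ${\mathrm{LK}}$. That is, there is a polynomial-time procedure which, given an ${\mathrm{LK}}$ proof of a sequent $\bigvee\vec a_0,\dots,\bigvee\vec a_{m-1}\to\bigwedge\vec b_0,\dots,\bigwedge\vec b_{n-1}$ with the $\vec a_i,\vec b_j$ nonempty sequences of literals, outputs an ${\mathrm{eLDT}}$ proof (in particular also an ${\mathrm{eLNDT}}$ proof) of ${\mathrm{Disj}}(\vec a_0),\dots,{\mathrm{Disj}}(\vec a_{m-1})\to{\mathrm{Conj}}(\vec b_0),\dots,{\mathrm{Conj}}(\vec b_{n-1})$.
   Context: A literal is a propositional variable $x$ or its negation $\overline x$. ${\mathrm{LK}}$ is the usual sequent calculus for Boolean formulas built from literals by binary $\land,\lor$ (initial sequents $p\to p$, $p,\overline p\to$, $\to p,\overline p$; contraction, weakening, cut, and the standard left/right rules for $\land,\lor$). $\bigvee\vec p$ / $\bigwedge\vec p$ denote any disjunction / conjunction of the literals of $\vec p$ in order, with arbitrary nesting. Extension variables $e,e_0,e_1,\dots$ are new variables distinct from the propositional variables. eDT formulas: every literal and every extension variable is an eDT formula; if $A,B$ are eDT formulas and $p$ is a literal (not an extension variable) then $(ApB)$ is an eDT formula ("if $p$ is false then $A$, else $B$"). eNDT formulas: same clauses plus $(A\lor B)$ for eNDT formulas $A,B$. A set of extension axioms $\{e_i\leftrightarrow A_i\}_{i<n}$ requires that $A_i$ contains only extension variables among $e_0,\dots,e_{i-1}$;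 it contributes the initial sequents $e_i\to A_i$ and $A_i\to e_i$. An ${\mathrm{eLDT}}$ proof is a pair consisting of a set of extension axioms with eDT formulas $A_i$ and a (dag-like) derivation of eDT-formula sequents using: initial sequents $p\to p$, $p,\overline p\to$, $\to p,\overline p$ and the extension axioms; contraction, weakening, cut; dec-l (from $A,\Gamma\to\Delta,p$ and $p,B,\Gamma\to\Delta$ infer $ApB,\Gamma\to\Delta$) and dec-r (from $\Gamma\to\Delta,A,p$ and $p,\Gamma\to\Delta,B$ infer $\Gamma\to\Delta,ApB$). An ${\mathrm{eLNDT}}$ proof is the same with eNDT formulas and additionally the rules $\lor$-l (from $A,\Gamma\to\Delta$ and $B,\Gamma\to\Delta$ infer $A\lor B,\Gamma\to\Delta$) and $\lor$-r (from $\Gamma\to\Delta,A,B$ infer $\Gamma\to\Delta,A\lor B$). Proof size is the total size of its formulas (including the extension axioms). ${\mathrm{Conj}}(p):=p$, ${\mathrm{Conj}}(p,\vec p):=(p\,p\,{\mathrm{Conj}}(\vec p))$; ${\mathrm{Disj}}(p):=p$, ${\mathrm{Disj}}(p,\vec p):=({\mathrm{Disj}}(\vec p)\,p\,p)$. *)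

theory Defs
  imports "HOL-Library.Multiset" "HOL-Computational_Algebra.Polynomial"
begin

section \<open>Sequents and dag-like derivations\<close>

datatype lit = Pos nat | Neg nat

primrec neg :: "lit \<Rightarrow> lit" where
  "neg (Pos x) = Neg x"
| "neg (Neg x) = Pos x"

type_synonym 'f sequent = "'f multiset \<times> 'f multiset"

text \<open>A line of a derivation lists the positions of its premises and its two cedents. Cedents are
  written out as lists, so that a derivation is a finite string, but are read as multisets: there
  is no exchange rule.\<close>

type_synonym 'f line = "nat list \<times> 'f list \<times> 'f list"

fun conclusion :: "'f line \<Rightarrow> 'f sequent" where
  "conclusion (ps, \<Gamma>, \<Delta>) = (mset \<Gamma>, mset \<Delta>)"

fun prem_ids :: "'f line \<Rightarrow> nat list" where
  "prem_ids (ps, \<Gamma>, \<Delta>) = ps"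

fun line_formulas :: "'f line \<Rightarrow> 'f set" where
  "line_formulas (ps, \<Gamma>, \<Delta>) = set \<Gamma> \<union> set \<Delta>"

text \<open>\<open>R Ps S\<close> says that \<open>S\<close> follows by one inference of the calculus from the list of
  premises \<open>Ps\<close>; initial sequents are inferences with \<open>Ps = []\<close>.\<close>

definition derivation :: "('f sequent list \<Rightarrow> 'f sequent \<Rightarrow> bool) \<Rightarrow> 'f line list \<Rightarrow> bool" where
  "derivation R \<pi> \<longleftrightarrow>
     (\<forall>k < length \<pi>. (\<forall>i \<in> set (prem_ids (\<pi> ! k)). i < k) \<and>
        R (map (\<lambda>i. conclusion (\<pi> ! i)) (prem_ids (\<pi> ! k))) (conclusion (\<pi> ! k)))"

definition derives ::
  "('f sequent list \<Rightarrow> 'f sequent \<Rightarrow> bool) \<Rightarrow> 'f line list \<Rightarrow> 'f sequent \<Rightarrow> bool" where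
  "derives R \<pi> S \<longleftrightarrow> derivation R \<pi> \<and> \<pi> \<noteq> [] \<and> conclusion (last \<pi>) = S"

inductive structural_rule :: "'f sequent list \<Rightarrow> 'f sequent \<Rightarrow> bool" where
  contraction_l: "structural_rule [(add_mset A (add_mset A \<Gamma>), \<Delta>)] (add_mset A \<Gamma>, \<Delta>)"
| contraction_r: "structural_rule [(\<Gamma>, add_mset A (add_mset A \<Delta>))] (\<Gamma>, add_mset A \<Delta>)"
| weakening_l: "structural_rule [(\<Gamma>, \<Delta>)] (add_mset A \<Gamma>, \<Delta>)"
| weakening_r: "structural_rule [(\<Gamma>, \<Delta>)] (\<Gamma>, add_mset A \<Delta>)"
| cut: "structural_rule [(\<Gamma>, add_mset A \<Delta>), (add_mset A \<Gamma>, \<Delta>)] (\<Gamma>, \<Delta>)"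

text \<open>The parameter \<open>L\<close> embeds literals into formulas.\<close>

inductive literal_axiom :: "(lit \<Rightarrow> 'f) \<Rightarrow> 'f sequent \<Rightarrow> bool" for L :: "lit \<Rightarrow> 'f" where
  "literal_axiom L ({#L p#}, {#L p#})"
| "literal_axiom L ({#L p, L (neg p)#}, {#})"
| "literal_axiom L ({#}, {#L p, L (neg p)#})"


section \<open>LK\<close>

datatype bfm = BLit lit | BAnd bfm bfm | BOr bfm bfm

inductive lk_rule :: "bfm sequent list \<Rightarrow> bfm sequent \<Rightarrow> bool" where
  lk_literal: "literal_axiom BLit S \<Longrightarrow> lk_rule [] S"
| lk_structural: "structural_rule Ps S \<Longrightarrow> lk_rule Ps S"
| and_l: "lk_rule [(add_mset A (add_mset B \<Gamma>), \<Delta>)] (add_mset (BAnd A B) \<Gamma>, \<Delta>)"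
| and_r: "lk_rule [(\<Gamma>, add_mset A \<Delta>), (\<Gamma>, add_mset B \<Delta>)] (\<Gamma>, add_mset (BAnd A B) \<Delta>)"
| or_l: "lk_rule [(add_mset A \<Gamma>, \<Delta>), (add_mset B \<Gamma>, \<Delta>)] (add_mset (BOr A B) \<Gamma>, \<Delta>)"
| or_r: "lk_rule [(\<Gamma>, add_mset A (add_mset B \<Delta>))] (\<Gamma>, add_mset (BOr A B) \<Delta>)"

definition lk_proof :: "bfm line list \<Rightarrow> bfm sequent \<Rightarrow> bool" where
  "lk_proof \<pi> S \<longleftrightarrow> derives lk_rule \<pi> S"

text \<open>\<open>disjunction_of ps A\<close>: \<open>A\<close> is a disjunction of the literals \<open>ps\<close>, in this order, with some
  nesting; dually \<open>conjunction_of\<close>.\<close>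

inductive disjunction_of :: "lit list \<Rightarrow> bfm \<Rightarrow> bool" where
  "disjunction_of [p] (BLit p)"
| "disjunction_of ps A \<Longrightarrow> disjunction_of qs B \<Longrightarrow> disjunction_of (ps @ qs) (BOr A B)"

inductive conjunction_of :: "lit list \<Rightarrow> bfm \<Rightarrow> bool" where
  "conjunction_of [p] (BLit p)"
| "conjunction_of ps A \<Longrightarrow> conjunction_of qs B \<Longrightarrow> conjunction_of (ps @ qs) (BAnd A B)"


section \<open>eLDT and eLNDT\<close>

text \<open>The eNDT formulas. \<open>EDec A p B\<close> is \<open>(A p B)\<close>: if \<open>p\<close> is false then \<open>A\<close>, else \<open>B\<close>.\<close>

datatype efm = ELit lit | EExt nat | EDec efm lit efm | EOr efm efm

primrec edt :: "efm \<Rightarrow> bool" where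
  "edt (ELit p) \<longleftrightarrow> True"
| "edt (EExt i) \<longleftrightarrow> True"
| "edt (EDec A p B) \<longleftrightarrow> edt A \<and> edt B"
| "edt (EOr A B) \<longleftrightarrow> False"

primrec ext_vars :: "efm \<Rightarrow> nat set" where
  "ext_vars (ELit p) = {}"
| "ext_vars (EExt i) = {i}"
| "ext_vars (EDec A p B) = ext_vars A \<union> ext_vars B"
| "ext_vars (EOr A B) = ext_vars A \<union> ext_vars B"

text \<open>A list \<open>E\<close> of formulas stands for the extension axioms \<open>EExt i \<leftrightarrow> E ! i\<close>, \<open>i < length E\<close>.\<close>

definition extension_axioms :: "efm list \<Rightarrow> bool" where
  "extension_axioms E \<longleftrightarrow> (\<forall>i < length E. ext_vars (E ! i) \<subseteq> {..<i})"

inductive eldt_rule :: "efm list \<Rightarrow> efm sequent list \<Rightarrow> efm sequent \<Rightarrow> bool" for E :: "efm list" where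
  eldt_literal: "literal_axiom ELit S \<Longrightarrow> eldt_rule E [] S"
| eldt_ext_l: "i < length E \<Longrightarrow> eldt_rule E [] ({#EExt i#}, {#E ! i#})"
| eldt_ext_r: "i < length E \<Longrightarrow> eldt_rule E [] ({#E ! i#}, {#EExt i#})"
| eldt_structural: "structural_rule Ps S \<Longrightarrow> eldt_rule E Ps S"
| dec_l: "eldt_rule E
    [(add_mset A \<Gamma>, add_mset (ELit p) \<Delta>), (add_mset (ELit p) (add_mset B \<Gamma>), \<Delta>)]
    (add_mset (EDec A p B) \<Gamma>, \<Delta>)"
| dec_r: "eldt_rule E
    [(\<Gamma>, add_mset A (add_mset (ELit p) \<Delta>)), (add_mset (ELit p) \<Gamma>, add_mset B \<Delta>)]
    (\<Gamma>, add_mset (EDec A p B) \<Delta>)"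

inductive elndt_rule :: "efm list \<Rightarrow> efm sequent list \<Rightarrow> efm sequent \<Rightarrow> bool" for E :: "efm list" where
  elndt_eldt: "eldt_rule E Ps S \<Longrightarrow> elndt_rule E Ps S"
| elndt_or_l: "elndt_rule E
    [(add_mset A \<Gamma>, \<Delta>), (add_mset B \<Gamma>, \<Delta>)] (add_mset (EOr A B) \<Gamma>, \<Delta>)"
| elndt_or_r: "elndt_rule E
    [(\<Gamma>, add_mset A (add_mset B \<Delta>))] (\<Gamma>, add_mset (EOr A B) \<Delta>)"

type_synonym eproof = "efm list \<times> efm line list"

fun eldt_proof :: "eproof \<Rightarrow> efm sequent \<Rightarrow> bool" where
  "eldt_proof (E, \<pi>) S \<longleftrightarrow>
     extension_axioms E \<and> (\<forall>A \<in> set E. edt A) \<and>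
     (\<forall>l \<in> set \<pi>. \<forall>A \<in> line_formulas l. edt A) \<and>
     derives (eldt_rule E) \<pi> S"

fun elndt_proof :: "eproof \<Rightarrow> efm sequent \<Rightarrow> bool" where
  "elndt_proof (E, \<pi>) S \<longleftrightarrow> extension_axioms E \<and> derives (elndt_rule E) \<pi> S"

text \<open>\<open>Conj []\<close> and \<open>Disj []\<close> are left unspecified.\<close>

fun Conj :: "lit list \<Rightarrow> efm" where
  "Conj [p] = ELit p"
| "Conj (p # q # ps) = EDec (ELit p) p (Conj (q # ps))"

fun Disj :: "lit list \<Rightarrow> efm" where
  "Disj [p] = ELit p"
| "Disj (p # q # ps) = EDec (Disj (q # ps)) p (ELit p)"


section \<open>Encoding of proofs as bit strings\<close>

text \<open>Objects are turned into binary trees, and these are written in Polish notation. Numbers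
  (indices of variables and of premises) are written in binary, least significant bit first, so up
  to the logarithmic length of the indices a code is as long as the proof has symbols.\<close>

datatype tree = Leaf | Node tree tree

primrec bits_of_tree :: "tree \<Rightarrow> bool list" where
  "bits_of_tree Leaf = [False]"
| "bits_of_tree (Node s t) = True # bits_of_tree s @ bits_of_tree t"

fun binary :: "nat \<Rightarrow> bool list" where
  "binary n = (if n = 0 then [] else odd n # binary (n div 2))"

declare binary.simps [simp del]

definition tree_list :: "('a \<Rightarrow> tree) \<Rightarrow> 'a list \<Rightarrow> tree" where
  "tree_list f xs = foldr (\<lambda>x. Node (f x)) xs Leaf"

definition tree_bool :: "bool \<Rightarrow> tree" where
  "tree_bool b = (if b then Node Leaf Leaf else Leaf)"

definition tree_nat :: "nat \<Rightarrow> tree" where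
  "tree_nat n = tree_list tree_bool (binary n)"

primrec tree_lit :: "lit \<Rightarrow> tree" where
  "tree_lit (Pos x) = Node (tree_bool True) (tree_nat x)"
| "tree_lit (Neg x) = Node (tree_bool False) (tree_nat x)"

primrec tree_bfm :: "bfm \<Rightarrow> tree" where
  "tree_bfm (BLit p) = Node (tree_nat 0) (tree_lit p)"
| "tree_bfm (BAnd A B) = Node (tree_nat 1) (Node (tree_bfm A) (tree_bfm B))"
| "tree_bfm (BOr A B) = Node (tree_nat 2) (Node (tree_bfm A) (tree_bfm B))"

primrec tree_efm :: "efm \<Rightarrow> tree" where
  "tree_efm (ELit p) = Node (tree_nat 0) (tree_lit p)"
| "tree_efm (EExt i) = Node (tree_nat 1) (tree_nat i)"
| "tree_efm (EDec A p B) = Node (tree_nat 2) (Node (tree_efm A) (Node (tree_lit p) (tree_efm B)))"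
| "tree_efm (EOr A B) = Node (tree_nat 3) (Node (tree_efm A) (tree_efm B))"

fun tree_line :: "('f \<Rightarrow> tree) \<Rightarrow> 'f line \<Rightarrow> tree" where
  "tree_line f (ps, \<Gamma>, \<Delta>) = Node (tree_list tree_nat ps) (Node (tree_list f \<Gamma>) (tree_list f \<Delta>))"

definition encode_lk :: "bfm line list \<Rightarrow> bool list" where
  "encode_lk \<pi> = bits_of_tree (tree_list (tree_line tree_bfm) \<pi>)"

fun encode_eproof :: "eproof \<Rightarrow> bool list" where
  "encode_eproof (E, \<pi>) =
     bits_of_tree (Node (tree_list tree_efm E) (tree_list (tree_line tree_efm) \<pi>))"


section \<open>Polynomial time\<close>

text \<open>The machine model: structured programs over finitely many stacks of bits. In one step a
  program pushes or pops one bit, or branches on the top of one stack. A stack is a one-way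
  infinite tape that is blank beyond its head, and a tape is a pair of stacks, so up to a constant
  factor in time these are the multitape Turing machines. The state of the machine is total, but a
  program mentions only finitely many stacks.\<close>

datatype prog =
    Skip
  | Push nat bool
  | Pop nat
  | Seq prog prog
  | Branch nat prog prog prog  \<comment> \<open>empty stack, top \<open>False\<close>, top \<open>True\<close>\<close>
  | While nat prog  \<comment> \<open>as long as the stack is nonempty\<close>

type_synonym store = "nat \<Rightarrow> bool list"

text \<open>\<open>exec c s n s'\<close>: started in \<open>s\<close>, program \<open>c\<close> halts in \<open>s'\<close> after \<open>n\<close> steps. Popping the
  empty stack has no effect.\<close>

inductive exec :: "prog \<Rightarrow> store \<Rightarrow> nat \<Rightarrow> store \<Rightarrow> bool" where
  exec_Skip: "exec Skip s 1 s"
| exec_Push: "exec (Push x b) s 1 (s(x := b # s x))"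
| exec_Pop: "exec (Pop x) s 1 (s(x := tl (s x)))"
| exec_Seq: "exec c s m s' \<Longrightarrow> exec d s' n s'' \<Longrightarrow> exec (Seq c d) s (m + n) s''"
| exec_Branch_empty: "s x = [] \<Longrightarrow> exec c s n s' \<Longrightarrow> exec (Branch x c d e) s (Suc n) s'"
| exec_Branch_False: "s x = False # w \<Longrightarrow> exec d s n s' \<Longrightarrow> exec (Branch x c d e) s (Suc n) s'"
| exec_Branch_True: "s x = True # w \<Longrightarrow> exec e s n s' \<Longrightarrow> exec (Branch x c d e) s (Suc n) s'"
| exec_While_empty: "s x = [] \<Longrightarrow> exec (While x c) s 1 s"
| exec_While_step: "s x \<noteq> [] \<Longrightarrow> exec c s m s' \<Longrightarrow> exec (While x c) s' n s'' \<Longrightarrow>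
    exec (While x c) s (Suc (m + n)) s''"

text \<open>Input and output are on stack \<open>0\<close>; all other stacks are initially empty.\<close>

definition outputs_within :: "prog \<Rightarrow> bool list \<Rightarrow> nat \<Rightarrow> bool list \<Rightarrow> bool" where
  "outputs_within c u t v \<longleftrightarrow> (\<exists>n s. exec c ((\<lambda>_. [])(0 := u)) n s \<and> n \<le> t \<and> s 0 = v)"


section \<open>The machine model is deterministic and the encodings are injective\<close>

inductive_cases exec_SkipE: "exec Skip s n s'"
inductive_cases exec_PushE: "exec (Push x b) s n s'"
inductive_cases exec_PopE: "exec (Pop x) s n s'"
inductive_cases exec_SeqE: "exec (Seq c d) s n s'"
inductive_cases exec_BranchE: "exec (Branch x c d e) s n s'"
inductive_cases exec_WhileE: "exec (While x c) s n s'"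

lemma exec_deterministic: "exec c s n s' \<Longrightarrow> exec c s m s'' \<Longrightarrow> m = n \<and> s'' = s'"
proof (induction arbitrary: m s'' rule: exec.induct)
  case exec_Skip then show ?case by (auto elim: exec_SkipE)
next
  case exec_Push then show ?case by (auto elim: exec_PushE)
next
  case exec_Pop then show ?case by (auto elim: exec_PopE)
next
  case exec_Seq
  from exec_Seq.prems show ?case
    by (rule exec_SeqE) (use exec_Seq.IH in blast)
next
  case exec_Branch_empty
  from exec_Branch_empty.prems show ?case
    by (rule exec_BranchE) (use exec_Branch_empty.hyps in \<open>auto dest!: exec_Branch_empty.IH\<close>)
next
  case exec_Branch_False
  from exec_Branch_False.prems show ?case
    by (rule exec_BranchE) (use exec_Branch_False.hyps in \<open>auto dest!: exec_Branch_False.IH\<close>)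
next
  case exec_Branch_True
  from exec_Branch_True.prems show ?case
    by (rule exec_BranchE) (use exec_Branch_True.hyps in \<open>auto dest!: exec_Branch_True.IH\<close>)
next
  case exec_While_empty then show ?case by (auto elim: exec_WhileE)
next
  case exec_While_step
  from exec_While_step.prems show ?case
    by (rule exec_WhileE) (use exec_While_step.hyps exec_While_step.IH in blast)+
qed

lemma bits_of_tree_append_inject:
  "bits_of_tree s @ u = bits_of_tree t @ v \<longleftrightarrow> s = t \<and> u = v"
proof (induction s arbitrary: t u v)
  case Leaf
  then show ?case by (cases t) auto
next
  case (Node s1 s2)
  then show ?case by (cases t) auto
qed

lemma bits_of_tree_inject: "bits_of_tree s = bits_of_tree t \<longleftrightarrow> s = t"
  using bits_of_tree_append_inject[of s "[]" t "[]"] by simp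

lemma inj_tree_list: "inj f \<Longrightarrow> inj (tree_list f)"
proof (rule injI)
  fix xs ys assume "inj f" "tree_list f xs = tree_list f ys"
  then show "xs = ys"
  proof (induction xs arbitrary: ys)
    case Nil
    then show ?case by (cases ys) (auto simp: tree_list_def)
  next
    case (Cons x xs)
    then show ?case by (cases ys) (auto simp: tree_list_def dest: injD)
  qed
qed

lemma binary_inject: "binary m = binary n \<Longrightarrow> m = n"
proof (induction m arbitrary: n rule: binary.induct)
  case (1 m)
  show ?case
  proof (cases "m = 0 \<or> n = 0")
    case True
    with "1.prems" show ?thesis by (auto simp: binary.simps split: if_splits)
  next
    case False
    with "1.prems" have eq: "odd m = odd n" "binary (m div 2) = binary (n div 2)"
      by (auto simp: binary.simps[of m] binary.simps[of n])
    with "1.IH" False have "m div 2 = n div 2" by blast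
    with eq(1) show ?thesis by presburger
  qed
qed

lemma inj_tree_nat: "inj tree_nat"
proof (rule injI)
  fix m n assume "tree_nat m = tree_nat n"
  then have eq: "tree_list tree_bool (binary m) = tree_list tree_bool (binary n)"
    by (simp add: tree_nat_def)
  have "inj tree_bool"
    by (rule injI) (simp add: tree_bool_def split: if_splits)
  then have "inj (tree_list tree_bool)" by (rule inj_tree_list)
  from injD[OF this eq] show "m = n" by (rule binary_inject)
qed

lemma inj_tree_lit: "inj tree_lit"
proof (rule injI)
  fix p q assume "tree_lit p = tree_lit q"
  then show "p = q"
    by (cases p; cases q) (auto simp: tree_bool_def dest: injD[OF inj_tree_nat])
qed

lemma inj_tree_bfm: "inj tree_bfm"
proof (rule injI)
  fix A B show "tree_bfm A = tree_bfm B \<Longrightarrow> A = B"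
  proof (induction A arbitrary: B)
    case (BLit p) then show ?case
      by (cases B) (auto dest: injD[OF inj_tree_nat] injD[OF inj_tree_lit])
  next
    case (BAnd A1 A2) then show ?case by (cases B) (auto dest: injD[OF inj_tree_nat])
  next
    case (BOr A1 A2) then show ?case by (cases B) (auto dest: injD[OF inj_tree_nat])
  qed
qed

lemma inj_tree_efm: "inj tree_efm"
proof (rule injI)
  fix A B show "tree_efm A = tree_efm B \<Longrightarrow> A = B"
  proof (induction A arbitrary: B)
    case (ELit p) then show ?case
      by (cases B) (auto dest: injD[OF inj_tree_nat] injD[OF inj_tree_lit])
  next
    case (EExt p) then show ?case by (cases B) (auto dest: injD[OF inj_tree_nat])
  next
    case (EDec A1 p A2) then show ?case
      by (cases B) (auto dest: injD[OF inj_tree_nat] injD[OF inj_tree_lit])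
  next
    case (EOr A1 A2) then show ?case by (cases B) (auto dest: injD[OF inj_tree_nat])
  qed
qed

lemma inj_tree_line: "inj f \<Longrightarrow> inj (tree_line f)"
  by (rule injI)
    (auto elim!: tree_line.elims dest: injD[OF inj_tree_list] injD[OF inj_tree_list[OF inj_tree_nat]])

lemma inj_encode_lk: "inj encode_lk"
  by (rule injI)
    (auto simp: encode_lk_def bits_of_tree_inject
      dest: injD[OF inj_tree_list[OF inj_tree_line[OF inj_tree_bfm]]])

lemma inj_encode_eproof: "inj encode_eproof"
  by (rule injI)
    (auto elim!: encode_eproof.elims simp: bits_of_tree_append_inject bits_of_tree_inject
      dest: injD[OF inj_tree_list[OF inj_tree_efm]]
        injD[OF inj_tree_list[OF inj_tree_line[OF inj_tree_efm]]])

end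

theory Submission
  imports Defs
begin

text \<open>A formula \<open>A\<close> over literals is computed by a branching program with one node per subformula
  occurrence: the node of \<open>B\<close> gets two continuations \<open>X\<close>, \<open>Y\<close> for the values false and true of \<open>B\<close>,
  and short-circuit evaluation of \<open>B\<close> passes suitable continuations to its immediate subformulas.
  With an extension variable for every node, each axiom is an eDT formula, and the variable of the
  root with the continuations 0 and 1 represents \<open>A\<close>. That the node of \<open>B\<close> is equivalent to
  \<open>(X B Y)\<close>, where \<open>B\<close> stands for the root variable of \<open>B\<close>'s own program, has
  short proofs by induction on \<open>B\<close>; it follows that the root variables commute with the
  connectives, and so LK is simulated line by line.

  The translation need not analyse the LK inferences. It writes down the sequents to be derived in
  order, and every single one follows from the preceding ones by weakening and at most five nested
  cuts, which are found by brute force over the formulas that have occurred. Premises are sequents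
  until a last pass replaces them by positions.

  For the time bound, functions on binary trees are computed on stack 0 in a last-in-first-out
  fashion; these are closed under composition, pairing, case distinction and folds whose accumulator
  stays polynomially bounded, and the translation is built from these operations.\<close>

section \<open>Stack programs\<close>

text \<open>Decisions are allowed on literals only, so a connective between compound formulas cannot
  be expressed by deciding on the extension variable of one of them. This is what forces the
  continuations. Unfolding the programs into eDT formulas instead would copy continuations and can
  be exponential.

  A node of the program of \<open>C\<close> is compared with the root variable of a subformula, so
  every subformula of the LK proof needs a program of its own, and a formula of size n contributes
  on the order of n squared variables at most.

  The length of the resulting proof is never estimated: a program writes at most one bit per step,
  so the running time bounds the output. The brute-force search is affordable because the nesting of
  cuts is a fixed number, independent of the input. The longest chains of cuts used have length
  four, within the depth five.

  Disjunction is never treated separately: exchanging the two sides of all sequents turns its laws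
  into those of conjunction.\<close>

definition runs :: "prog \<Rightarrow> store \<Rightarrow> nat \<Rightarrow> store \<Rightarrow> bool" where
  "runs c s t s' \<longleftrightarrow> (\<exists>n\<le>t. exec c s n s')"

lemma runs_mono: "runs c s t s' \<Longrightarrow> t \<le> t' \<Longrightarrow> runs c s t' s'"
  unfolding runs_def by (meson le_trans)

lemma runs_Skip: "runs Skip s 1 s"
  unfolding runs_def using exec_Skip by blast

lemma runs_Push: "runs (Push x b) s 1 (s(x := b # s x))"
  unfolding runs_def using exec_Push by blast

lemma runs_Pop: "runs (Pop x) s 1 (s(x := tl (s x)))"
  unfolding runs_def using exec_Pop by blast

lemma runs_Seq: "runs c s t s' \<Longrightarrow> runs d s' t' s'' \<Longrightarrow> runs (Seq c d) s (t + t') s''"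
  unfolding runs_def by (meson exec_Seq add_mono)

lemma runs_Branch_False: "s x = False # w \<Longrightarrow> runs d s t s' \<Longrightarrow> runs (Branch x c d e) s (Suc t) s'"
  unfolding runs_def by (meson exec_Branch_False Suc_le_mono)

lemma runs_Branch_True: "s x = True # w \<Longrightarrow> runs e s t s' \<Longrightarrow> runs (Branch x c d e) s (Suc t) s'"
  unfolding runs_def by (meson exec_Branch_True Suc_le_mono)

lemma runs_Branch_cons:
  "s x = b # w \<Longrightarrow> runs (if b then e else d) s t s' \<Longrightarrow> runs (Branch x c d e) s (Suc t) s'"
  by (cases b) (auto intro: runs_Branch_False runs_Branch_True)

lemma runs_While_empty: "s x = [] \<Longrightarrow> runs (While x c) s 1 s"
  unfolding runs_def using exec_While_empty by blast

lemma runs_While_step: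
  assumes "s x \<noteq> []" "runs c s t s'" "runs (While x c) s' t' s''"
  shows "runs (While x c) s (Suc (t + t')) s''"
proof -
  obtain m n where "m \<le> t" "exec c s m s'" "n \<le> t'" "exec (While x c) s' n s''"
    using assms unfolding runs_def by blast
  then show ?thesis
    unfolding runs_def using exec_While_step[of s x c m s' n s''] assms(1) by (intro exI[of _ "Suc (m + n)"]) auto
qed

lemma exec_length: "exec c s n s' \<Longrightarrow> length (s' x) \<le> length (s x) + n"
proof (induction rule: exec.induct)
  case (exec_Pop y s)
  then show ?case by (cases "s y") auto
qed auto

lemma runs_length: "runs c s t s' \<Longrightarrow> length (s' x) \<le> length (s x) + t"
  unfolding runs_def using exec_length by (meson add_left_mono le_trans)

primrec pushes :: "nat list \<Rightarrow> bool \<Rightarrow> prog" where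
  "pushes [] b = Skip"
| "pushes (j # js) b = Seq (Push j b) (pushes js b)"

definition pour :: "nat \<Rightarrow> nat list \<Rightarrow> prog" where
  "pour i js = While i (Branch i Skip (Seq (Pop i) (pushes js False)) (Seq (Pop i) (pushes js True)))"

lemma runs_pushes:
  "distinct js \<Longrightarrow> runs (pushes js b) s (1 + length js) (\<lambda>k. if k \<in> set js then b # s k else s k)"
proof (induction js arbitrary: s)
  case Nil
  show ?case using runs_Skip by simp
next
  case (Cons j js)
  have "(\<lambda>k. if k \<in> set js then b # (s(j := b # s j)) k else (s(j := b # s j)) k) =
      (\<lambda>k. if k \<in> set (j # js) then b # s k else s k)"
    using Cons.prems by (auto simp: fun_eq_iff)
  moreover from Cons.prems have "distinct js" by simp
  note Cons.IH[OF this, of "s(j := b # s j)"]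
  ultimately have "runs (pushes js b) (s(j := b # s j)) (1 + length js) (\<lambda>k. if k \<in> set (j # js) then b # s k else s k)"
    by (simp only:)
  from runs_Seq[OF runs_Push this] show ?case by simp
qed

lemma runs_pour:
  assumes "distinct (i # js)"
  shows "runs (pour i js) s ((4 + length js) * length (s i) + 1)
    (\<lambda>k. if k = i then [] else if k \<in> set js then rev (s i) @ s k else s k)"
proof (induction "s i" arbitrary: s)
  case Nil
  then have "(\<lambda>k. if k = i then [] else if k \<in> set js then rev (s i) @ s k else s k) = s"
    by (auto simp: fun_eq_iff)
  moreover have "runs (pour i js) s 1 s"
    unfolding pour_def using Nil by (intro runs_While_empty) simp
  ultimately show ?case using Nil by (metis add_0 list.size(3) mult_0_right)
next
  case (Cons b u)
  let ?s = "\<lambda>k. if k = i then u else if k \<in> set js then b # s k else s k"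
  have si: "s i = b # u" using Cons.hyps by simp
  have "(\<lambda>k. if k \<in> set js then b # (s(i := tl (s i))) k else (s(i := tl (s i))) k) = ?s"
    using assms si by (auto simp: fun_eq_iff)
  then have step: "runs (Seq (Pop i) (pushes js b)) s (1 + (1 + length js)) ?s"
    using runs_Seq[OF runs_Pop runs_pushes[of js b "s(i := tl (s i))"]] assms by simp
  have body: "runs (Branch i Skip (Seq (Pop i) (pushes js False)) (Seq (Pop i) (pushes js True))) s
      (Suc (1 + (1 + length js))) ?s"
    by (rule runs_Branch_cons[of s i b u, OF si]) (use step in \<open>cases b; simp\<close>)
  have "(\<lambda>k. if k = i then [] else if k \<in> set js then rev (?s i) @ ?s k else ?s k) =
      (\<lambda>k. if k = i then [] else if k \<in> set js then rev (s i) @ s k else s k)"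
    using assms si by (auto simp: fun_eq_iff)
  with Cons.hyps(1)[of ?s]
  have "runs (pour i js) ?s ((4 + length js) * length u + 1)
      (\<lambda>k. if k = i then [] else if k \<in> set js then rev (s i) @ s k else s k)" by simp
  from runs_While_step[OF _ body this[unfolded pour_def]] si show ?case
    unfolding pour_def by (auto elim!: runs_mono)
qed

text \<open>Stack 2 counts, in unary, the trees still to be read.\<close>

definition grab_loop :: "nat \<Rightarrow> prog" where
  "grab_loop d = While 2 (Branch 0 Skip
     (Seq (Pop 0) (Seq (Push d False) (Pop 2))) (Seq (Pop 0) (Seq (Push d True) (Push 2 True))))"

definition grab :: "nat \<Rightarrow> prog" where
  "grab d = Seq (Push 2 True) (grab_loop d)"

text \<open>The rest of the run is a hypothesis, in continuation style: for a \<open>Node\<close>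
  the run on the second subtree is the rest of the run on the first, so the induction needs no
  description of the loop halfway through a tree. Every bit costs one round of five steps.\<close>

lemma runs_grab_loop:
  assumes "d \<noteq> 0" "d \<noteq> 2"
    and "runs (grab_loop d) (s(0 := w, d := rev (bits_of_tree t) @ r, 2 := c)) n s'"
  shows "runs (grab_loop d) (s(0 := bits_of_tree t @ w, d := r, 2 := True # c))
    (n + 5 * length (bits_of_tree t)) s'"
  using assms(3)
proof (induction t arbitrary: w r c n)
  case Leaf
  let ?s = "s(0 := bits_of_tree Leaf @ w, d := r, 2 := True # c)"
  let ?s1 = "?s(0 := tl (?s 0))" let ?s2 = "?s1(d := False # ?s1 d)" let ?s3 = "?s2(2 := tl (?s2 2))"
  have "runs (Seq (Pop 0) (Seq (Push d False) (Pop 2))) ?s 3 ?s3"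
    by (rule runs_mono[OF runs_Seq[OF runs_Pop runs_Seq[OF runs_Push runs_Pop]]]) simp
  moreover have s3: "?s3 = s(0 := w, d := rev (bits_of_tree Leaf) @ r, 2 := c)"
    using assms(1,2) by (auto simp: fun_eq_iff)
  ultimately have b: "runs (Branch 0 Skip (Seq (Pop 0) (Seq (Push d False) (Pop 2)))
      (Seq (Pop 0) (Seq (Push d True) (Push 2 True)))) ?s (Suc 3) (s(0 := w, d := rev (bits_of_tree Leaf) @ r, 2 := c))"
    using assms(1,2) by (intro runs_Branch_False[where w = w]) auto
  from runs_While_step[OF _ b Leaf[unfolded grab_loop_def]]
  have "runs (grab_loop d) ?s (Suc (Suc 3 + n)) s'"
    unfolding grab_loop_def by simp
  then show ?case by (rule runs_mono) simp
next
  case (Node t1 t2)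
  let ?s = "s(0 := bits_of_tree (Node t1 t2) @ w, d := r, 2 := True # c)"
  let ?s1 = "?s(0 := tl (?s 0))" let ?s2 = "?s1(d := True # ?s1 d)" let ?s3 = "?s2(2 := True # ?s2 2)"
  let ?s' = "s(0 := bits_of_tree t1 @ bits_of_tree t2 @ w, d := True # r, 2 := True # True # c)"
  have "runs (Seq (Pop 0) (Seq (Push d True) (Push 2 True))) ?s 3 ?s3"
    by (rule runs_mono[OF runs_Seq[OF runs_Pop runs_Seq[OF runs_Push runs_Push]]]) simp
  moreover have s3: "?s3 = ?s'"
    using assms(1,2) by (auto simp: fun_eq_iff)
  ultimately have b: "runs (Branch 0 Skip (Seq (Pop 0) (Seq (Push d False) (Pop 2)))
      (Seq (Pop 0) (Seq (Push d True) (Push 2 True)))) ?s (Suc 3) ?s'"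
    using assms(1,2) by (intro runs_Branch_True[where w = "bits_of_tree t1 @ bits_of_tree t2 @ w"]) auto
  have "runs (grab_loop d) ?s' (n + 5 * length (bits_of_tree t2) + 5 * length (bits_of_tree t1)) s'"
    using Node.prems by (intro Node.IH) simp
  from runs_While_step[OF _ b this[unfolded grab_loop_def]]
  have "runs (grab_loop d) ?s (Suc (Suc 3 + (n + 5 * length (bits_of_tree t2) + 5 * length (bits_of_tree t1)))) s'"
    unfolding grab_loop_def by simp
  then show ?case by (rule runs_mono) simp
qed

lemma runs_grab:
  assumes "d \<noteq> 0" "d \<noteq> 2" "s 0 = bits_of_tree t @ w" "s 2 = []"
  shows "runs (grab d) s (2 + 5 * length (bits_of_tree t)) (s(0 := w, d := rev (bits_of_tree t) @ s d))"
proof -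
  let ?s = "s(0 := w, d := rev (bits_of_tree t) @ s d, 2 := [])"
  have "runs (grab_loop d) ?s 1 ?s"
    unfolding grab_loop_def by (intro runs_While_empty) simp
  from runs_grab_loop[OF assms(1,2) this]
  have 1: "runs (grab_loop d) (s(0 := bits_of_tree t @ w, d := s d, 2 := [True])) (1 + 5 * length (bits_of_tree t)) ?s" .
  have 2: "s(0 := bits_of_tree t @ w, d := s d, 2 := [True]) = s(2 := True # s 2)"
    using assms by (auto simp: fun_eq_iff)
  have 3: "?s = s(0 := w, d := rev (bits_of_tree t) @ s d)"
    using assms by (auto simp: fun_eq_iff)
  have "runs (grab d) s (1 + (1 + 5 * length (bits_of_tree t))) ?s"
    unfolding grab_def using 1 unfolding 2 by (intro runs_Seq[OF runs_Push])
  then show ?thesis unfolding 3 by (rule runs_mono) simp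
qed

text \<open>Every \<open>grab\<close> and every \<open>pour\<close> reverses. After
  \<open>pour 1 [0, 3]\<close> both targets hold the tree in reading order, so the second copy has
  to pass through stack 1 again before it goes onto stack 0.\<close>

definition dup :: prog where
  "dup = Seq (grab 1) (Seq (pour 1 [0, 3]) (Seq (pour 3 [1]) (pour 1 [0])))"

definition swap :: prog where
  "swap = Seq (grab 1) (Seq (grab 3) (Seq (pour 1 [0]) (pour 3 [0])))"

definition drop_tree :: prog where
  "drop_tree = Seq (grab 1) (pour 1 [])"

lemma runs_dup:
  assumes "s 0 = bits_of_tree t @ w" "s 1 = []" "s 2 = []" "s 3 = []"
  shows "runs dup s (5 + 21 * length (bits_of_tree t)) (s(0 := bits_of_tree t @ bits_of_tree t @ w))"
proof -
  let ?b = "bits_of_tree t"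
  let ?s1 = "s(0 := w, 1 := rev ?b)"
  let ?s2 = "s(0 := ?b @ w, 3 := ?b)"
  let ?s3 = "s(0 := ?b @ w, 1 := rev ?b)"
  let ?s4 = "s(0 := ?b @ ?b @ w)"
  have "runs (grab 1) s (2 + 5 * length ?b) ?s1"
    using runs_grab[OF _ _ assms(1,3), of 1] assms(2) by simp
  moreover have "(\<lambda>k. if k = 1 then [] else if k \<in> set [0, 3] then rev (?s1 1) @ ?s1 k else ?s1 k) = ?s2"
    using assms by (auto simp: fun_eq_iff)
  then have "runs (pour 1 [0, 3]) ?s1 (6 * length ?b + 1) ?s2"
    using runs_pour[of 1 "[0, 3]" ?s1] by simp
  moreover have "(\<lambda>k. if k = 3 then [] else if k \<in> set [1] then rev (?s2 3) @ ?s2 k else ?s2 k) = ?s3"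
    using assms by (auto simp: fun_eq_iff)
  then have "runs (pour 3 [1]) ?s2 (5 * length ?b + 1) ?s3"
    using runs_pour[of 3 "[1]" ?s2] by simp
  moreover have "(\<lambda>k. if k = 1 then [] else if k \<in> set [0] then rev (?s3 1) @ ?s3 k else ?s3 k) = ?s4"
    using assms by (auto simp: fun_eq_iff)
  then have "runs (pour 1 [0]) ?s3 (5 * length ?b + 1) ?s4"
    using runs_pour[of 1 "[0]" ?s3] by simp
  ultimately have "runs dup s ((2 + 5 * length ?b) + ((6 * length ?b + 1) +
      ((5 * length ?b + 1) + (5 * length ?b + 1)))) ?s4"
    unfolding dup_def by (intro runs_Seq)
  then show ?thesis by (rule runs_mono) simp
qed

lemma runs_swap:
  assumes "s 0 = bits_of_tree t @ bits_of_tree u @ w" "s 1 = []" "s 2 = []" "s 3 = []"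
  shows "runs swap s (6 + 10 * (length (bits_of_tree t) + length (bits_of_tree u)))
    (s(0 := bits_of_tree u @ bits_of_tree t @ w))"
proof -
  let ?b = "bits_of_tree t" let ?c = "bits_of_tree u"
  let ?s1 = "s(0 := ?c @ w, 1 := rev ?b)"
  let ?s2 = "s(0 := w, 1 := rev ?b, 3 := rev ?c)"
  let ?s3 = "s(0 := ?b @ w, 3 := rev ?c)"
  let ?s4 = "s(0 := ?c @ ?b @ w)"
  have "runs (grab 1) s (2 + 5 * length ?b) ?s1"
    using runs_grab[OF _ _ assms(1,3), of 1] assms(2) by simp
  moreover have "runs (grab 3) ?s1 (2 + 5 * length ?c) ?s2"
    using runs_grab[of 3 ?s1 u w] assms by (simp add: fun_upd_twist)
  moreover have "(\<lambda>k. if k = 1 then [] else if k \<in> set [0] then rev (?s2 1) @ ?s2 k else ?s2 k) = ?s3"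
    using assms by (auto simp: fun_eq_iff)
  then have "runs (pour 1 [0]) ?s2 (5 * length ?b + 1) ?s3"
    using runs_pour[of 1 "[0]" ?s2] by simp
  moreover have "(\<lambda>k. if k = 3 then [] else if k \<in> set [0] then rev (?s3 3) @ ?s3 k else ?s3 k) = ?s4"
    using assms by (auto simp: fun_eq_iff)
  then have "runs (pour 3 [0]) ?s3 (5 * length ?c + 1) ?s4"
    using runs_pour[of 3 "[0]" ?s3] by simp
  ultimately have "runs swap s ((2 + 5 * length ?b) + ((2 + 5 * length ?c) +
      ((5 * length ?b + 1) + (5 * length ?c + 1)))) ?s4"
    unfolding swap_def by (intro runs_Seq)
  then show ?thesis by (rule runs_mono) simp
qed

lemma runs_drop_tree:
  assumes "s 0 = bits_of_tree t @ w" "s 1 = []" "s 2 = []"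
  shows "runs drop_tree s (3 + 9 * length (bits_of_tree t)) (s(0 := w))"
proof -
  let ?b = "bits_of_tree t"
  let ?s1 = "s(0 := w, 1 := rev ?b)"
  have "runs (grab 1) s (2 + 5 * length ?b) ?s1"
    using runs_grab[OF _ _ assms(1,3), of 1] assms(2) by simp
  moreover have "(\<lambda>k. if k = 1 then [] else if k \<in> set [] then rev (?s1 1) @ ?s1 k else ?s1 k) = s(0 := w)"
    using assms by (auto simp: fun_eq_iff)
  then have "runs (pour 1 []) ?s1 (4 * length ?b + 1) (s(0 := w))"
    using runs_pour[of 1 "[]" ?s1] by simp
  ultimately have "runs drop_tree s ((2 + 5 * length ?b) + (4 * length ?b + 1)) (s(0 := w))"
    unfolding drop_tree_def by (intro runs_Seq)
  then show ?thesis by (rule runs_mono) simp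
qed

primrec push_bits :: "bool list \<Rightarrow> prog" where
  "push_bits [] = Skip"
| "push_bits (b # u) = Seq (push_bits u) (Push 0 b)"

lemma runs_push_bits: "runs (push_bits u) s (1 + length u) (s(0 := u @ s 0))"
proof (induction u)
  case Nil
  show ?case using runs_Skip by simp
next
  case (Cons b u)
  have "(s(0 := u @ s 0))(0 := b # (s(0 := u @ s 0)) 0) = s(0 := (b # u) @ s 0)" by simp
  with runs_Seq[OF Cons runs_Push[of 0 b]]
  have "runs (push_bits (b # u)) s (1 + length u + 1) (s(0 := (b # u) @ s 0))"
    unfolding push_bits.simps by (simp only:)
  then show ?case by (rule runs_mono) simp
qed

section \<open>Polynomial time functions on encodable types\<close>

definition aux_empty :: "nat \<Rightarrow> store \<Rightarrow> bool" where
  "aux_empty k s \<longleftrightarrow> (\<forall>i. 0 < i \<and> i < k \<longrightarrow> s i = [])"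

lemma aux_empty_upd [simp]: "aux_empty k (s(0 := u)) \<longleftrightarrow> aux_empty k s"
  by (auto simp: aux_empty_def)

lemma aux_empty_mono: "aux_empty k s \<Longrightarrow> k' \<le> k \<Longrightarrow> aux_empty k' s"
  by (auto simp: aux_empty_def)

text \<open>Whatever lies below the argument on stack 0 is kept, so programs can be composed without
  renaming stacks; only the stacks that control the loops have to be kept apart, by the level \<open>k\<close>.\<close>

definition does :: "prog \<Rightarrow> nat \<Rightarrow> bool list \<Rightarrow> nat \<Rightarrow> bool list \<Rightarrow> bool" where
  "does c k u t v \<longleftrightarrow> (\<forall>s. aux_empty k s \<longrightarrow> s 0 = u \<longrightarrow> runs c s t (s(0 := v)))"

lemma doesD: "does c k u t v \<Longrightarrow> aux_empty k s \<Longrightarrow> s 0 = u \<Longrightarrow> runs c s t (s(0 := v))"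
  by (simp add: does_def)

lemma does_mono: "does c k u t v \<Longrightarrow> k \<le> k' \<Longrightarrow> t \<le> t' \<Longrightarrow> does c k' u t' v"
  unfolding does_def by (blast intro: aux_empty_mono runs_mono)

lemma does_Skip: "does Skip k u 1 u"
  unfolding does_def using runs_Skip by (metis fun_upd_triv)

lemma does_Push: "does (Push 0 b) k u 1 (b # u)"
  unfolding does_def using runs_Push by metis

lemma does_Pop: "does (Pop 0) k (b # u) 1 u"
  unfolding does_def using runs_Pop by (metis list.sel(3))

lemma does_push_bits: "does (push_bits v) k u (1 + length v) (v @ u)"
  unfolding does_def using runs_push_bits by metis

lemma does_Seq:
  assumes "does c k u t v" "does d k v t' w"
  shows "does (Seq c d) k u (t + t') w"
  unfolding does_def
proof (intro allI impI)
  fix s assume s: "aux_empty k s" "s 0 = u"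
  have "runs c s t (s(0 := v))" using assms(1) s by (rule doesD)
  moreover have "runs d (s(0 := v)) t' ((s(0 := v))(0 := w))"
    using assms(2) by (rule doesD) (use s in simp_all)
  ultimately show "runs (Seq c d) s (t + t') (s(0 := w))"
    using runs_Seq by fastforce
qed

lemma does_Branch_False: "does d k (False # u) t v \<Longrightarrow> does (Branch 0 c d e) k (False # u) (Suc t) v"
  unfolding does_def using runs_Branch_False by metis

lemma does_Branch_True: "does e k (True # u) t v \<Longrightarrow> does (Branch 0 c d e) k (True # u) (Suc t) v"
  unfolding does_def using runs_Branch_True by metis

lemma does_dup:
  "4 \<le> k \<Longrightarrow> does dup k (bits_of_tree t @ u) (5 + 21 * length (bits_of_tree t))
     (bits_of_tree t @ bits_of_tree t @ u)"
  unfolding does_def by (auto simp: aux_empty_def intro!: runs_dup)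

lemma does_swap:
  "4 \<le> k \<Longrightarrow> does swap k (bits_of_tree t @ bits_of_tree t' @ u)
     (6 + 10 * (length (bits_of_tree t) + length (bits_of_tree t'))) (bits_of_tree t' @ bits_of_tree t @ u)"
  unfolding does_def using runs_swap by (simp add: aux_empty_def)

lemma does_drop_tree:
  "4 \<le> k \<Longrightarrow> does drop_tree k (bits_of_tree t @ u) (3 + 9 * length (bits_of_tree t)) u"
  unfolding does_def by (auto simp: aux_empty_def intro!: runs_drop_tree)

section \<open>Bit length of codes and bounds polynomial in it\<close>

class enc =
  fixes enc :: "'a \<Rightarrow> tree"
  assumes enc_inject: "enc x = enc y \<longleftrightarrow> x = y"

abbreviation enc_bits :: "'a::enc \<Rightarrow> bool list" where
  "enc_bits x \<equiv> bits_of_tree (enc x)"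

definition sz :: "'a::enc \<Rightarrow> nat" where
  "sz x = length (enc_bits x)"

definition pbound :: "('a::enc \<Rightarrow> nat) \<Rightarrow> bool" where
  "pbound t \<longleftrightarrow> (\<exists>q :: nat poly. \<forall>x. t x \<le> poly q (sz x))"

text \<open>All coefficients are nonnegative. Monotonicity is what lets a bound at the size of an
  argument be replaced by one at any larger size.\<close>

lemma poly_nat_mono: "m \<le> n \<Longrightarrow> poly (q :: nat poly) m \<le> poly q n"
  by (induction q) (auto intro: add_mono mult_mono)

lemma pb_le: "pbound u \<Longrightarrow> (\<And>x. t x \<le> u x) \<Longrightarrow> pbound t"
  unfolding pbound_def by (meson le_trans)

lemma pb_const: "pbound (\<lambda>_. n)"
  unfolding pbound_def by (rule exI[of _ "[:n:]"]) simp

lemma pb_sz: "pbound sz"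
  unfolding pbound_def by (rule exI[of _ "[:0, 1:]"]) simp

lemma pb_add: "pbound t \<Longrightarrow> pbound u \<Longrightarrow> pbound (\<lambda>x. t x + u x)"
  unfolding pbound_def by (metis (no_types, lifting) add_mono poly_add)

lemma pb_mult: "pbound t \<Longrightarrow> pbound u \<Longrightarrow> pbound (\<lambda>x. t x * u x)"
  unfolding pbound_def by (metis (no_types, lifting) mult_le_mono poly_mult)

lemma pb_Suc: "pbound t \<Longrightarrow> pbound (\<lambda>x. Suc (t x))"
  using pb_add[OF _ pb_const[of 1], of t] by simp

lemma pb_poly: "pbound t \<Longrightarrow> pbound (\<lambda>x. poly q (t x))"
  unfolding pbound_def
proof (elim exE)
  fix r assume "\<forall>x. t x \<le> poly r (sz x)"
  then show "\<exists>r. \<forall>x. poly q (t x) \<le> poly r (sz x)"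
    by (intro exI[of _ "pcompose q r"]) (simp add: poly_pcompose poly_nat_mono)
qed

lemma pb_comp: "pbound t \<Longrightarrow> pbound (\<lambda>x. sz (f x)) \<Longrightarrow> pbound (\<lambda>x. t (f x))"
proof -
  assume "pbound t" and f: "pbound (\<lambda>x. sz (f x))"
  then obtain q where "\<And>x. t x \<le> poly q (sz x)" unfolding pbound_def by blast
  then show ?thesis by (rule pb_le[OF pb_poly[OF f]])
qed

lemmas pb_intros = pb_const pb_sz pb_add pb_mult pb_Suc pb_poly

definition computes :: "prog \<Rightarrow> nat \<Rightarrow> ('a::enc \<Rightarrow> 'b::enc) \<Rightarrow> ('a \<Rightarrow> nat) \<Rightarrow> bool" where
  "computes c k f t \<longleftrightarrow>
     (\<forall>x w. does c k (enc_bits x @ w) (t x) (enc_bits (f x) @ w))"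

lemma computesD:
  "computes c k f t \<Longrightarrow> does c k (enc_bits x @ w) (t x) (enc_bits (f x) @ w)"
  by (simp add: computes_def)

lemma computes_mono:
  "computes c k f t \<Longrightarrow> k \<le> k' \<Longrightarrow> (\<And>x. t x \<le> t' x) \<Longrightarrow> computes c k' f t'"
  unfolding computes_def using does_mono by blast

text \<open>Stacks 1 to 3 are the scratch space of \<open>dup\<close>, \<open>swap\<close> and
  \<open>drop_tree\<close>, whence \<open>4 \<le> k\<close>. The level can stay hidden: compositions
  take the maximum of two levels, and only a loop claims a fresh stack.\<close>

definition pt :: "('a::enc \<Rightarrow> 'b::enc) \<Rightarrow> bool" where
  "pt f \<longleftrightarrow> (\<exists>c k t. 4 \<le> k \<and> pbound t \<and> computes c k f t)"

lemma ptI: "computes c k f t \<Longrightarrow> 4 \<le> k \<Longrightarrow> pbound t \<Longrightarrow> pt f"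
  unfolding pt_def by blast

lemma ptE:
  assumes "pt f" obtains c k t where "4 \<le> k" "pbound t" "computes c k f t"
  using assms unfolding pt_def by blast

text \<open>A step adds at most one bit to stack 0, so the running time bounds the growth from
  argument to result. All later size bounds on computed values come from here.\<close>

lemma pt_sz: 
  assumes "pt f" shows "pbound (\<lambda>x. sz (f x))"
proof -
  from assms obtain c k t where ct: "4 \<le> k" "pbound t" "computes c k f t" by (rule ptE)
  have "sz (f x) \<le> sz x + t x" for x
  proof -
    let ?s = "(\<lambda>_. [])(0 := enc_bits x @ [])"
    have "runs c ?s (t x) (?s(0 := enc_bits (f x) @ []))"
      by (rule doesD[OF computesD[OF ct(3)]]) (auto simp: aux_empty_def)
    from runs_length[OF this, of 0] show ?thesis by (simp add: sz_def)
  qed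
  then show ?thesis by (rule pb_le[OF pb_add[OF pb_sz ct(2)]])
qed

lemma pb_pt: "pbound t \<Longrightarrow> pt f \<Longrightarrow> pbound (\<lambda>x. t (f x))"
  by (rule pb_comp[OF _ pt_sz])

named_theorems pt_intros

text \<open>Programs see only codes. Hence a function between trees serves for any other types whose
  values have the same codes, and constructors, selectors and tags reduce to operations on
  trees.\<close>

lemma pt_recode:
  assumes "pt f" "\<And>x. enc (g x) = enc (f x)"
  shows "pt g"
  using assms unfolding pt_def computes_def by simp

lemma pt_id [pt_intros]: "pt (\<lambda>x. x)"
proof (rule ptI)
  show "computes Skip 4 (\<lambda>x. x) (\<lambda>_. 1)" by (simp add: computes_def does_Skip[simplified])
qed (auto intro: pb_const)

lemma pt_comp:
  assumes "pt g" "pt f"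
  shows "pt (\<lambda>x. g (f x))"
proof -
  from assms obtain c k t d l u where
    f: "4 \<le> k" "pbound t" "computes c k f t" and g: "4 \<le> l" "pbound u" "computes d l g u"
    by (metis ptE)
  show ?thesis
  proof (rule ptI)
    show "computes (Seq c d) (max k l) (\<lambda>x. g (f x)) (\<lambda>x. t x + u (f x))"
      unfolding computes_def
      using computesD[OF computes_mono[OF f(3), of "max k l" t]]
        computesD[OF computes_mono[OF g(3), of "max k l" u]] by (auto intro!: does_Seq)
    show "pbound (\<lambda>x. t x + u (f x))"
      by (intro pb_add f pb_pt[OF g(2) assms(2)])
  qed (use f in simp)
qed

lemma pt_const [pt_intros]: "pt (\<lambda>_. a)"
proof (rule ptI)
  let ?b = "enc_bits a"
  show "computes (Seq drop_tree (push_bits ?b)) 4 (\<lambda>_. a) (\<lambda>x. (3 + 9 * sz x) + (1 + length ?b))"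
    unfolding computes_def sz_def by (intro allI does_Seq[OF does_drop_tree does_push_bits]) simp
qed (auto intro!: pb_intros)

instantiation prod :: (enc, enc) enc
begin
definition "enc z = Node (enc (fst z)) (enc (snd z))"
instance by standard (auto simp: enc_prod_def enc_inject prod_eq_iff)
end

lemma enc_Pair: "enc (a, b) = Node (enc a) (enc b)"
  by (simp add: enc_prod_def)

text \<open>\<open>g\<close> consumes one copy of the argument, the swap brings the other copy to
  the top for \<open>f\<close>, and the final \<open>Push 0 True\<close> is the head of a
  \<open>Node\<close> in Polish notation.\<close>

lemma pt_Pair [pt_intros]:
  assumes "pt f" "pt g"
  shows "pt (\<lambda>x. (f x, g x))"
proof -
  from assms obtain c k t d l u where
    f: "4 \<le> k" "pbound t" "computes c k f t" and g: "4 \<le> l" "pbound u" "computes d l g u"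
    by (metis ptE)
  let ?m = "max k l"
  let ?c = "Seq dup (Seq d (Seq swap (Seq c (Push 0 True))))"
  let ?t = "\<lambda>x. (5 + 21 * sz x) + (u x + ((6 + 10 * (sz (g x) + sz x)) + (t x + 1)))"
  note f' = computesD[OF computes_mono[OF f(3), of ?m t]]
  note g' = computesD[OF computes_mono[OF g(3), of ?m u]]
  have "does ?c ?m (enc_bits x @ w) (?t x) (enc_bits (f x, g x) @ w)" for x w
    unfolding sz_def
    apply (rule does_Seq[OF does_dup])
    using f(1) apply simp
    apply (rule does_Seq[OF g'])
      apply simp
     apply simp
    apply (rule does_Seq[OF does_swap])
    using f(1) apply simp
    apply (rule does_Seq[OF f'])
      apply simp
     apply simp
    using does_Push[of True] by (simp add: enc_Pair)
  then show ?thesis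
    by (intro ptI[of ?c ?m _ ?t])
      (use f(1) in \<open>auto simp: computes_def intro!: pb_intros f g pt_sz assms\<close>)
qed

instantiation tree :: enc
begin
definition "enc t = (t::tree)"
instance by standard (simp add: enc_tree_def)
end

instantiation bool :: enc
begin
definition "enc b = tree_bool b"
instance by standard (auto simp: enc_bool_def tree_bool_def)
end

lemma enc_bool_simps: "enc True = Node Leaf Leaf" "enc False = Leaf"
  by (simp_all add: enc_bool_def tree_bool_def)

lemma pt_enc: "pt enc"
  by (rule pt_recode[OF pt_id]) (simp add: enc_tree_def)

primrec lft :: "tree \<Rightarrow> tree" where
  "lft Leaf = Leaf"
| "lft (Node s t) = s"

primrec rgt :: "tree \<Rightarrow> tree" where
  "rgt Leaf = Leaf"
| "rgt (Node s t) = t"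

lemma pt_is_Leaf0: "pt (\<lambda>t. t = Leaf)"
proof (rule ptI)
  \<comment> \<open>\<open>[True, False, False]\<close> is the code of the truth value
    \<open>True\<close>, and \<open>[False]\<close> that of \<open>False\<close>.\<close>
  let ?c = "Branch 0 Skip (Seq (Pop 0) (push_bits [True, False, False])) (Seq drop_tree (push_bits [False]))"
  let ?t = "\<lambda>t::tree. Suc (3 + 9 * sz t + 5)"
  have "does ?c 4 (bits_of_tree t @ w) (?t t) (enc_bits (t = Leaf) @ w)" for t w
  proof (cases t)
    case Leaf
    have "does (Seq (Pop 0) (push_bits [True, False, False])) 4 (False # w) (1 + (1 + length [True, False, False]))
      ([True, False, False] @ w)"
      by (rule does_Seq[OF does_Pop does_push_bits])
    from does_Branch_False[OF this, of Skip "Seq drop_tree (push_bits [False])"] Leaf show ?thesis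
      by (auto simp: enc_bool_simps simp del: push_bits.simps elim!: does_mono)
  next
    case (Node a b)
    have "does (Seq drop_tree (push_bits [False])) 4 (bits_of_tree t @ w)
        ((3 + 9 * length (bits_of_tree t)) + (1 + length [False])) ([False] @ w)"
      by (rule does_Seq[OF does_drop_tree does_push_bits]) simp
    then have "does ?c 4 (True # bits_of_tree a @ bits_of_tree b @ w)
      (Suc ((3 + 9 * length (bits_of_tree t)) + (1 + length [False]))) ([False] @ w)"
      unfolding Node by (intro does_Branch_True) simp
    then show ?thesis using Node
      by (auto simp: enc_bool_simps sz_def enc_tree_def simp del: push_bits.simps elim!: does_mono)
  qed
  then show "computes ?c 4 (\<lambda>t. t = Leaf) ?t" by (simp add: computes_def enc_tree_def)
qed (auto intro!: pb_intros)

lemma pt_lft0: "pt lft"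
proof (rule ptI)
  let ?c = "Branch 0 Skip Skip (Seq (Pop 0) (Seq swap drop_tree))"
  let ?t = "\<lambda>t::tree. Suc (1 + ((6 + 10 * sz t) + (3 + 9 * sz t)))"
  have "does ?c 4 (bits_of_tree t @ w) (?t t) (bits_of_tree (lft t) @ w)" for t w
  proof (cases t)
    case Leaf
    show ?thesis unfolding Leaf
      using does_mono[OF does_Branch_False[OF does_Skip], where k = 4 and k' = 4] by simp
  next
    case (Node a b)
    have "does (Seq (Pop 0) (Seq swap drop_tree)) 4 (True # bits_of_tree a @ bits_of_tree b @ w)
       (1 + ((6 + 10 * (length (bits_of_tree a) + length (bits_of_tree b))) + (3 + 9 * length (bits_of_tree b))))
       (bits_of_tree a @ w)"
      by (rule does_Seq[OF does_Pop does_Seq[OF does_swap does_drop_tree]]) simp_all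
    from does_Branch_True[OF this, of Skip Skip] show ?thesis unfolding Node
      by (auto simp: sz_def enc_tree_def elim!: does_mono)
  qed
  then show "computes ?c 4 lft ?t" by (simp add: computes_def enc_tree_def)
qed (auto intro!: pb_intros)

lemma pt_rgt0: "pt rgt"
proof (rule ptI)
  let ?c = "Branch 0 Skip Skip (Seq (Pop 0) drop_tree)"
  let ?t = "\<lambda>t::tree. Suc (1 + (3 + 9 * sz t))"
  have "does ?c 4 (bits_of_tree t @ w) (?t t) (bits_of_tree (rgt t) @ w)" for t w
  proof (cases t)
    case Leaf
    show ?thesis unfolding Leaf
      using does_mono[OF does_Branch_False[OF does_Skip], where k = 4 and k' = 4] by simp
  next
    case (Node a b)
    have "does (Seq (Pop 0) drop_tree) 4 (True # bits_of_tree a @ bits_of_tree b @ w)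
       (1 + (3 + 9 * length (bits_of_tree a))) (bits_of_tree b @ w)"
      by (rule does_Seq[OF does_Pop does_drop_tree]) simp_all
    from does_Branch_True[OF this, of Skip Skip] show ?thesis unfolding Node
      by (auto simp: sz_def enc_tree_def elim!: does_mono)
  qed
  then show "computes ?c 4 rgt ?t" by (simp add: computes_def enc_tree_def)
qed (auto intro!: pb_intros)

lemmas pt_is_Leaf = pt_comp[OF pt_is_Leaf0]
lemmas pt_lft = pt_comp[OF pt_lft0]
lemmas pt_rgt = pt_comp[OF pt_rgt0]

lemma pt_if [pt_intros]:
  assumes "pt b" "pt f" "pt g"
  shows "pt (\<lambda>x. if b x then f x else g x)"
proof -
  from assms obtain ct kt tt cf kf tf cg kg tg where
    b: "4 \<le> kt" "pbound tt" "computes ct kt b tt" and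
    f: "4 \<le> kf" "pbound tf" "computes cf kf f tf" and g: "4 \<le> kg" "pbound tg" "computes cg kg g tg"
    by (metis ptE)
  let ?m = "max kt (max kf kg)"
  \<comment> \<open>The result of the test is removed before going on: its code has one bit for
    \<open>False\<close> and three bits for \<open>True\<close>.\<close>
  let ?br = "Branch 0 Skip (Seq (Pop 0) cg) (Seq (Pop 0) (Seq (Pop 0) (Seq (Pop 0) cf)))"
  let ?c = "Seq dup (Seq ct ?br)"
  let ?t = "\<lambda>x. (5 + 21 * sz x) + (tt x + (4 + tf x + tg x))"
  let ?r = "\<lambda>x. if b x then f x else g x"
  note b' = computesD[OF computes_mono[OF b(3), of ?m tt]]
  note f' = computesD[OF computes_mono[OF f(3), of ?m tf]]
  note g' = computesD[OF computes_mono[OF g(3), of ?m tg]]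
  have br: "does ?br ?m (enc_bits (b x) @ enc_bits x @ w) (4 + tf x + tg x)
      (enc_bits (?r x) @ w)" for x w
  proof (cases "b x")
    case True
    have "does ?br ?m (True # False # False # enc_bits x @ w) (Suc (1 + (1 + (1 + tf x))))
      (enc_bits (f x) @ w)"
      by (intro does_Branch_True does_Seq[OF does_Pop] f') simp_all
    then show ?thesis using True by (auto simp: enc_bool_simps elim!: does_mono)
  next
    case False
    have "does ?br ?m (False # enc_bits x @ w) (Suc (1 + tg x))
      (enc_bits (g x) @ w)"
      by (intro does_Branch_False does_Seq[OF does_Pop] g') simp_all
    then show ?thesis using False by (auto simp: enc_bool_simps elim!: does_mono)
  qed
  have "does ?c ?m (enc_bits x @ w) (?t x) (enc_bits (?r x) @ w)" for x w
    unfolding sz_def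
    apply (rule does_Seq[OF does_dup])
    using f(1) apply simp
    apply (rule does_Seq[OF b'])
      apply simp
     apply simp
    by (rule br)
  then show ?thesis
    by (intro ptI[of ?c ?m _ ?t])
      (use f(1) in \<open>auto simp: computes_def intro!: pb_intros f g b\<close>)
qed

text \<open>\<open>While\<close> can only test a stack for emptiness, and stack 0 also carries
  whatever lies below the argument. A flag on the separate stack \<open>K\<close> therefore controls
  the loop: it is popped at the start of a round and pushed again only if the test succeeds.\<close>

definition while_prog :: "nat \<Rightarrow> prog \<Rightarrow> prog \<Rightarrow> prog" where
  "while_prog K ct cf = Seq (Push K True) (While K (Seq (Pop K) (Seq dup (Seq ct
     (Branch 0 Skip (Pop 0) (Seq (Seq (Pop 0) (Seq (Pop 0) (Seq (Pop 0) cf))) (Push K True)))))))"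

text \<open>\<open>g\<close> is the effect of the whole loop, described by what a step preserves and
  by being the identity once the test fails. \<open>S\<close> bounds every reachable state and
  \<open>m0\<close> the number of rounds. Both depend on the input \<open>x\<close> only, so the
  product of rounds and cost per round stays polynomial.\<close>

lemma pt_while:
  fixes f g :: "'b::enc \<Rightarrow> 'b" and i :: "'a::enc \<Rightarrow> 'b"
  assumes i: "pt i" and "pt b" "pt f" and S: "pbound S" and m0: "pbound m0"
    and Inv0: "\<And>x. Inv x (i x)"
    and step: "\<And>x y. Inv x y \<Longrightarrow> b y \<Longrightarrow> Inv x (f y) \<and> m (f y) < m y \<and> g (f y) = g y"
    and stop: "\<And>x y. Inv x y \<Longrightarrow> \<not> b y \<Longrightarrow> g y = y"
    and m: "\<And>x. m (i x) \<le> m0 x" and size: "\<And>x y. Inv x y \<Longrightarrow> sz y \<le> S x"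
  shows "pt (\<lambda>x. g (i x))"
proof -
  from assms(1,2,3) obtain ci ki ti ct kt tt cf kf tf where
    i: "4 \<le> ki" "pbound ti" "computes ci ki i ti" and
    b: "4 \<le> kt" "pbound tt" "computes ct kt b tt" and
    f: "4 \<le> kf" "pbound tf" "computes cf kf f tf"
    by (metis ptE)
  from b(2) f(2) obtain qt qf where q: "\<And>x. tt x \<le> poly qt (sz x)" "\<And>x. tf x \<le> poly qf (sz x)"
    unfolding pbound_def by metis
  define K where "K = max ki (max kt kf)"
  have K: "4 \<le> K" "ki \<le> K" "kt \<le> K" "kf \<le> K" using b(1) by (auto simp: K_def)
  let ?f = "Seq (Pop 0) (Seq (Pop 0) (Seq (Pop 0) cf))"
  let ?br = "Branch 0 Skip (Pop 0) (Seq ?f (Push K True))"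
  let ?body = "Seq (Pop K) (Seq dup (Seq ct ?br))"
  let ?w = "While K ?body"
  \<comment> \<open>The cost of one round: copying, testing and executing the body, each at a state
    of size at most \<open>S x\<close>, and a constant for the control. The summand
    \<open>B x\<close> in \<open>loop\<close> pays for the last, failing test.\<close>
  define B where "B = (\<lambda>x. 1 + (5 + 21 * S x) + poly qt (S x) + poly qf (S x) + 10)"
  let ?B = "\<lambda>u. u @ [] :: bool list"
  have loop: "runs ?w (s(0 := enc_bits y @ w, K := [True])) (m y * B x + B x) (s(0 := enc_bits (g y) @ w))"
    if "Inv x y" "aux_empty (Suc K) s" for x y w s
    using that
  proof (induction "m y" arbitrary: y rule: less_induct)
    case less
    let ?b = "enc_bits y"
    let ?s = "s(0 := ?b @ w, K := [True])"
    have sK: "s K = []" "aux_empty K s" using less.prems(2) K by (auto simp: aux_empty_def)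
    have tt: "tt y \<le> poly qt (S x)" "tf y \<le> poly qf (S x)" "length ?b \<le> S x"
      using q[of y] poly_nat_mono[OF size[OF less.prems(1)]] size[OF less.prems(1)]
      by (auto simp: sz_def intro: le_trans)
    have "?s(K := tl (?s K)) = s(0 := ?b @ w)" using sK K by (auto simp: fun_eq_iff)
    with runs_Pop[of K ?s] have pop: "runs (Pop K) ?s 1 (s(0 := ?b @ w))" by simp
    have d: "runs dup (s(0 := ?b @ w)) (5 + 21 * length ?b) (s(0 := ?b @ ?b @ w))"
      using doesD[OF does_dup[OF K(1), of "enc y" w], of "s(0 := ?b @ w)"] sK by simp
    have c: "runs ct (s(0 := ?b @ ?b @ w)) (tt y) (s(0 := enc_bits (b y) @ ?b @ w))"
      using doesD[OF computesD[OF b(3), of y "?b @ w"], of "s(0 := ?b @ ?b @ w)"] sK K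
      by (simp add: aux_empty_mono[OF sK(2)])
    show ?case
    proof (cases "b y")
      case False
      have "does (Pop 0) K (False # ?b @ w) 1 (?b @ w)" by (rule does_Pop)
      from doesD[OF this, of "s(0 := False # ?b @ w)"] sK(2)
      have "runs (Pop 0) (s(0 := False # ?b @ w)) 1 (s(0 := ?b @ w))" by simp
      from runs_Branch_False[OF _ this]
      have br: "runs ?br (s(0 := enc_bits (b y) @ ?b @ w)) (Suc 1) (s(0 := ?b @ w))"
        using False by (simp add: enc_bool_simps)
      have body: "runs ?body ?s (1 + ((5 + 21 * length ?b) + (tt y + Suc 1))) (s(0 := ?b @ w))"
        by (rule runs_Seq[OF pop runs_Seq[OF d runs_Seq[OF c br]]])
      have stopw: "runs ?w (s(0 := ?b @ w)) 1 (s(0 := ?b @ w))"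
        by (rule runs_While_empty) (use sK K in simp)
      have "runs ?w ?s (Suc ((1 + ((5 + 21 * length ?b) + (tt y + Suc 1))) + 1)) (s(0 := ?b @ w))"
        by (rule runs_While_step[OF _ body stopw]) simp
      then show ?thesis unfolding stop[OF less.prems(1) False]
        by (rule runs_mono) (use tt in \<open>simp add: B_def\<close>)
    next
      case True
      note st = step[OF less.prems(1) True]
      let ?b' = "enc_bits (f y)"
      have "does ?f K (True # False # False # ?b @ w) (1 + (1 + (1 + tf y))) (?b' @ w)"
        by (intro does_Seq[OF does_Pop] does_mono[OF computesD[OF f(3)]]) (use K in simp_all)
      from doesD[OF this, of "s(0 := True # False # False # ?b @ w)"] sK(2)
      have f3: "runs ?f (s(0 := True # False # False # ?b @ w)) (1 + (1 + (1 + tf y))) (s(0 := ?b' @ w))"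
        by simp
      have "(s(0 := ?b' @ w))(K := True # (s(0 := ?b' @ w)) K) = s(0 := ?b' @ w, K := [True])"
        using sK K by (auto simp: fun_eq_iff)
      with runs_Push[of K True "s(0 := ?b' @ w)"]
      have "runs (Push K True) (s(0 := ?b' @ w)) 1 (s(0 := ?b' @ w, K := [True]))" by simp
      from runs_Branch_True[OF _ runs_Seq[OF f3 this]]
      have br: "runs ?br (s(0 := enc_bits (b y) @ ?b @ w)) (Suc ((1 + (1 + (1 + tf y))) + 1))
          (s(0 := ?b' @ w, K := [True]))"
        using True by (simp add: enc_bool_simps)
      have body: "runs ?body ?s (1 + ((5 + 21 * length ?b) + (tt y + Suc ((1 + (1 + (1 + tf y))) + 1))))
          (s(0 := ?b' @ w, K := [True]))"
        by (rule runs_Seq[OF pop runs_Seq[OF d runs_Seq[OF c br]]])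
      have "runs ?w (s(0 := ?b' @ w, K := [True])) (m (f y) * B x + B x) (s(0 := enc_bits (g y) @ w))"
        using less.hyps[of "f y"] st less.prems(2) by simp
      from runs_While_step[OF _ body this]
      have "runs ?w ?s (Suc ((1 + ((5 + 21 * length ?b) + (tt y + Suc ((1 + (1 + (1 + tf y))) + 1)))) +
          (m (f y) * B x + B x))) (s(0 := enc_bits (g y) @ w))" by simp
      moreover have "Suc (1 + ((5 + 21 * length ?b) + (tt y + Suc ((1 + (1 + (1 + tf y))) + 1)))) \<le> B x"
        using tt by (simp add: B_def)
      moreover have "Suc (m (f y)) * B x \<le> m y * B x"
        using st by (intro mult_le_mono1) simp
      ultimately show ?thesis by (auto elim!: runs_mono)
    qed
  qed
  have "does (while_prog K ct cf) (Suc K) (enc_bits (i x) @ w) (1 + (m0 x * B x + B x))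
      (enc_bits (g (i x)) @ w)" for x w
    unfolding does_def
  proof (intro allI impI)
    fix s assume s: "aux_empty (Suc K) s" "s 0 = enc_bits (i x) @ w"
    have "s(K := True # s K) = s(0 := enc_bits (i x) @ w, K := [True])"
      using s K by (auto simp: fun_eq_iff aux_empty_def)
    with runs_Push[of K True s]
    have push: "runs (Push K True) s 1 (s(0 := enc_bits (i x) @ w, K := [True]))" by simp
    have "runs (while_prog K ct cf) s (1 + (m (i x) * B x + B x)) (s(0 := enc_bits (g (i x)) @ w))"
      unfolding while_prog_def by (rule runs_Seq[OF push loop[OF Inv0 s(1)]])
    then show "runs (while_prog K ct cf) s (1 + (m0 x * B x + B x)) (s(0 := enc_bits (g (i x)) @ w))"
      by (rule runs_mono) (simp add: m mult_le_mono1)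
  qed
  from does_Seq[OF does_mono[OF computesD[OF i(3)] _ order_refl] this]
  have "computes (Seq ci (while_prog K ct cf)) (Suc K) (\<lambda>x. g (i x)) (\<lambda>x. ti x + (1 + (m0 x * B x + B x)))"
    using K by (simp add: computes_def)
  moreover have "pbound (\<lambda>x. ti x + (1 + (m0 x * B x + B x)))"
    unfolding B_def by (intro pb_intros S m0 i)
  ultimately show ?thesis
    using K by (intro ptI[where k = "Suc K"]) simp_all
qed

subsection \<open>Products, truth values and equality\<close>

lemma pt_fst [pt_intros]: "pt f \<Longrightarrow> pt (\<lambda>x. fst (f x))"
  by (rule pt_comp[of fst]) (rule pt_recode[OF pt_lft[OF pt_enc]], simp add: enc_prod_def enc_tree_def)

lemma pt_snd [pt_intros]: "pt f \<Longrightarrow> pt (\<lambda>x. snd (f x))"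
  by (rule pt_comp[of snd]) (rule pt_recode[OF pt_rgt[OF pt_enc]], simp add: enc_prod_def enc_tree_def)

lemma pt_comp2: "pt (\<lambda>z. h (fst z) (snd z)) \<Longrightarrow> pt f \<Longrightarrow> pt g \<Longrightarrow> pt (\<lambda>x. h (f x) (g x))"
  using pt_comp[of "\<lambda>z. h (fst z) (snd z)" "\<lambda>x. (f x, g x)"] by (simp add: pt_Pair)

lemma pt_comp3:
  "pt (\<lambda>z. h (fst z) (fst (snd z)) (snd (snd z))) \<Longrightarrow> pt f \<Longrightarrow> pt g \<Longrightarrow> pt k \<Longrightarrow>
   pt (\<lambda>x. h (f x) (g x) (k x))"
  using pt_comp[of "\<lambda>z. h (fst z) (fst (snd z)) (snd (snd z))" "\<lambda>x. (f x, g x, k x)"]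
  by (simp add: pt_Pair)

lemma pt_case_prod [pt_intros]:
  "pt g \<Longrightarrow> pt (\<lambda>z. f (fst z) (fst (snd z)) (snd (snd z))) \<Longrightarrow> pt (\<lambda>x. case g x of (a, b) \<Rightarrow> f x a b)"
  unfolding case_prod_beta by (rule pt_comp3[of f]) (intro pt_intros | assumption)+

lemma pt_Let [pt_intros]: "pt g \<Longrightarrow> pt (\<lambda>z. f (fst z) (snd z)) \<Longrightarrow> pt (\<lambda>x. let y = g x in f x y)"
  unfolding Let_def by (rule pt_comp2[of f]) (intro pt_intros | assumption)+

lemma pt_Not [pt_intros]: "pt b \<Longrightarrow> pt (\<lambda>x. \<not> b x)"
  by (rule pt_recode[OF pt_if[OF _ pt_const[of False] pt_const[of True]]]) auto

lemma pt_conj [pt_intros]: "pt b \<Longrightarrow> pt c \<Longrightarrow> pt (\<lambda>x. b x \<and> c x)"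
  by (rule pt_recode[OF pt_if[of b c, OF _ _ pt_const[of False]]]) auto

instantiation list :: (enc) enc
begin
definition "enc xs = tree_list enc xs"
instance
  by standard (simp add: enc_list_def inj_eq[OF inj_tree_list] inj_def enc_inject)
end

lemma enc_Nil: "enc [] = Leaf" and enc_Cons: "enc (x # xs) = Node (enc x) (enc xs)"
  by (simp_all add: enc_list_def tree_list_def)

lemma enc_eq_Leaf_iff: "enc (xs :: 'a::enc list) = Leaf \<longleftrightarrow> xs = []"
  by (cases xs) (simp_all add: enc_Nil enc_Cons)

lemma sz_pos: "0 < sz x"
  by (cases "enc x") (simp_all add: sz_def)

lemma sz_Pair [simp]: "sz (a, b) = Suc (sz a + sz b)"
  by (simp add: sz_def enc_prod_def)

lemma sz_Nil [simp]: "sz [] = 1"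
  by (simp add: sz_def enc_Nil)

lemma sz_Cons [simp]: "sz (x # xs) = Suc (sz x + sz xs)"
  by (simp add: sz_def enc_Cons)

lemma sz_bool_le: "sz (b :: bool) \<le> 3"
  by (cases b) (simp_all add: sz_def enc_bool_simps)

lemma sz_append: "Suc (sz (xs @ ys)) = sz xs + sz ys"
  by (induction xs) simp_all

lemma length_le_sz: "length xs \<le> sz xs"
  by (induction xs) auto

lemma sz_mem: "y \<in> set xs \<Longrightarrow> sz y \<le> sz xs"
  by (induction xs) auto

lemma pt_Cons [pt_intros]: "pt f \<Longrightarrow> pt g \<Longrightarrow> pt (\<lambda>x. f x # g x)"
  by (rule pt_recode[OF pt_Pair]) (simp_all add: enc_Cons enc_prod_def)

lemma pt_tl [pt_intros]: "pt f \<Longrightarrow> pt (\<lambda>x. tl (f x))"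
proof (rule pt_comp[of tl])
  show "pt (tl :: 'b list \<Rightarrow> 'b list)"
  proof (rule pt_recode[OF pt_rgt[OF pt_enc]])
    fix xs :: "'b list" show "enc (tl xs) = enc (rgt (enc xs))"
      by (cases xs) (simp_all add: enc_Nil enc_Cons enc_tree_def)
  qed
qed

lemma pt_null: "pt f \<Longrightarrow> pt (\<lambda>x. f x = [])"
  unfolding enc_eq_Leaf_iff[symmetric] by (intro pt_is_Leaf pt_comp[OF pt_enc])

text \<open>The value \<open>hd []\<close> is unspecified but fixed, so that a program can output it as a constant.\<close>

lemma pt_hd: "pt f \<Longrightarrow> pt (\<lambda>x. hd (f x))"
proof (rule pt_comp[of hd])
  show "pt (hd :: 'b list \<Rightarrow> 'b)"
  proof (rule pt_recode)
    show "pt (\<lambda>xs :: 'b list. if xs = [] then enc (hd [] :: 'b) else lft (enc xs))"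
      by (intro pt_intros pt_null pt_lft pt_enc)
    fix xs :: "'b list" show "enc (hd xs) = enc (if xs = [] then enc (hd [] :: 'b) else lft (enc xs))"
      by (cases xs) (simp_all add: enc_Nil enc_Cons enc_tree_def)
  qed
qed

lemma pt_case_list [pt_intros]:
  assumes "pt g" "pt f" "pt (\<lambda>z. h (fst z) (fst (snd z)) (snd (snd z)))"
  shows "pt (\<lambda>x. case g x of [] \<Rightarrow> f x | y # ys \<Rightarrow> h x y ys)"
proof -
  have "(\<lambda>x. case g x of [] \<Rightarrow> f x | y # ys \<Rightarrow> h x y ys) =
      (\<lambda>x. if g x = [] then f x else h x (hd (g x)) (tl (g x)))"
    by (auto split: list.split)
  then show ?thesis
    by (simp only:) (intro pt_intros pt_null pt_comp3[OF assms(3)] pt_hd assms)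
qed

text \<open>A worklist of pairs still to be compared. A mismatch clears it, so that the loop ends at
  once with \<open>False\<close>.\<close>

definition eq_step :: "(tree \<times> tree) list \<times> bool \<Rightarrow> (tree \<times> tree) list \<times> bool" where
  "eq_step z = (case z of (ws, r) \<Rightarrow> case ws of [] \<Rightarrow> ([], r) | v # vs \<Rightarrow>
     if fst v = Leaf then if snd v = Leaf then (vs, r) else ([], False)
     else if snd v = Leaf then ([], False)
     else ((lft (fst v), lft (snd v)) # (rgt (fst v), rgt (snd v)) # vs, r))"

lemma pt_eq_tree: "pt (\<lambda>z :: tree \<times> tree. fst z = snd z)"
proof -
  define g :: "(tree \<times> tree) list \<times> bool \<Rightarrow> (tree \<times> tree) list \<times> bool"
    where "g = (\<lambda>(ws, r). ([], r \<and> (\<forall>v\<in>set ws. fst v = snd v)))"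
  \<comment> \<open>Splitting a pair of nodes leaves the size of the state unchanged, since the two
    lost \<open>Node\<close> bits pay for the additional pair and list cell. So the initial state
    bounds all states, while the total size of the left components drops.\<close>
  define m :: "(tree \<times> tree) list \<times> bool \<Rightarrow> nat"
    where "m = (\<lambda>(ws, r). (\<Sum>v\<leftarrow>ws. sz (fst v)))"
  have sz_tree: "sz Leaf = 1" "\<And>a b. sz (Node a b) = Suc (sz a + sz b)"
    by (simp_all add: sz_def enc_tree_def)
  have False_le: "sz False \<le> sz b" for b :: bool
    by (cases b) (simp_all add: sz_def enc_bool_simps)
  have "pt (\<lambda>z. g ([z], True))"
  proof (rule pt_while[where b = "\<lambda>z. fst z \<noteq> []" and f = eq_step and m = m
        and i = "\<lambda>z. ([z], True)" and Inv = "\<lambda>x y. sz y \<le> sz ([x], True)"])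
    show "pt (\<lambda>z :: (tree \<times> tree) list \<times> bool. fst z \<noteq> [])"
      by (intro pt_intros pt_null)
    show "pt eq_step"
      unfolding eq_step_def by (intro pt_intros pt_is_Leaf pt_lft pt_rgt)
    show "pbound (\<lambda>x :: tree \<times> tree. sz ([x], True))"
      by (intro pt_sz pt_intros)
    show "pbound (\<lambda>x :: tree \<times> tree. sz x)" by (rule pb_sz)
  next
    fix x :: "tree \<times> tree" and y :: "(tree \<times> tree) list \<times> bool"
    assume le: "sz y \<le> sz ([x], True)" and "fst y \<noteq> []"
    then obtain s t ws r where y: "y = ((s, t) # ws, r)" by (cases y; cases "fst y") auto
    have "sz (eq_step y) \<le> sz y \<and> m (eq_step y) < m y \<and> g (eq_step y) = g y"
      by (cases s; cases t) (use False_le[of r] in \<open>auto simp: y eq_step_def m_def g_def sz_tree sz_pos\<close>)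
    with le show "sz (eq_step y) \<le> sz ([x], True) \<and> m (eq_step y) < m y \<and> g (eq_step y) = g y"
      by simp
  qed (auto simp: g_def m_def intro!: pt_intros)
  then have "pt (\<lambda>z. snd (g ([z], True)))" by (rule pt_snd)
  then show ?thesis by (simp add: g_def)
qed

lemma pt_eq [pt_intros]: "pt f \<Longrightarrow> pt g \<Longrightarrow> pt (\<lambda>x. f x = g x)"
  using pt_comp2[of "(=)", OF pt_eq_tree pt_comp[OF pt_enc, of f] pt_comp[OF pt_enc, of g]]
  by (simp add: enc_inject)

subsection \<open>Folds\<close>

text \<open>A step computable in polynomial time may double the accumulator, and iterating it would
  then give exponential size. Hence the bound \<open>S\<close> is required after every prefix of the
  list, not only at the end.\<close>

lemma pt_fold:
  fixes h :: "'a::enc \<Rightarrow> 'b::enc \<Rightarrow> 'c::enc \<Rightarrow> 'c"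
  assumes xs: "pt xs" and a: "pt a" and h: "pt (\<lambda>z. h (fst z) (fst (snd z)) (snd (snd z)))"
    and S: "pbound S" and le: "\<And>x ys zs. xs x = ys @ zs \<Longrightarrow> sz (fold (h x) ys (a x)) \<le> S x"
  shows "pt (\<lambda>x. fold (h x) (xs x) (a x))"
proof -
  define f :: "('b list \<times> 'c) \<times> 'a \<Rightarrow> ('b list \<times> 'c) \<times> 'a" where
    "f = (\<lambda>z. case fst (fst z) of [] \<Rightarrow> z | y # ys \<Rightarrow> ((ys, h (snd z) y (snd (fst z))), snd z))"
  define g where "g = (\<lambda>z. (([] :: 'b list, fold (h (snd z)) (fst (fst z)) (snd (fst z))), snd z))"
  define Inv where "Inv = (\<lambda>x (z :: ('b list \<times> 'c) \<times> 'a).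
    snd z = x \<and> (\<exists>us. xs x = us @ fst (fst z) \<and> snd (fst z) = fold (h x) us (a x)))"
  have "pt (\<lambda>x. g ((xs x, a x), x))"
  proof (rule pt_while[where b = "\<lambda>z. fst (fst z) \<noteq> []" and f = f and m = "\<lambda>z. length (fst (fst z))"
        and i = "\<lambda>x. ((xs x, a x), x)" and Inv = Inv])
    show "pt (\<lambda>z :: ('b list \<times> 'c) \<times> 'a. fst (fst z) \<noteq> [])" by (intro pt_intros)
    show "pt f" unfolding f_def by (intro pt_intros pt_comp3[OF h])
    show "pbound (\<lambda>x. 2 + sz (xs x) + S x + sz x)" by (intro pb_intros pt_sz xs S)
    show "pbound (\<lambda>x. sz (xs x))" by (intro pt_sz xs)
  next
    fix x z assume "Inv x z"
    then obtain us where us: "snd z = x" "xs x = us @ fst (fst z)" "snd (fst z) = fold (h x) us (a x)"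
      by (auto simp: Inv_def)
    have "Suc (sz (xs x)) = sz us + sz (fst (fst z))"
      unfolding us(2) by (rule sz_append)
    then have "sz (fst (fst z)) \<le> sz (xs x)" using sz_pos[of us] by linarith
    moreover have "sz (snd (fst z)) \<le> S x" unfolding us(3) using us(2) by (rule le)
    moreover have "z = ((fst (fst z), snd (fst z)), x)" using us(1) by (cases z) auto
    then have "sz z = Suc (Suc (sz (fst (fst z)) + sz (snd (fst z))) + sz x)"
      by (metis sz_Pair)
    ultimately show "sz z \<le> 2 + sz (xs x) + S x + sz x" by simp
    assume "fst (fst z) \<noteq> []"
    then obtain y ys where "fst (fst z) = y # ys" by (cases "fst (fst z)") auto
    with us show "Inv x (f z) \<and> length (fst (fst (f z))) < length (fst (fst z)) \<and> g (f z) = g z"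
      by (auto simp: Inv_def f_def g_def intro!: exI[of _ "us @ [y]"])
  qed (auto simp: g_def Inv_def length_le_sz intro!: pt_intros xs a)
  then have "pt (\<lambda>x. snd (fst (g ((xs x, a x), x))))" by (intro pt_intros)
  then show ?thesis by (simp add: g_def)
qed

lemma pt_fold_inv:
  fixes h :: "'a::enc \<Rightarrow> 'b::enc \<Rightarrow> 'c::enc \<Rightarrow> 'c"
  assumes xs: "pt xs" and a: "pt a" and h: "pt (\<lambda>z. h (fst z) (fst (snd z)) (snd (snd z)))"
    and R: "pbound R" and I: "\<And>x. I x (a x)"
    and step: "\<And>x y b. y \<in> set (xs x) \<Longrightarrow> I x b \<Longrightarrow> I x (h x y b) \<and> sz (h x y b) \<le> sz b + R x"
  shows "pt (\<lambda>x. fold (h x) (xs x) (a x))"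
proof (rule pt_fold[OF xs a h])
  show "pbound (\<lambda>x. sz (a x) + sz (xs x) * R x)"
    by (intro pb_intros pt_sz xs a R)
  fix x ys zs assume eq: "xs x = ys @ zs"
  have "I x b \<Longrightarrow> I x (fold (h x) us b) \<and> sz (fold (h x) us b) \<le> sz b + length us * R x"
    if "set us \<subseteq> set (xs x)" for us b
    using that
  proof (induction us arbitrary: b)
    case (Cons u us)
    then show ?case using step[of u x b] by fastforce
  qed simp
  from this[of ys "a x"] I eq have "sz (fold (h x) ys (a x)) \<le> sz (a x) + length ys * R x" by simp
  also have "length ys \<le> sz (xs x)" using length_le_sz[of "xs x"] eq by simp
  finally show "sz (fold (h x) ys (a x)) \<le> sz (a x) + sz (xs x) * R x" by (simp add: mult_le_mono1)
qed

text \<open>If each step adds only an amount that depends on the parameter and the list element, and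
  not on the accumulator, then the growth over the whole fold is polynomial. Nearly all list
  operations below have this form.\<close>

lemma pt_fold_add:
  fixes h :: "'a::enc \<Rightarrow> 'b::enc \<Rightarrow> 'c::enc \<Rightarrow> 'c"
  assumes xs: "pt xs" and a: "pt a" and h: "pt (\<lambda>z. h (fst z) (fst (snd z)) (snd (snd z)))"
    and R: "pbound R" and step: "\<And>x y b. sz (h x y b) \<le> sz b + R (x, y)"
  shows "pt (\<lambda>x. fold (h x) (xs x) (a x))"
proof -
  obtain q where q: "\<And>z. R z \<le> poly q (sz z)" using R unfolding pbound_def by blast
  show ?thesis
  proof (rule pt_fold_inv[OF xs a h])
    \<comment> \<open>An element is no larger than the list that contains it, so one bound in terms
      of the whole list covers all rounds.\<close>
    show "pbound (\<lambda>x. poly q (Suc (sz x + sz (xs x))))"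
      by (intro pb_intros pt_sz xs)
    fix x y b assume "y \<in> set (xs x)"
    then have "sz (x, y) \<le> Suc (sz x + sz (xs x))" using sz_mem by fastforce
    then have "R (x, y) \<le> poly q (Suc (sz x + sz (xs x)))"
      using q[of "(x, y)"] poly_nat_mono le_trans by blast
    with step[of x y b] show "True \<and> sz (h x y b) \<le> sz b + poly q (Suc (sz x + sz (xs x)))" by simp
  qed simp
qed

lemma pt_rev [pt_intros]: "pt xs \<Longrightarrow> pt (\<lambda>x. rev (xs x))"
proof -
  assume "pt xs"
  then have "pt (\<lambda>x. fold Cons (xs x) [])"
    by (rule pt_fold_add[where R = "\<lambda>z. Suc (sz (snd z))"]) (auto intro!: pt_intros pb_intros pt_sz)
  then show ?thesis by (simp add: fold_Cons_rev)
qed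

lemma pt_foldr_add:
  fixes h :: "'a::enc \<Rightarrow> 'b::enc \<Rightarrow> 'c::enc \<Rightarrow> 'c"
  assumes "pt xs" "pt a" "pt (\<lambda>z. h (fst z) (fst (snd z)) (snd (snd z)))"
    "pbound R" "\<And>x y b. sz (h x y b) \<le> sz b + R (x, y)"
  shows "pt (\<lambda>x. foldr (h x) (xs x) (a x))"
  unfolding foldr_conv_fold by (rule pt_fold_add[OF pt_rev]) (fact assms)+

lemma pt_append [pt_intros]: "pt xs \<Longrightarrow> pt ys \<Longrightarrow> pt (\<lambda>x. xs x @ ys x)"
proof -
  assume "pt xs" "pt ys"
  then have "pt (\<lambda>x. foldr Cons (xs x) (ys x))"
    by (rule pt_foldr_add[where R = "\<lambda>z. Suc (sz (snd z))"]) (auto intro!: pt_intros pb_intros pt_sz)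
  moreover have "foldr Cons us vs = us @ vs" for us vs :: "'b list" by (induction us) auto
  ultimately show ?thesis by simp
qed

lemma pt_map [pt_intros]:
  assumes "pt xs" and f: "pt (\<lambda>z. f (fst z) (snd z))"
  shows "pt (\<lambda>x. map (f x) (xs x))"
proof -
  have "pt (\<lambda>x. foldr (\<lambda>y b. f x y # b) (xs x) [])"
    by (rule pt_foldr_add[where R = "\<lambda>z. Suc (sz (f (fst z) (snd z)))"])
      (auto intro!: pt_intros pb_intros pt_sz assms pt_comp2[OF f])
  moreover have "foldr (\<lambda>y b. f x y # b) us [] = map (f x) us" for us x by (induction us) auto
  ultimately show ?thesis by simp
qed

lemma pt_concat [pt_intros]: "pt xs \<Longrightarrow> pt (\<lambda>x. concat (xs x))"
proof -
  assume "pt xs"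
  then have "pt (\<lambda>x. foldr (@) (xs x) [])"
  proof (rule pt_foldr_add[where R = "\<lambda>z. sz (snd z)"])
    fix x :: 'a and y b :: "'b list" show "sz (y @ b) \<le> sz b + sz (snd (x, y))"
      using sz_append[of y b] by simp
  qed (auto intro!: pt_intros pb_intros pt_sz)
  moreover have "foldr (@) us [] = concat us" for us :: "'b list list" by (induction us) auto
  ultimately show ?thesis by simp
qed

lemma pt_Ball [pt_intros]:
  assumes "pt xs" and P: "pt (\<lambda>z. P (fst z) (snd z))"
  shows "pt (\<lambda>x. \<forall>y\<in>set (xs x). P x y)"
proof -
  have "pt (\<lambda>x. foldr (\<lambda>y b. P x y \<and> b) (xs x) True)"
  proof (rule pt_foldr_add[where R = "\<lambda>z. 3"])
    fix x y b show "sz (P x y \<and> b) \<le> sz b + 3" using sz_bool_le[of "P x y \<and> b"] by simp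
  qed (auto intro!: pt_intros pb_intros assms pt_comp2[OF P])
  moreover have "foldr (\<lambda>y b. P x y \<and> b) us True \<longleftrightarrow> (\<forall>y\<in>set us. P x y)" for us x
    by (induction us) auto
  ultimately show ?thesis by simp
qed

lemma pt_mem [pt_intros]: "pt f \<Longrightarrow> pt xs \<Longrightarrow> pt (\<lambda>x. f x \<in> set (xs x))"
proof -
  assume f: "pt f" and xs: "pt xs"
  have "pt (\<lambda>x. \<not> (\<forall>y\<in>set (xs x). \<not> y = f x))"
    by (intro pt_intros xs pt_comp[OF f])
  moreover have "(\<not> (\<forall>y\<in>set (xs x). \<not> y = f x)) = (f x \<in> set (xs x))" for x by auto
  ultimately show ?thesis by simp
qed

lemma pt_subset [pt_intros]: "pt xs \<Longrightarrow> pt ys \<Longrightarrow> pt (\<lambda>x. set (xs x) \<subseteq> set (ys x))"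
proof -
  assume xs: "pt xs" and ys: "pt ys"
  have "pt (\<lambda>x. \<forall>y\<in>set (xs x). y \<in> set (ys x))"
    by (intro pt_intros xs pt_comp[OF ys])
  then show ?thesis by (simp add: subset_eq)
qed

text \<open>The nonempty suffixes, shortest first. Mapping over them replaces recursion on a list;
  applied to a reversed script they pair each entry with its predecessors.\<close>

primrec suffs :: "'a list \<Rightarrow> 'a list list" where
  "suffs [] = []"
| "suffs (x # xs) = suffs xs @ [x # xs]"

lemma pt_suffs [pt_intros]: "pt xs \<Longrightarrow> pt (\<lambda>x. suffs (xs x))"
proof -
  assume xs: "pt xs"
  \<comment> \<open>The folded list acts only as a counter: every round records the current suffix
    and passes to its tail.\<close>
  have "pt (\<lambda>x. fold (\<lambda>_ z. (tl (fst z), fst z # snd z)) (xs x) (xs x, []))"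
  proof (rule pt_fold_inv[where R = "\<lambda>x. 2 + sz (xs x)" and I = "\<lambda>x z. sz (fst z) \<le> sz (xs x)"])
    fix x :: 'a and z :: "'b list \<times> 'b list list" assume le: "sz (fst z) \<le> sz (xs x)"
    obtain us vs where z: "z = (us, vs)" by fastforce
    have "sz (tl us) \<le> sz us" by (cases us) auto
    with le z show "sz (fst (tl (fst z), fst z # snd z)) \<le> sz (xs x) \<and>
        sz (tl (fst z), fst z # snd z) \<le> sz z + (2 + sz (xs x))" by simp
  qed (auto intro!: pt_intros pb_intros xs pt_sz)
  then have "pt (\<lambda>x. snd (fold (\<lambda>_ z. (tl (fst z), fst z # snd z)) (xs x) (xs x, [])))"
    by (rule pt_snd)
  moreover have "snd (fold (\<lambda>_ z. (tl (fst z), fst z # snd z)) us (us, vs)) = suffs us @ vs"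
    for us :: "'b list" and vs by (induction us arbitrary: vs) auto
  ultimately show ?thesis by simp
qed

instantiation option :: (enc) enc
begin
definition "enc x = (case x of None \<Rightarrow> Leaf | Some y \<Rightarrow> Node Leaf (enc y))"
instance by standard (auto simp: enc_option_def enc_inject split: option.splits)
end

lemma sz_option [simp]: "sz None = 1" "sz (Some y) = Suc (Suc (sz y))"
  by (simp_all add: sz_def enc_option_def)

lemma pt_Some [pt_intros]: "pt f \<Longrightarrow> pt (\<lambda>x. Some (f x))"
  by (rule pt_recode[OF pt_Pair[OF pt_const[of Leaf]]]) (simp_all add: enc_option_def enc_prod_def enc_tree_def)

lemma pt_case_option [pt_intros]:
  assumes "pt g" "pt f" "pt (\<lambda>z. h (fst z) (snd z))"
  shows "pt (\<lambda>x. case g x of None \<Rightarrow> f x | Some y \<Rightarrow> h x y)"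
proof -
  have "(\<lambda>x. case g x of None \<Rightarrow> f x | Some y \<Rightarrow> h x y) =
      (\<lambda>x. if g x = None then f x else h x (the (g x)))"
    by (auto split: option.split)
  moreover have "pt (the :: 'b option \<Rightarrow> 'b)"
  proof (rule pt_recode)
    show "pt (\<lambda>x :: 'b option. if x = None then enc (the None :: 'b) else rgt (enc x))"
      by (intro pt_intros pt_rgt pt_enc)
    fix x :: "'b option" show "enc (the x) = enc (if x = None then enc (the None :: 'b) else rgt (enc x))"
      by (cases x) (simp_all add: enc_option_def enc_tree_def)
  qed
  ultimately show ?thesis
    by (simp only:) (intro pt_intros pt_comp2[OF assms(3)] pt_comp[OF _ assms(1), of the] assms)
qed

primrec first_some :: "('a \<Rightarrow> 'b option) \<Rightarrow> 'a list \<Rightarrow> 'b option" where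
  "first_some f [] = None"
| "first_some f (x # xs) = (case f x of None \<Rightarrow> first_some f xs | Some y \<Rightarrow> Some y)"

lemma pt_first_some [pt_intros]:
  assumes "pt xs" and f: "pt (\<lambda>z. f (fst z) (snd z))"
  shows "pt (\<lambda>x. first_some (f x) (xs x))"
proof -
  have "pt (\<lambda>x. foldr (\<lambda>y b. case f x y of None \<Rightarrow> b | Some z \<Rightarrow> Some z) (xs x) None)"
    by (rule pt_foldr_add[where R = "\<lambda>z. sz (f (fst z) (snd z))"])
      (auto intro!: pt_intros pb_intros pt_sz assms pt_comp2[OF f] split: option.split)
  moreover have "foldr (\<lambda>y b. case f x y of None \<Rightarrow> b | Some z \<Rightarrow> Some z) us None = first_some (f x) us"
    for us x by (induction us) (auto split: option.split)
  ultimately show ?thesis by simp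
qed

subsection \<open>Numbers, literals and formulas\<close>

instantiation nat :: enc
begin
definition "enc n = tree_nat n"
instance by standard (simp add: enc_nat_def inj_eq[OF inj_tree_nat])
end

primrec inc :: "bool list \<Rightarrow> bool list" where
  "inc [] = [True]"
| "inc (b # u) = (if b then False # inc u else True # u)"

lemma binary_Suc: "binary (Suc n) = inc (binary n)"
proof (induction n rule: binary.induct)
  case (1 n)
  show ?case
  proof (cases "n = 0")
    case False
    then have eq: "binary n = odd n # binary (n div 2)" by (simp add: binary.simps)
    show ?thesis
    proof (cases "odd n")
      case True
      then have "Suc n div 2 = Suc (n div 2)" by presburger
      then show ?thesis using 1 False True eq by (simp add: binary.simps[of "Suc n"])
    next
      case False
      then have "Suc n div 2 = n div 2" by presburger
      then show ?thesis using False eq by (simp add: binary.simps[of "Suc n"])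
    qed
  qed (simp add: binary.simps)
qed

lemma enc_nat_binary: "enc n = enc (binary n)"
  by (simp add: enc_nat_def enc_list_def tree_nat_def enc_bool_def[abs_def])

text \<open>Ripple carry from the least significant bit: \<open>fst z\<close> is the carry and
  \<open>b \<noteq> fst z\<close> the sum bit. The sum bits pile up reversed, and a carry that
  survives becomes a new leading bit.\<close>

lemma inc_fold: "rev (let z = fold (\<lambda>b z. (fst z \<and> b, (b \<noteq> fst z) # snd z)) u (c, v)
    in if fst z then True # snd z else snd z) = rev v @ (if c then inc u else u)"
  by (induction u arbitrary: c v) (auto simp: Let_def)

lemma sz_inc: "sz (inc u) \<le> sz u + 4"
  by (induction u) (auto simp: sz_def enc_Cons enc_Nil enc_bool_simps)

lemma pt_Suc [pt_intros]: "pt f \<Longrightarrow> pt (\<lambda>x. Suc (f x))"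
proof (rule pt_comp[of Suc])
  have "pt (\<lambda>u. fold (\<lambda>b z. (fst z \<and> b, (b \<noteq> fst z) # snd z)) u (True, []))"
  proof (rule pt_fold_add[where R = "\<lambda>_. 10"])
    fix b and z :: "bool \<times> bool list"
    show "sz (fst z \<and> b, (b \<noteq> fst z) # snd z) \<le> sz z + 10"
      using sz_bool_le[of "fst z \<and> b"] sz_bool_le[of "b \<noteq> fst z"] by (cases z) simp
  qed (auto intro!: pt_intros pb_intros)
  then have "pt (\<lambda>u. rev (let z = fold (\<lambda>b z. (fst z \<and> b, (b \<noteq> fst z) # snd z)) u (True, [])
    in if fst z then True # snd z else snd z))"
    by (intro pt_intros)
  then have "pt inc" unfolding inc_fold by simp
  moreover have "pt binary" by (rule pt_recode[OF pt_id]) (simp add: enc_nat_binary)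
  ultimately have "pt (\<lambda>n. inc (binary n))" by (rule pt_comp)
  then show "pt Suc" by (rule pt_recode) (simp add: enc_nat_binary binary_Suc)
qed

lemma sz_Suc: "sz (Suc n) \<le> sz n + 4"
  using sz_inc[of "binary n"] by (simp add: sz_def enc_nat_binary binary_Suc)

primrec idx :: "'a \<Rightarrow> 'a list \<Rightarrow> nat" where
  "idx k [] = 0"
| "idx k (x # xs) = (if x = k then 0 else Suc (idx k xs))"

lemma pt_idx [pt_intros]: "pt f \<Longrightarrow> pt xs \<Longrightarrow> pt (\<lambda>x. idx (f x) (xs x))"
proof -
  assume f: "pt f" and xs: "pt xs"
  have "pt (\<lambda>x. foldr (\<lambda>y n. if y = f x then 0 else Suc n) (xs x) 0)"
  proof (rule pt_foldr_add[where R = "\<lambda>_. 5"])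
    fix x y and n :: nat
    have "sz (0::nat) = 1" by (simp add: sz_def enc_nat_binary binary.simps enc_Nil)
    then show "sz (if y = f x then 0 else Suc n) \<le> sz n + 5" using sz_Suc[of n] by auto
  qed (auto intro!: pt_intros pb_intros xs pt_comp[OF f])
  moreover have "foldr (\<lambda>y n. if y = f x then 0 else Suc n) us 0 = idx (f x) us" for us x
    by (induction us) auto
  ultimately show ?thesis by simp
qed

instantiation lit :: enc
begin
definition "enc p = tree_lit p"
instance by standard (simp add: enc_lit_def inj_eq[OF inj_tree_lit])
end

lemma pt_neg [pt_intros]: "pt f \<Longrightarrow> pt (\<lambda>x. neg (f x))"
proof (rule pt_comp[of neg])
  \<comment> \<open>The tag of a negative literal is \<open>Leaf\<close> and that of a positive one
    is not, so the outcome of this test is exactly the opposite tag.\<close>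
  have "pt (\<lambda>p::lit. (lft (enc p) = Leaf, rgt (enc p)))"
    by (intro pt_intros pt_lft pt_rgt pt_enc)
  then show "pt neg"
  proof (rule pt_recode)
    fix p show "enc (neg p) = enc (lft (enc p) = Leaf, rgt (enc p))"
      by (cases p) (simp_all add: enc_lit_def enc_prod_def enc_bool_def tree_bool_def enc_tree_def)
  qed
qed

instantiation bfm :: enc
begin
definition "enc A = tree_bfm A"
instance by standard (simp add: enc_bfm_def inj_eq[OF inj_tree_bfm])
end

lemma enc_bfm_simps:
  "enc (BLit p) = Node Leaf (enc p)"
  "enc (BAnd A B) = Node (tree_nat 1) (Node (enc A) (enc B))"
  "enc (BOr A B) = Node (tree_nat 2) (Node (enc A) (enc B))"
  by (simp_all add: enc_bfm_def enc_lit_def tree_nat_def binary.simps tree_list_def)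

lemma tree_nat_distinct: "tree_nat 1 \<noteq> Leaf" "tree_nat 2 \<noteq> Leaf" "tree_nat 1 \<noteq> tree_nat 2"
  by (simp_all add: tree_nat_def binary.simps tree_list_def tree_bool_def)

lemma pt_case_bfm [pt_intros]:
  assumes "pt g" "pt (\<lambda>z. f1 (fst z) (snd z))" "pt (\<lambda>z. f2 (fst z) (fst (snd z)) (snd (snd z)))"
    "pt (\<lambda>z. f3 (fst z) (fst (snd z)) (snd (snd z)))"
  shows "pt (\<lambda>x. case g x of BLit p \<Rightarrow> f1 x p | BAnd A B \<Rightarrow> f2 x A B | BOr A B \<Rightarrow> f3 x A B)"
proof -
  \<comment> \<open>Total selectors: on the wrong constructor they return \<open>A\<close> itself or
    \<open>Pos 0\<close>, values that the programs can produce as well. The case distinction is then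
    made on the tag, the left component of the code.\<close>
  define l where "l = (\<lambda>A. case A of BLit p \<Rightarrow> A | BAnd B C \<Rightarrow> B | BOr B C \<Rightarrow> B)"
  define r where "r = (\<lambda>A. case A of BLit p \<Rightarrow> A | BAnd B C \<Rightarrow> C | BOr B C \<Rightarrow> C)"
  define p where "p = (\<lambda>A. case A of BLit p \<Rightarrow> p | BAnd B C \<Rightarrow> Pos 0 | BOr B C \<Rightarrow> Pos 0)"
  note tags = tree_nat_distinct tree_nat_distinct[unfolded One_nat_def] enc_bfm_simps enc_tree_def
  have "pt l"
  proof (rule pt_recode)
    show "pt (\<lambda>A :: bfm. if lft (enc A) = Leaf then enc A else lft (rgt (enc A)))"
      by (intro pt_intros pt_lft pt_rgt pt_enc)
    fix A show "enc (l A) = enc (if lft (enc A) = Leaf then enc A else lft (rgt (enc A)))"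
      by (cases A) (simp_all add: l_def tags)
  qed
  moreover have "pt r"
  proof (rule pt_recode)
    show "pt (\<lambda>A :: bfm. if lft (enc A) = Leaf then enc A else rgt (rgt (enc A)))"
      by (intro pt_intros pt_lft pt_rgt pt_enc)
    fix A show "enc (r A) = enc (if lft (enc A) = Leaf then enc A else rgt (rgt (enc A)))"
      by (cases A) (simp_all add: r_def tags)
  qed
  moreover have "pt p"
  proof (rule pt_recode)
    show "pt (\<lambda>A :: bfm. if lft (enc A) = Leaf then rgt (enc A) else enc (Pos 0))"
      by (intro pt_intros pt_lft pt_rgt pt_enc)
    fix A show "enc (p A) = enc (if lft (enc A) = Leaf then rgt (enc A) else enc (Pos 0))"
      by (cases A) (simp_all add: p_def tags)
  qed
  moreover have "(\<lambda>x. case g x of BLit p \<Rightarrow> f1 x p | BAnd A B \<Rightarrow> f2 x A B | BOr A B \<Rightarrow> f3 x A B) =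
      (\<lambda>x. if lft (enc (g x)) = Leaf then f1 x (p (g x))
        else if lft (enc (g x)) = tree_nat 1 then f2 x (l (g x)) (r (g x)) else f3 x (l (g x)) (r (g x)))"
    by (rule ext) (simp add: l_def r_def p_def tags tree_nat_distinct[symmetric] del: One_nat_def split: bfm.split)
  ultimately show ?thesis
    by (simp only:) (intro pt_intros pt_lft pt_comp2[OF assms(2)] pt_comp3[OF assms(3)]
      pt_comp3[OF assms(4)] pt_comp[OF _ assms(1), of l] pt_comp[OF _ assms(1), of r]
      pt_comp[OF _ assms(1), of p] pt_comp[OF pt_enc] assms(1))
qed

instantiation efm :: enc
begin
definition "enc A = tree_efm A"
instance by standard (simp add: enc_efm_def inj_eq[OF inj_tree_efm])
end

lemma enc_efm_simps:
  "enc (ELit p) = Node (tree_nat 0) (enc p)"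
  "enc (EExt i) = Node (tree_nat 1) (enc i)"
  "enc (EDec A p B) = Node (tree_nat 2) (Node (enc A) (Node (enc p) (enc B)))"
  by (simp_all add: enc_efm_def enc_lit_def enc_nat_def)

lemma pt_ELit [pt_intros]: "pt f \<Longrightarrow> pt (\<lambda>x. ELit (f x))"
  by (rule pt_recode[OF pt_Pair[OF pt_const[of "tree_nat 0"]]])
    (simp_all add: enc_efm_simps enc_prod_def enc_tree_def)

lemma pt_EExt [pt_intros]: "pt f \<Longrightarrow> pt (\<lambda>x. EExt (f x))"
  by (rule pt_recode[OF pt_Pair[OF pt_const[of "tree_nat 1"]]])
    (simp_all add: enc_efm_simps enc_prod_def enc_tree_def)

lemma pt_EDec [pt_intros]: "pt f \<Longrightarrow> pt g \<Longrightarrow> pt h \<Longrightarrow> pt (\<lambda>x. EDec (f x) (g x) (h x))"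
  by (rule pt_recode[OF pt_Pair[OF pt_const[of "tree_nat 2"] pt_Pair[OF _ pt_Pair]], of f g h])
    (simp_all add: enc_efm_simps enc_prod_def enc_tree_def)

section \<open>The translation\<close>

type_synonym key = "bfm \<times> bool list"
type_synonym item = "bfm \<times> bool list \<times> bfm \<times> key \<times> key"
type_synonym seq = "efm list \<times> efm list"
type_synonym entry = "bool \<times> seq list \<times> seq"
type_synonym ded = "(seq list \<times> seq) list"

text \<open>The item \<open>(C, q, B, X, Y)\<close> is a node of the branching program of \<open>C\<close>: at the occurrence \<open>q\<close> (a
  path read upwards, \<open>False\<close> for left) of its subformula \<open>B\<close>, continue with \<open>X\<close> if \<open>B\<close> is false and
  with \<open>Y\<close> if it is true. Its extension variable is named by the key \<open>(C, q)\<close>. The two constants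
  get keys that are not an occurrence in any formula.\<close>

definition k0 :: key where "k0 = (BLit (Pos 0), [False])"
definition k1 :: key where "k1 = (BLit (Pos 0), [True])"

text \<open>The right operand is listed first because the left one has its key as a continuation,
  and the node comes last because it is defined by the left operand. Thus every axiom mentions only
  earlier variables.\<close>

primrec its :: "bfm \<Rightarrow> bfm \<Rightarrow> bool list \<Rightarrow> key \<Rightarrow> key \<Rightarrow> item list" where
  "its C (BLit p) q X Y = [(C, q, BLit p, X, Y)]"
| "its C (BAnd A B) q X Y =
     its C B (True # q) X Y @ its C A (False # q) X (C, True # q) @ [(C, q, BAnd A B, X, Y)]"
| "its C (BOr A B) q X Y =
     its C B (True # q) X Y @ its C A (False # q) (C, True # q) Y @ [(C, q, BOr A B, X, Y)]"

definition items :: "bfm \<Rightarrow> item list" where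
  "items C = its C C [] k0 k1"

definition ikey :: "item \<Rightarrow> key" where
  "ikey it = (fst it, fst (snd it))"

definition isub :: "item \<Rightarrow> bfm" where
  "isub it = fst (snd (snd it))"

definition icase :: "item \<Rightarrow> (lit \<Rightarrow> 'a list) \<Rightarrow> 'a list" where
  "icase it f = (case isub it of BLit p \<Rightarrow> f p | BAnd A B \<Rightarrow> [] | BOr A B \<Rightarrow> [])"

primrec lits :: "bfm \<Rightarrow> lit list" where
  "lits (BLit p) = [p]"
| "lits (BAnd A B) = lits A @ lits B"
| "lits (BOr A B) = lits A @ lits B"

text \<open>A variable is numbered by the first position of its key, which is also the position of
  its axiom in \<open>exts\<close>. Formulas that occur repeatedly repeat their keys;
  \<open>items_eq\<close> shows that equal keys carry equal items.\<close>

definition ev :: "key list \<Rightarrow> key \<Rightarrow> efm" where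
  "ev K k = EExt (idx k K)"

definition tr :: "key list \<Rightarrow> bfm \<Rightarrow> efm" where
  "tr K A = ev K (A, [])"

text \<open>Evaluation of a compound node begins with its left operand, whose continuations already
  contain the connective. So the two variables are simply equated, and only the leaves make
  decisions.\<close>

definition edef :: "key list \<Rightarrow> item \<Rightarrow> efm" where
  "edef K it = (case it of (C, q, B, X, Y) \<Rightarrow> case B of
     BLit p \<Rightarrow> EDec (ev K X) p (ev K Y)
   | BAnd A A' \<Rightarrow> ev K (C, False # q)
   | BOr A A' \<Rightarrow> ev K (C, False # q))"

text \<open>There are no constants among eDT formulas. If the variable is false \<open>c0\<close>
  returns the variable, otherwise its negation, so it is always false; \<open>c1\<close> is always
  true.\<close>

definition c0 :: efm where "c0 = EDec (ELit (Pos 0)) (Pos 0) (ELit (Neg 0))"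
definition c1 :: efm where "c1 = EDec (ELit (Neg 0)) (Pos 0) (ELit (Pos 0))"

definition forms :: "bfm line list \<Rightarrow> bfm list" where
  "forms \<pi> = concat (map (\<lambda>l. fst (snd l) @ snd (snd l)) \<pi>)"

definition roots :: "bfm line list \<Rightarrow> bfm list" where
  "roots \<pi> = concat (map (\<lambda>A. map isub (items A)) (forms \<pi>))"

definition all_items :: "bfm line list \<Rightarrow> item list" where
  "all_items \<pi> = concat (map items (roots \<pi>))"

definition keys :: "bfm line list \<Rightarrow> key list" where
  "keys \<pi> = k0 # k1 # map ikey (all_items \<pi>)"

definition exts :: "bfm line list \<Rightarrow> efm list" where
  "exts \<pi> = c0 # c1 # map (edef (keys \<pi>)) (all_items \<pi>)"

text \<open>An entry of the script is an inference with explicit premises or a goal, whose derivation from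
  the preceding entries is found by search.\<close>

definition ax :: "seq \<Rightarrow> entry" where "ax S = (True, [], S)"
definition goal :: "seq \<Rightarrow> entry" where "goal S = (False, [], S)"

definition infer2 :: "seq \<Rightarrow> seq \<Rightarrow> seq \<Rightarrow> entry list" where
  "infer2 P Q S = [goal P, goal Q, (True, [P, Q], S)]"

definition lit_entries :: "lit \<Rightarrow> entry list" where
  "lit_entries p = [ax ([ELit p], [ELit p]), ax ([ELit p, ELit (neg p)], []), ax ([], [ELit p, ELit (neg p)])]"

text \<open>Initial sequents \<open>A \<rightarrow> A\<close> exist for literals only. The identity
  for \<open>N\<close> is recorded because decision inferences between extension variables start
  from it.\<close>

definition ext_entries :: "efm \<Rightarrow> efm \<Rightarrow> entry list" where
  "ext_entries N F = [ax ([N], [F]), ax ([F], [N]), goal ([N], [N])]"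

text \<open>The four sequents say that \<open>F\<close> agrees with \<open>Y\<close> when
  \<open>P\<close> holds and with \<open>X\<close> when it fails. The repeated occurrences of
  \<open>P\<close> and \<open>ELit p\<close> in the premises come from the contexts, which the
  decision rules require to match as multisets.\<close>

definition dec_entries :: "efm \<Rightarrow> lit \<Rightarrow> efm \<Rightarrow> entry list" where
  "dec_entries X p Y = (let P = ELit p; F = EDec X p Y in
     infer2 ([X, P], [P, Y]) ([P, Y, P], [Y]) ([F, P], [Y]) @
     infer2 ([X], [P, P, X]) ([P, Y], [P, X]) ([F], [P, X]) @
     infer2 ([P, Y], [X, P]) ([P, P, Y], [Y]) ([P, Y], [F]) @
     infer2 ([X], [X, P, P]) ([P, X], [Y, P]) ([X], [F, P]))"

definition root_entries :: "key list \<Rightarrow> bfm \<Rightarrow> entry list" where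
  "root_entries K C = (case C of
     BLit p \<Rightarrow> [goal ([tr K C], [ELit p]), goal ([ELit p], [tr K C])]
   | BAnd A B \<Rightarrow> [goal ([tr K C], [tr K A]), goal ([tr K C], [tr K B]), goal ([tr K A, tr K B], [tr K C])]
   | BOr A B \<Rightarrow> [goal ([tr K A], [tr K C]), goal ([tr K B], [tr K C]), goal ([tr K C], [tr K A, tr K B])])"

text \<open>These express that \<open>N\<close> is equivalent to \<open>(X B Y)\<close>, which is not an eDT formula because \<open>B\<close> is
  an extension variable.\<close>

definition node_entries :: "efm \<Rightarrow> efm \<Rightarrow> efm \<Rightarrow> efm \<Rightarrow> entry list" where
  "node_entries N B X Y =
     [goal ([B, N], [Y]), goal ([B, Y], [N]), goal ([N], [B, X]), goal ([X], [B, N])]"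

text \<open>At the root the node variable and the root variable of the subformula coincide, so the
  node law would say nothing. The law of the outermost connective is recorded there instead.\<close>

definition item_entries :: "key list \<Rightarrow> item \<Rightarrow> entry list" where
  "item_entries K it = (case it of (C, q, B, X, Y) \<Rightarrow>
     case q of [] \<Rightarrow> root_entries K B
     | b # r \<Rightarrow> node_entries (ev K (C, q)) (tr K B) (ev K X) (ev K Y))"

definition flip :: "seq \<Rightarrow> seq" where
  "flip S = (snd S, fst S)"

definition orient :: "bool \<Rightarrow> seq \<Rightarrow> seq" where
  "orient d S = (if d then S else flip S)"

definition junct :: "bool \<Rightarrow> lit list \<Rightarrow> efm" where
  "junct d ps = (if d then Disj ps else Conj ps)"

text \<open>\<open>d\<close> is true for the left-hand side with its disjunctions, false for the dual situation on the
  right.\<close>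

definition junct_entries :: "bool \<Rightarrow> key list \<Rightarrow> bfm \<Rightarrow> entry list" where
  "junct_entries d K A =
     concat (map (\<lambda>B. map (\<lambda>p. goal (orient d ([ELit p], [tr K B]))) (lits B)) (map isub (items A))) @
     concat (map (\<lambda>s. case s of [] \<Rightarrow> [] | p # r \<Rightarrow> (case r of [] \<Rightarrow> [] | q # t \<Rightarrow>
       (let P = orient d ([junct d r], [ELit p, tr K A]); Q = orient d ([ELit p, ELit p], [tr K A]);
         S = orient d ([junct d s], [tr K A])
       in if d then infer2 P Q S else infer2 Q P S)))
      (suffs (lits A)))"

text \<open>The formulas of the last line are exchanged one after the other. As cedents are compared as sets
  by the search, the new formulas are all present from the start and only the old ones disappear.\<close>

definition final_entries :: "key list \<Rightarrow> bfm list \<Rightarrow> bfm list \<Rightarrow> entry list" where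
  "final_entries K \<Gamma> \<Delta> =
     (let G = map (\<lambda>A. junct True (lits A)) \<Gamma>; D = map (\<lambda>A. junct False (lits A)) \<Delta> in
     concat (map (junct_entries True K) \<Gamma>) @ concat (map (junct_entries False K) \<Delta>) @
     map (\<lambda>s. goal (orient True (G @ map (tr K) s, map (tr K) \<Delta>))) (rev ([] # suffs \<Gamma>)) @
     map (\<lambda>s. goal (orient False (D @ map (tr K) s, G))) (rev ([] # suffs \<Delta>)))"

text \<open>\<open>Pos 0\<close> and \<open>Neg 0\<close> are added to the literals because
  \<open>c0\<close> and \<open>c1\<close> are built from them, whether or not they occur in the LK
  proof.\<close>

definition base_entries :: "key list \<Rightarrow> item list \<Rightarrow> entry list" where
  "base_entries K I =
     concat (map lit_entries (Pos 0 # Neg 0 # concat (map (\<lambda>it. icase it (\<lambda>p. [p])) I))) @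
     ext_entries (ev K k0) c0 @ ext_entries (ev K k1) c1 @
     concat (map (\<lambda>it. ext_entries (ev K (ikey it)) (edef K it)) I) @
     dec_entries (ELit (Pos 0)) (Pos 0) (ELit (Neg 0)) @ dec_entries (ELit (Neg 0)) (Pos 0) (ELit (Pos 0)) @
     concat (map (\<lambda>it. icase it (\<lambda>p.
       dec_entries (ev K (fst (snd (snd (snd it))))) p (ev K (snd (snd (snd (snd it))))))) I) @
     [goal ([ev K k0], []), goal ([], [ev K k1])]"

definition script :: "bfm line list \<Rightarrow> entry list" where
  "script \<pi> = (let I = all_items \<pi>; K = keys \<pi> in
     base_entries K I @ concat (map (item_entries K) I) @
     map (\<lambda>l. goal (map (tr K) (fst (snd l)), map (tr K) (snd (snd l)))) \<pi> @
     (case rev \<pi> of [] \<Rightarrow> [] | l # r \<Rightarrow> final_entries K (fst (snd l)) (snd (snd l))))"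

section \<open>Search for derivations by nested cuts\<close>

definition sub :: "seq \<Rightarrow> seq \<Rightarrow> bool" where
  "sub P S \<longleftrightarrow> set (fst P) \<subseteq> set (fst S) \<and> set (snd P) \<subseteq> set (snd S)"

text \<open>On each side the formulas of \<open>S\<close> are first added one by one, and then those
  of \<open>P\<close> are contracted away. The contractions are legal since \<open>sub P S\<close>
  makes every formula of \<open>P\<close> occur in \<open>S\<close>.\<close>

definition weaken :: "seq \<Rightarrow> seq \<Rightarrow> ded" where
  "weaken P S =
     map (\<lambda>s. ([(tl s @ fst P, snd P)], (s @ fst P, snd P))) (suffs (fst S)) @
     map (\<lambda>s. ([(fst S @ s, snd P)], (fst S @ tl s, snd P))) (rev (suffs (fst P))) @
     map (\<lambda>s. ([(fst S, tl s @ snd P)], (fst S, s @ snd P))) (suffs (snd S)) @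
     map (\<lambda>s. ([(fst S, snd S @ s)], (fst S, snd S @ tl s))) (rev (suffs (snd P)))"

text \<open>The literal in front guarantees a candidate even if the known sequents contain no
  formula, so a cut can always be made for padding.\<close>

definition cands :: "seq list \<Rightarrow> efm list" where
  "cands K = ELit (Pos 0) # concat (map (\<lambda>P. fst P @ snd P) K)"

text \<open>The nesting is exactly \<open>n\<close> on every branch. Goals that need fewer cuts are
  padded with redundant ones, which costs nothing in the argument and makes the goal itself the last
  sequent derived.\<close>

primrec srch :: "nat \<Rightarrow> seq list \<Rightarrow> seq \<Rightarrow> ded option" where
  "srch 0 K S = first_some (\<lambda>P. if sub P S then Some (weaken P S) else None) K"
| "srch (Suc n) K S = first_some (\<lambda>a.
     case srch n K (fst S, a # snd S) of None \<Rightarrow> None | Some L \<Rightarrow>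
     (case srch n K (a # fst S, snd S) of None \<Rightarrow> None | Some M \<Rightarrow>
       Some (L @ M @ [([(fst S, a # snd S), (a # fst S, snd S)], S)]))) (cands K)"

definition gen :: "entry list \<Rightarrow> ded" where
  "gen s = (case s of [] \<Rightarrow> [] | e # r \<Rightarrow>
     if fst e then [snd e]
     else (case srch 5 (map (\<lambda>e. snd (snd e)) r) (snd (snd e)) of None \<Rightarrow> [] | Some L \<Rightarrow> L))"

definition dedn :: "entry list \<Rightarrow> ded" where
  "dedn s = concat (map gen (suffs (rev s)))"

text \<open>\<open>idx\<close> refers to the first line that concludes the premise. If some earlier
  line does so, then that first one is earlier too.\<close>

definition lines :: "ded \<Rightarrow> efm line list" where
  "lines L = (let C = map snd L in map (\<lambda>d. (map (\<lambda>P. idx P C) (fst d), snd d)) L)"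

definition trans :: "bfm line list \<Rightarrow> eproof" where
  "trans \<pi> = (exts \<pi>, lines (dedn (script \<pi>)))"


subsection \<open>The translation takes polynomial time\<close>

text \<open>One level of \<open>its\<close>, with the left operand first. As \<open>dfs\<close> puts
  visited items in front of its output, the preorder comes out reversed, which is the order of
  \<open>its\<close>.\<close>

definition children :: "item \<Rightarrow> item list" where
  "children it = (case it of (C, q, B, X, Y) \<Rightarrow> case B of
     BLit p \<Rightarrow> []
   | BAnd A A' \<Rightarrow> [(C, False # q, A, X, (C, True # q)), (C, True # q, A', X, Y)]
   | BOr A A' \<Rightarrow> [(C, False # q, A, (C, True # q), Y), (C, True # q, A', X, Y)])"

definition dfs :: "item list \<times> item list \<Rightarrow> item list \<times> item list" where
  "dfs z = (case fst z of [] \<Rightarrow> z | it # ws \<Rightarrow> (children it @ ws, it # snd z))"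

primrec nodes :: "bfm \<Rightarrow> nat" where
  "nodes (BLit p) = 1"
| "nodes (BAnd A B) = Suc (nodes A + nodes B)"
| "nodes (BOr A B) = Suc (nodes A + nodes B)"

lemma nodes_pos: "0 < nodes A"
  by (cases A) auto

lemma sz_bfm: "sz (BAnd A B) > Suc (sz A + sz B)" "sz (BOr A B) > Suc (sz A + sz B)"
  by (simp_all add: sz_def enc_bfm_simps)

lemma nodes_le_sz: "nodes A \<le> sz A"
proof (induction A)
  case (BLit p)
  show ?case using sz_pos[of "BLit p"] by simp
next
  case (BAnd A B)
  then show ?case using sz_bfm(1)[of A B] by simp
next
  case (BOr A B)
  then show ?case using sz_bfm(2)[of A B] by simp
qed

lemma sz_bool_list: "sz (q :: bool list) \<le> 1 + 4 * length q"
proof (induction q)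
  case (Cons b q)
  then show ?case using sz_bool_le[of b] by simp
qed simp

lemma sz_list_le: "\<forall>x\<in>set xs. sz x \<le> n \<Longrightarrow> sz xs \<le> 1 + length xs * Suc n"
  by (induction xs) auto

definition key_ok :: "bfm \<Rightarrow> key \<Rightarrow> bool" where
  "key_ok C k \<longleftrightarrow> k = k0 \<or> k = k1 \<or> fst k = C \<and> length (snd k) \<le> nodes C"

definition item_ok :: "bfm \<Rightarrow> item \<Rightarrow> bool" where
  "item_ok C it \<longleftrightarrow> (case it of (D, q, B, X, Y) \<Rightarrow>
     D = C \<and> length q + nodes B \<le> nodes C \<and> sz B \<le> sz C \<and> key_ok C X \<and> key_ok C Y)"

text \<open>A Boolean in a list costs at most four bits, and a path is no longer than the number of
  nodes, hence than \<open>sz C\<close>; this gives the term \<open>4 * sz C\<close>.\<close>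

definition key_bound :: "bfm \<Rightarrow> nat" where
  "key_bound C = sz k0 + sz k1 + (2 + sz C + 4 * sz C)"

lemma sz_key: "key_ok C k \<Longrightarrow> sz k \<le> key_bound C"
proof -
  assume k: "key_ok C k"
  show ?thesis
  proof (cases "k = k0 \<or> k = k1")
    case False
    then have "fst k = C" "length (snd k) \<le> sz C"
      using k nodes_le_sz[of C] by (auto simp: key_ok_def)
    then show ?thesis using sz_bool_list[of "snd k"] by (cases k) (simp add: key_bound_def)
  qed (auto simp: key_bound_def)
qed

definition item_bound :: "bfm \<Rightarrow> nat" where
  "item_bound C = 5 + 6 * sz C + 2 * key_bound C"

lemma sz_item: "item_ok C it \<Longrightarrow> sz it \<le> item_bound C"
proof -
  assume ok: "item_ok C it"
  obtain D q B X Y where it: "it = (D, q, B, X, Y)" by (cases it)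
  have "length q \<le> sz C" using ok nodes_le_sz[of C] by (auto simp: item_ok_def it)
  then have "sz q \<le> 1 + 4 * sz C" using sz_bool_list[of q] by linarith
  moreover have "sz X \<le> key_bound C" "sz Y \<le> key_bound C" "sz B \<le> sz C" "D = C"
    using ok sz_key by (auto simp: item_ok_def it)
  ultimately show ?thesis by (simp add: it item_bound_def)
qed

lemma children_ok:
  assumes "item_ok C it" "it' \<in> set (children it)"
  shows "item_ok C it'"
proof -
  obtain D q B X Y where it: "it = (D, q, B, X, Y)" by (cases it)
  show ?thesis
  proof (cases B)
    case (BLit p)
    then show ?thesis using assms by (simp add: it children_def)
  next
    case (BAnd A A')
    then show ?thesis using assms sz_bfm(1)[of A A'] nodes_pos[of A] nodes_pos[of A']
      by (auto simp: it children_def item_ok_def key_ok_def)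
  next
    case (BOr A A')
    then show ?thesis using assms sz_bfm(2)[of A A'] nodes_pos[of A] nodes_pos[of A']
      by (auto simp: it children_def item_ok_def key_ok_def)
  qed
qed

text \<open>The recursion of \<open>its\<close> branches and is not a fold, so it is run as a loop
  with a worklist. Pending nodes and finished items together never exceed \<open>nodes C\<close>,
  which bounds both lists, and each item has size linear in that of \<open>C\<close>.\<close>

lemma pt_items [pt_intros]: "pt f \<Longrightarrow> pt (\<lambda>x. items (f x))"
proof (rule pt_comp[of items])
  define its' where "its' = (\<lambda>it :: item. case it of (C, q, B, X, Y) \<Rightarrow> its C B q X Y)"
  define g where "g = (\<lambda>z. ([] :: item list, concat (rev (map its' (fst z))) @ snd z))"
  define m where "m = (\<lambda>z :: item list \<times> item list. \<Sum>it\<leftarrow>fst z. nodes (isub it))"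
  define Inv where "Inv = (\<lambda>C z. (\<forall>it\<in>set (fst z) \<union> set (snd z). item_ok C it) \<and> m z + length (snd z) \<le> nodes C)"
  have "pt (\<lambda>C. g ([(C, [], C, k0, k1)], []))"
  proof (rule pt_while[where b = "\<lambda>z. fst z \<noteq> []" and f = dfs and m = m
        and i = "\<lambda>C. ([(C, [], C, k0, k1)], [])" and Inv = Inv])
    show "pt dfs" unfolding dfs_def children_def by (intro pt_intros)
    show "pbound (\<lambda>C. 1 + 2 * (1 + sz C * Suc (item_bound C)))"
      unfolding item_bound_def key_bound_def by (intro pb_intros)
    show "pbound (sz :: bfm \<Rightarrow> nat)" by (rule pb_sz)
  next
    fix C z assume inv: "Inv C z"
    have len: "length ws \<le> (\<Sum>it\<leftarrow>ws. nodes (isub it))" for ws :: "item list"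
    proof (induction ws)
      case (Cons it ws)
      then show ?case using nodes_pos[of "isub it"] by simp
    qed simp
    have "length (fst z) \<le> sz C" "length (snd z) \<le> sz C"
      using inv len[of "fst z"] nodes_le_sz[of C] by (auto simp: Inv_def m_def)
    moreover have "sz (fst z) \<le> 1 + length (fst z) * Suc (item_bound C)"
      "sz (snd z) \<le> 1 + length (snd z) * Suc (item_bound C)"
      by (intro sz_list_le ballI sz_item; use inv in \<open>simp add: Inv_def\<close>)+
    ultimately have "sz (fst z) \<le> 1 + sz C * Suc (item_bound C)" "sz (snd z) \<le> 1 + sz C * Suc (item_bound C)"
      by (meson add_left_mono le_trans mult_le_mono1)+
    then show "sz z \<le> 1 + 2 * (1 + sz C * Suc (item_bound C))" by (cases z) simp
    assume "fst z \<noteq> []"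
    then obtain it ws out where z: "z = (it # ws, out)" by (cases z; cases "fst z") auto
    have "(\<Sum>it\<leftarrow>children it. nodes (isub it)) < nodes (isub it)"
      by (auto simp: children_def isub_def split: prod.split bfm.split)
    moreover have "concat (rev (map its' (children it))) @ [it] = its' it"
      by (auto simp: its'_def children_def split: prod.split bfm.split)
    ultimately show "Inv C (dfs z) \<and> m (dfs z) < m z \<and> g (dfs z) = g z"
      using inv children_ok[of C it] by (auto simp: Inv_def dfs_def m_def g_def z)
  qed (auto simp: g_def m_def Inv_def isub_def item_ok_def key_ok_def nodes_le_sz intro!: pt_intros)
  then have "pt (\<lambda>C. snd (g ([(C, [], C, k0, k1)], [])))" by (rule pt_snd)
  then show "pt items" by (simp add: g_def its'_def items_def[abs_def])
qed

lemma pt_isub [pt_intros]: "pt f \<Longrightarrow> pt (\<lambda>x. isub (f x))"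
  and pt_ikey [pt_intros]: "pt f \<Longrightarrow> pt (\<lambda>x. ikey (f x))"
  unfolding isub_def ikey_def by (intro pt_intros; assumption)+

lemma pt_icase [pt_intros]:
  "pt f \<Longrightarrow> pt (\<lambda>z. h (fst z) (snd z)) \<Longrightarrow> pt (\<lambda>x. icase (f x) (\<lambda>p. h x p))"
  unfolding icase_def by (intro pt_intros; assumption)

text \<open>\<open>its\<close> meets the leaves from right to left. Reading the literals off the
  items avoids a second traversal of formulas.\<close>

lemma lits_its: "rev (concat (map (\<lambda>it. icase it (\<lambda>p. [p])) (its C B q X Y))) = lits B"
  by (induction B arbitrary: q X Y) (auto simp: icase_def isub_def)

lemma pt_lits [pt_intros]: "pt f \<Longrightarrow> pt (\<lambda>x. lits (f x))"
proof -
  assume "pt f"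
  then have "pt (\<lambda>x. rev (concat (map (\<lambda>it. icase it (\<lambda>p. [p])) (items (f x)))))"
    by (intro pt_intros; assumption)
  then show ?thesis by (simp add: items_def lits_its)
qed

lemma pt_ev [pt_intros]: "pt K \<Longrightarrow> pt k \<Longrightarrow> pt (\<lambda>x. ev (K x) (k x))"
  unfolding ev_def by (intro pt_intros; assumption)

lemma pt_tr [pt_intros]: "pt K \<Longrightarrow> pt A \<Longrightarrow> pt (\<lambda>x. tr (K x) (A x))"
  unfolding tr_def by (intro pt_intros; assumption)

lemma pt_edef [pt_intros]: "pt K \<Longrightarrow> pt f \<Longrightarrow> pt (\<lambda>x. edef (K x) (f x))"
  by (rule pt_comp2[of edef]) (unfold edef_def, intro pt_intros)

lemma Disj_Cons: "ps \<noteq> [] \<Longrightarrow> Disj (p # ps) = EDec (Disj ps) p (ELit p)"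
  and Conj_Cons: "ps \<noteq> [] \<Longrightarrow> Conj (p # ps) = EDec (ELit p) p (Conj ps)"
  by (cases ps; simp)+

lemma pt_Disj [pt_intros]: "pt f \<Longrightarrow> pt (\<lambda>x. Disj (f x))"
proof (rule pt_comp[of Disj])
  have F: "pt (\<lambda>z :: lit \<times> lit list. fold (\<lambda>p A. EDec A p (ELit p)) (snd z) (ELit (fst z)))"
  proof (rule pt_fold_add[where R = "\<lambda>z. sz (EDec (ELit (Pos 0)) (snd z) (ELit (snd z)))"])
    fix x :: "lit \<times> lit list" and p A
    show "sz (EDec A p (ELit p)) \<le> sz A + sz (EDec (ELit (Pos 0)) (snd (x, p)) (ELit (snd (x, p))))"
      by (simp add: sz_def enc_efm_simps)
  qed (intro pt_intros pt_sz)+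
  \<comment> \<open>\<open>Disj []\<close> is unspecified but is one fixed formula, so
    \<open>pt_const\<close> applies to it.\<close>
  have "pt (\<lambda>ps. case rev ps of [] \<Rightarrow> Disj [] | q # qs \<Rightarrow> fold (\<lambda>p A. EDec A p (ELit p)) qs (ELit q))"
    by (intro pt_intros pt_comp2[OF F])
  moreover have "fold (\<lambda>p A. EDec A p (ELit p)) qs (ELit q) = Disj (rev qs @ [q])" for q qs
    by (induction qs rule: rev_induct) (simp_all add: Disj_Cons)
  then have "(case rev ps of [] \<Rightarrow> Disj [] | q # qs \<Rightarrow> fold (\<lambda>p A. EDec A p (ELit p)) qs (ELit q)) = Disj ps" for ps
    by (cases ps rule: rev_cases) simp_all
  ultimately show "pt Disj" by simp
qed

lemma pt_Conj [pt_intros]: "pt f \<Longrightarrow> pt (\<lambda>x. Conj (f x))"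
proof (rule pt_comp[of Conj])
  have F: "pt (\<lambda>z :: lit \<times> lit list. fold (\<lambda>p A. EDec (ELit p) p A) (snd z) (ELit (fst z)))"
  proof (rule pt_fold_add[where R = "\<lambda>z. sz (EDec (ELit (snd z)) (snd z) (ELit (Pos 0)))"])
    fix x :: "lit \<times> lit list" and p A
    show "sz (EDec (ELit p) p A) \<le> sz A + sz (EDec (ELit (snd (x, p))) (snd (x, p)) (ELit (Pos 0)))"
      by (simp add: sz_def enc_efm_simps)
  qed (intro pt_intros pt_sz)+
  have "pt (\<lambda>ps. case rev ps of [] \<Rightarrow> Conj [] | q # qs \<Rightarrow> fold (\<lambda>p A. EDec (ELit p) p A) qs (ELit q))"
    by (intro pt_intros pt_comp2[OF F])
  moreover have "fold (\<lambda>p A. EDec (ELit p) p A) qs (ELit q) = Conj (rev qs @ [q])" for q qs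
    by (induction qs rule: rev_induct) (simp_all add: Conj_Cons)
  then have "(case rev ps of [] \<Rightarrow> Conj [] | q # qs \<Rightarrow> fold (\<lambda>p A. EDec (ELit p) p A) qs (ELit q)) = Conj ps" for ps
    by (cases ps rule: rev_cases) simp_all
  ultimately show "pt Conj" by simp
qed

lemma pt_all_items [pt_intros]: "pt f \<Longrightarrow> pt (\<lambda>x. all_items (f x))"
  unfolding all_items_def roots_def forms_def by (intro pt_intros; assumption)

lemma pt_keys [pt_intros]: "pt f \<Longrightarrow> pt (\<lambda>x. keys (f x))"
  unfolding keys_def by (intro pt_intros; assumption)

lemma pt_exts [pt_intros]: "pt f \<Longrightarrow> pt (\<lambda>x. exts (f x))"
  by (rule pt_comp[of exts]) (unfold exts_def, intro pt_intros)

lemma pt_goal [pt_intros]: "pt f \<Longrightarrow> pt (\<lambda>x. goal (f x))"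
  and pt_ax [pt_intros]: "pt f \<Longrightarrow> pt (\<lambda>x. ax (f x))"
  unfolding goal_def ax_def by (intro pt_intros; assumption)+

lemma pt_infer2 [pt_intros]: "pt f \<Longrightarrow> pt g \<Longrightarrow> pt h \<Longrightarrow> pt (\<lambda>x. infer2 (f x) (g x) (h x))"
  unfolding infer2_def by (intro pt_intros; assumption)

lemma pt_lit_entries [pt_intros]: "pt f \<Longrightarrow> pt (\<lambda>x. lit_entries (f x))"
  unfolding lit_entries_def by (intro pt_intros; assumption)

lemma pt_ext_entries [pt_intros]: "pt f \<Longrightarrow> pt g \<Longrightarrow> pt (\<lambda>x. ext_entries (f x) (g x))"
  unfolding ext_entries_def by (intro pt_intros; assumption)

lemma pt_dec_entries [pt_intros]: "pt f \<Longrightarrow> pt g \<Longrightarrow> pt h \<Longrightarrow> pt (\<lambda>x. dec_entries (f x) (g x) (h x))"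
  by (rule pt_comp3[of dec_entries]) (unfold dec_entries_def Let_def, intro pt_intros)

lemma pt_item_entries [pt_intros]: "pt f \<Longrightarrow> pt g \<Longrightarrow> pt (\<lambda>x. item_entries (f x) (g x))"
  by (rule pt_comp2[of item_entries])
    (unfold item_entries_def root_entries_def node_entries_def, intro pt_intros)

lemma pt_orient [pt_intros]: "pt f \<Longrightarrow> pt (\<lambda>x. orient d (f x))"
  by (cases d) (simp_all add: orient_def flip_def pt_Pair pt_fst pt_snd)

lemma pt_junct [pt_intros]: "pt f \<Longrightarrow> pt (\<lambda>x. junct d (f x))"
  by (cases d) (simp_all add: junct_def pt_Disj pt_Conj)

lemma pt_junct_entries [pt_intros]: "pt f \<Longrightarrow> pt g \<Longrightarrow> pt (\<lambda>x. junct_entries d (f x) (g x))"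
  by (rule pt_comp2[of "junct_entries d"]) (unfold junct_entries_def, intro pt_intros)

lemma pt_final_entries [pt_intros]:
  "pt f \<Longrightarrow> pt g \<Longrightarrow> pt h \<Longrightarrow> pt (\<lambda>x. final_entries (f x) (g x) (h x))"
  by (rule pt_comp3[of final_entries]) (unfold final_entries_def, intro pt_intros)

lemma pt_base_entries [pt_intros]: "pt f \<Longrightarrow> pt g \<Longrightarrow> pt (\<lambda>x. base_entries (f x) (g x))"
  by (rule pt_comp2[of base_entries]) (unfold base_entries_def, intro pt_intros)

lemma pt_script [pt_intros]: "pt f \<Longrightarrow> pt (\<lambda>x. script (f x))"
  by (rule pt_comp[of script]) (unfold script_def, intro pt_intros)

lemma pt_sub [pt_intros]: "pt f \<Longrightarrow> pt g \<Longrightarrow> pt (\<lambda>x. sub (f x) (g x))"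
  unfolding sub_def by (intro pt_intros; assumption)

lemma pt_weaken [pt_intros]: "pt f \<Longrightarrow> pt g \<Longrightarrow> pt (\<lambda>x. weaken (f x) (g x))"
  by (rule pt_comp2[of weaken]) (unfold weaken_def, intro pt_intros)

lemma pt_cands [pt_intros]: "pt f \<Longrightarrow> pt (\<lambda>x. cands (f x))"
  by (rule pt_comp[of cands]) (unfold cands_def, intro pt_intros)

text \<open>Every level multiplies the work by twice the number of candidates, so the degree of the
  bound grows with \<open>n\<close>. The induction is therefore outside \<open>pt\<close>, and
  \<open>n\<close> is a fixed number rather than an input.\<close>

lemma pt_srch0: "pt (\<lambda>z. srch n (fst z) (snd z))"
proof (induction n)
  case 0
  show ?case unfolding srch.simps by (intro pt_intros)
next
  case (Suc n)
  show ?case unfolding srch.simps by (intro pt_intros pt_comp2[OF Suc])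
qed

lemmas pt_srch [pt_intros] = pt_comp2[OF pt_srch0]

lemma pt_trans: "pt trans"
  unfolding trans_def lines_def dedn_def gen_def by (intro pt_intros)

section \<open>Correctness of the search\<close>

definition msq :: "seq \<Rightarrow> efm sequent" where
  "msq S = (mset (fst S), mset (snd S))"

definition edts :: "seq \<Rightarrow> bool" where
  "edts S \<longleftrightarrow> (\<forall>A\<in>set (fst S) \<union> set (snd S). edt A)"

primrec valid_ded :: "efm list \<Rightarrow> seq set \<Rightarrow> ded \<Rightarrow> bool" where
  "valid_ded E K [] \<longleftrightarrow> True"
| "valid_ded E K (d # L) \<longleftrightarrow> eldt_rule E (map msq (fst d)) (msq (snd d)) \<and> set (fst d) \<subseteq> K \<and>
     edts (snd d) \<and> valid_ded E (insert (snd d) K) L"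

abbreviation concls :: "ded \<Rightarrow> seq set" where
  "concls L \<equiv> snd ` set L"

lemma valid_ded_append:
  "valid_ded E K (L @ M) \<longleftrightarrow> valid_ded E K L \<and> valid_ded E (K \<union> concls L) M"
  by (induction L arbitrary: K) auto

lemma weaken_left:
  assumes "(G, D) \<in> K" "edts (U @ G, D)"
  shows "valid_ded E K (map (\<lambda>s. ([(tl s @ G, D)], (s @ G, D))) (suffs U)) \<and>
    (U @ G, D) \<in> K \<union> concls (map (\<lambda>s. ([(tl s @ G, D)], (s @ G, D))) (suffs U))"
  using assms
proof (induction U)
  case (Cons u U)
  have "eldt_rule E [msq (U @ G, D)] (msq (u # U @ G, D))"
    using eldt_structural[OF weakening_l[of "mset (U @ G)" "mset D" u]] by (simp add: msq_def)
  with Cons show ?case by (simp add: valid_ded_append edts_def)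
qed simp

lemma weaken_right:
  assumes "(G, D) \<in> K" "edts (G, U @ D)"
  shows "valid_ded E K (map (\<lambda>s. ([(G, tl s @ D)], (G, s @ D))) (suffs U)) \<and>
    (G, U @ D) \<in> K \<union> concls (map (\<lambda>s. ([(G, tl s @ D)], (G, s @ D))) (suffs U))"
  using assms
proof (induction U)
  case (Cons u U)
  have "eldt_rule E [msq (G, U @ D)] (msq (G, u # U @ D))"
    using eldt_structural[OF weakening_r[of "mset G" "mset (U @ D)" u]] by (simp add: msq_def)
  with Cons show ?case by (simp add: valid_ded_append edts_def)
qed simp

lemma add_mset_member: "x \<in> set H \<Longrightarrow> \<exists>M. mset H = add_mset x M"
  by (metis in_multiset_in_set mset_add)

lemma contract_left:
  assumes "(H @ G, D) \<in> K" "edts (H @ G, D)" "set G \<subseteq> set H"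
  shows "valid_ded E K (map (\<lambda>s. ([(H @ s, D)], (H @ tl s, D))) (rev (suffs G))) \<and>
    (H, D) \<in> K \<union> concls (map (\<lambda>s. ([(H @ s, D)], (H @ tl s, D))) (rev (suffs G)))"
  using assms
proof (induction G arbitrary: K)
  case (Cons g G)
  from Cons.prems obtain M where "mset H = add_mset g M" using add_mset_member[of g H] by auto
  then have "eldt_rule E [msq (H @ g # G, D)] (msq (H @ G, D))"
    using eldt_structural[OF contraction_l[of g "M + mset G" "mset D"]] by (simp add: msq_def)
  with Cons.prems Cons.IH[of "insert (H @ G, D) K"] show ?case by (auto simp: edts_def)
qed simp

lemma contract_right:
  assumes "(G, H @ D) \<in> K" "edts (G, H @ D)" "set D \<subseteq> set H"
  shows "valid_ded E K (map (\<lambda>s. ([(G, H @ s)], (G, H @ tl s))) (rev (suffs D))) \<and>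
    (G, H) \<in> K \<union> concls (map (\<lambda>s. ([(G, H @ s)], (G, H @ tl s))) (rev (suffs D)))"
  using assms
proof (induction D arbitrary: K)
  case (Cons g D)
  from Cons.prems obtain M where "mset H = add_mset g M" using add_mset_member[of g H] by auto
  then have "eldt_rule E [msq (G, H @ g # D)] (msq (G, H @ D))"
    using eldt_structural[OF contraction_r[of "mset G" g "M + mset D"]] by (simp add: msq_def)
  with Cons.prems Cons.IH[of "insert (G, H @ D) K"] show ?case by (auto simp: edts_def)
qed simp

lemma weaken_valid:
  assumes "sub P S" "P \<in> K" "edts P" "edts S"
  shows "valid_ded E K (weaken P S) \<and> S \<in> K \<union> concls (weaken P S)"
proof -
  let ?\<Gamma> = "fst S" let ?\<Delta> = "snd S" let ?G = "fst P" let ?D = "snd P"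
  define L1 where "L1 = map (\<lambda>s. ([(tl s @ ?G, ?D)], (s @ ?G, ?D))) (suffs ?\<Gamma>)"
  define L2 where "L2 = map (\<lambda>s. ([(?\<Gamma> @ s, ?D)], (?\<Gamma> @ tl s, ?D))) (rev (suffs ?G))"
  define L3 where "L3 = map (\<lambda>s. ([(?\<Gamma>, tl s @ ?D)], (?\<Gamma>, s @ ?D))) (suffs ?\<Delta>)"
  define L4 where "L4 = map (\<lambda>s. ([(?\<Gamma>, ?\<Delta> @ s)], (?\<Gamma>, ?\<Delta> @ tl s))) (rev (suffs ?D))"
  have L: "weaken P S = L1 @ L2 @ L3 @ L4"
    by (simp add: weaken_def L1_def L2_def L3_def L4_def)
  have 1: "valid_ded E K L1 \<and> (?\<Gamma> @ ?G, ?D) \<in> K \<union> concls L1"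
    unfolding L1_def by (rule weaken_left) (use assms in \<open>auto simp: edts_def\<close>)
  then have 2: "valid_ded E (K \<union> concls L1) L2 \<and> (?\<Gamma>, ?D) \<in> K \<union> concls L1 \<union> concls L2"
    unfolding L2_def by (intro contract_left) (use assms in \<open>auto simp: edts_def sub_def\<close>)
  then have 3: "valid_ded E (K \<union> concls L1 \<union> concls L2) L3 \<and>
      (?\<Gamma>, ?\<Delta> @ ?D) \<in> K \<union> concls L1 \<union> concls L2 \<union> concls L3"
    unfolding L3_def by (intro weaken_right) (use assms in \<open>auto simp: edts_def sub_def\<close>)
  then have 4: "valid_ded E (K \<union> concls L1 \<union> concls L2 \<union> concls L3) L4 \<and>
      (?\<Gamma>, ?\<Delta>) \<in> K \<union> concls L1 \<union> concls L2 \<union> concls L3 \<union> concls L4"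
    unfolding L4_def by (intro contract_right) (use assms in \<open>auto simp: edts_def sub_def\<close>)
  have "(?\<Gamma>, ?\<Delta>) = S" by simp
  with 1 2 3 4 show ?thesis
    unfolding L by (simp add: valid_ded_append Un_assoc image_Un)
qed

lemma first_some_SomeD: "first_some f xs = Some y \<Longrightarrow> \<exists>x\<in>set xs. f x = Some y"
  by (induction xs) (auto split: option.splits)

lemma first_some_None: "first_some f xs = None \<longleftrightarrow> (\<forall>x\<in>set xs. f x = None)"
  by (induction xs) (auto split: option.splits)

text \<open>At depth 0 the search may succeed without deriving anything; with a cut the last
  conclusion is \<open>S\<close>. This is what puts the desired end sequent on the last line of the
  proof.\<close>

lemma srch_valid:
  assumes "srch n Ks S = Some L" "set Ks \<subseteq> K" "edts S" "\<forall>P\<in>set Ks. edts P"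
  shows "valid_ded E K L \<and> S \<in> K \<union> concls L \<and> (0 < n \<longrightarrow> L \<noteq> [] \<and> snd (last L) = S)"
  using assms
proof (induction n arbitrary: S L K)
  case 0
  from 0(1) obtain P where "P \<in> set Ks" "sub P S" "L = weaken P S"
    using first_some_SomeD by (fastforce split: if_splits)
  then show ?case using 0 weaken_valid[of P S K E] by auto
next
  case (Suc n)
  from Suc.prems(1) obtain a L1 L2 where a: "a \<in> set (cands Ks)"
    and L1: "srch n Ks (fst S, a # snd S) = Some L1" and L2: "srch n Ks (a # fst S, snd S) = Some L2"
    and L: "L = L1 @ L2 @ [([(fst S, a # snd S), (a # fst S, snd S)], S)]"
    by (auto dest!: first_some_SomeD split: option.splits)
  have "edt a" using a Suc.prems(4) by (auto simp: cands_def edts_def)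
  then have e: "edts (fst S, a # snd S)" "edts (a # fst S, snd S)"
    using Suc.prems(3) by (auto simp: edts_def)
  have 1: "valid_ded E K L1 \<and> (fst S, a # snd S) \<in> K \<union> concls L1"
    using Suc.IH[OF L1 Suc.prems(2) e(1) Suc.prems(4)] by blast
  have 2: "valid_ded E (K \<union> concls L1) L2 \<and> (a # fst S, snd S) \<in> K \<union> concls L1 \<union> concls L2"
    using Suc.IH[OF L2 _ e(2) Suc.prems(4), of "K \<union> concls L1"] Suc.prems(2) by blast
  have "eldt_rule E [msq (fst S, a # snd S), msq (a # fst S, snd S)] (msq S)"
    using eldt_structural[OF cut[of "mset (fst S)" a "mset (snd S)"]] by (simp add: msq_def)
  with 1 2 show ?case using Suc.prems(3) by (auto simp: L valid_ded_append Un_assoc)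
qed

section \<open>Existence of derivations with a fixed nesting of cuts\<close>

primrec found :: "nat \<Rightarrow> seq set \<Rightarrow> seq \<Rightarrow> bool" where
  "found 0 K S \<longleftrightarrow> (\<exists>P\<in>K. sub P S)"
| "found (Suc n) K S \<longleftrightarrow> (\<exists>a\<in>insert (ELit (Pos 0)) (\<Union>P\<in>K. set (fst P) \<union> set (snd P)).
     found n K (fst S, a # snd S) \<and> found n K (a # fst S, snd S))"

lemma srch_found: "found n (set Ks) S \<Longrightarrow> srch n Ks S \<noteq> None"
proof (induction n arbitrary: S)
  case 0
  then show ?case by (auto simp: first_some_None)
next
  case (Suc n)
  have c: "set (cands Ks) = insert (ELit (Pos 0)) (\<Union>P\<in>set Ks. set (fst P) \<union> set (snd P))"
    by (auto simp: cands_def)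
  from Suc.prems obtain a where a: "a \<in> set (cands Ks)"
    "srch n Ks (fst S, a # snd S) \<noteq> None" "srch n Ks (a # fst S, snd S) \<noteq> None"
    unfolding found.simps c[symmetric] using Suc.IH by blast
  then show ?case by (auto simp: first_some_None intro!: bexI[of _ a])
qed

lemma sub_trans: "sub P S \<Longrightarrow> sub S S' \<Longrightarrow> sub P S'"
  by (auto simp: sub_def)

lemma found_weaken: "found n K S \<Longrightarrow> sub S S' \<Longrightarrow> found n K S'"
proof (induction n arbitrary: S S')
  case 0
  then show ?case using sub_trans unfolding found.simps by blast
next
  case (Suc n)
  then obtain a where a: "a \<in> insert (ELit (Pos 0)) (\<Union>P\<in>K. set (fst P) \<union> set (snd P))"
    "found n K (fst S, a # snd S)" "found n K (a # fst S, snd S)" by auto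
  have "sub (fst S, a # snd S) (fst S', a # snd S')" "sub (a # fst S, snd S) (a # fst S', snd S')"
    using Suc.prems(2) by (auto simp: sub_def)
  with a Suc.IH have "found n K (fst S', a # snd S')" "found n K (a # fst S', snd S')" by blast+
  with a(1) show ?case unfolding found.simps by blast
qed

lemma found_mono: "found n K S \<Longrightarrow> K \<subseteq> K' \<Longrightarrow> found n K' S"
proof (induction n arbitrary: S)
  case (Suc n)
  then obtain a where a: "a \<in> insert (ELit (Pos 0)) (\<Union>P\<in>K. set (fst P) \<union> set (snd P))"
    "found n K (fst S, a # snd S)" "found n K (a # fst S, snd S)" by auto
  then have "a \<in> insert (ELit (Pos 0)) (\<Union>P\<in>K'. set (fst P) \<union> set (snd P))"
    using Suc.prems(2) by auto
  with a Suc show ?case unfolding found.simps by blast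
qed auto

text \<open>A redundant cut on \<open>ELit (Pos 0)\<close>: both of its premises are weakenings of
  \<open>S\<close>.\<close>

lemma found_Suc: "found n K S \<Longrightarrow> found (Suc n) K S"
  using found_weaken[of n K S "(fst S, ELit (Pos 0) # snd S)"]
    found_weaken[of n K S "(ELit (Pos 0) # fst S, snd S)"]
  by (simp add: sub_def subset_insertI)

lemma found_ax:
  assumes "(G, D) \<in> K" "set G \<subseteq> set \<Gamma>" "set D \<subseteq> set \<Delta>"
  shows "found n K (\<Gamma>, \<Delta>)"
proof (induction n)
  case 0
  show ?case using assms by (auto simp: sub_def intro!: bexI[of _ "(G, D)"])
qed (rule found_Suc)

text \<open>A backward step: the known sequent closes one branch of a cut on \<open>a\<close>, so
  \<open>a\<close> may be assumed on the left. The formula \<open>a\<close> is a candidate because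
  it occurs in that sequent; if it does not occur there, the goal is already a weakening of
  it.\<close>

lemma cut_left:
  assumes "(G, D) \<in> K" "set G \<subseteq> set \<Gamma>" "set D \<subseteq> insert a (set \<Delta>)" "found n K (a # \<Gamma>, \<Delta>)"
  shows "found (Suc n) K (\<Gamma>, \<Delta>)"
proof (cases "a \<in> set D")
  case True
  then have "a \<in> (\<Union>P\<in>K. set (fst P) \<union> set (snd P))" using assms(1) by force
  moreover have "found n K (\<Gamma>, a # \<Delta>)" using assms by (intro found_ax) auto
  ultimately show ?thesis using assms(4) by auto
next
  case False
  then show ?thesis using assms by (intro found_ax) auto
qed

lemma cut_right:
  assumes "(G, D) \<in> K" "set G \<subseteq> insert a (set \<Gamma>)" "set D \<subseteq> set \<Delta>" "found n K (\<Gamma>, a # \<Delta>)"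
  shows "found (Suc n) K (\<Gamma>, \<Delta>)"
proof (cases "a \<in> set G")
  case True
  then have "a \<in> (\<Union>P\<in>K. set (fst P) \<union> set (snd P))" using assms(1) by force
  moreover have "found n K (a # \<Gamma>, \<Delta>)" using assms by (intro found_ax) auto
  ultimately show ?thesis using assms(4) by auto
next
  case False
  then show ?thesis using assms by (intro found_ax) auto
qed

lemma flip_Pair [simp]: "flip (G, D) = (D, G)"
  by (simp add: flip_def)

lemma flip_mem [simp]: "(G, D) \<in> flip ` K \<longleftrightarrow> (D, G) \<in> K"
  by (force simp: flip_def)

text \<open>Weakening, cut and the set of candidates are symmetric in the two sides of a sequent.
  This carries the whole duality between conjunction and disjunction.\<close>

lemma found_flip: "found n K S \<Longrightarrow> found n (flip ` K) (flip S)"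
proof (induction n arbitrary: S)
  case 0
  then show ?case by (auto simp: sub_def flip_def)
next
  case (Suc n)
  then obtain a where a: "a \<in> insert (ELit (Pos 0)) (\<Union>P\<in>K. set (fst P) \<union> set (snd P))"
    "found n K (fst S, a # snd S)" "found n K (a # fst S, snd S)" by auto
  have "(\<Union>P\<in>flip ` K. set (fst P) \<union> set (snd P)) = (\<Union>P\<in>K. set (fst P) \<union> set (snd P))"
    by (auto simp: flip_def)
  with a Suc.IH[OF a(2)] Suc.IH[OF a(3)] show ?case
    unfolding found.simps by (auto simp: flip_def)
qed

lemma found_flip_iff: "found n (flip ` K) (G, D) \<longleftrightarrow> found n K (D, G)"
proof -
  have "flip ` flip ` K = K" by (force simp: flip_def)
  then show ?thesis using found_flip[of n "flip ` K" "(G, D)"] found_flip[of n K "(D, G)"]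
    by (auto simp: flip_def)
qed

lemma orient_mem: "orient d S \<in> K \<longleftrightarrow> S \<in> orient d ` K"
  by (cases S; cases d) (simp_all add: orient_def[abs_def])

lemma found_orient: "found n K (orient d S) \<longleftrightarrow> found n (orient d ` K) S"
  by (cases S; cases d) (simp_all add: orient_def[abs_def] found_flip_iff)

abbreviation seqs :: "entry list \<Rightarrow> seq set" where
  "seqs s \<equiv> (\<lambda>e. snd (snd e)) ` set s"

section \<open>From a correct script to a proof\<close>

primrec script_ok :: "efm list \<Rightarrow> seq set \<Rightarrow> entry list \<Rightarrow> bool" where
  "script_ok E K [] \<longleftrightarrow> True"
| "script_ok E K (e # s) \<longleftrightarrow> edts (snd (snd e)) \<and>
     (if fst e then eldt_rule E (map msq (fst (snd e))) (msq (snd (snd e))) \<and> set (fst (snd e)) \<subseteq> K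
      else found 5 K (snd (snd e))) \<and>
     script_ok E (insert (snd (snd e)) K) s"

lemma script_ok_append:
  "script_ok E K (s @ t) \<longleftrightarrow> script_ok E K s \<and> script_ok E (K \<union> seqs s) t"
  by (induction s arbitrary: K) auto

lemma script_ok_mono: "script_ok E K s \<Longrightarrow> K \<subseteq> K' \<Longrightarrow> script_ok E K' s"
proof (induction s arbitrary: K K')
  case (Cons e s)
  then show ?case
    using Cons.IH[of "insert (snd (snd e)) K" "insert (snd (snd e)) K'"] found_mono[OF _ Cons.prems(2)]
      subset_trans[OF _ Cons.prems(2)] insert_mono[OF Cons.prems(2)]
    by (simp split: if_splits)
qed simp

lemma script_ok_concat:
  assumes "\<And>x. x \<in> set xs \<Longrightarrow> script_ok E K (f x)"
  shows "script_ok E K (concat (map f xs))"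
  using assms
proof (induction xs arbitrary: K)
  case (Cons x xs)
  then have "script_ok E (K \<union> seqs (f x)) (concat (map f xs))"
    using script_ok_mono by (metis list.set_intros(2) sup_ge1)
  with Cons.prems show ?case by (simp add: script_ok_append)
qed simp

lemma script_ok_map:
  assumes "\<And>x. x \<in> set xs \<Longrightarrow> script_ok E K [f x]"
  shows "script_ok E K (map f xs)"
  using script_ok_concat[of xs E K "\<lambda>x. [f x]"] assms by simp

lemma dedn_snoc: "dedn (s @ [e]) = dedn s @ gen (e # rev s)"
  by (simp add: dedn_def)

lemma script_ok_edts: "script_ok E K s \<Longrightarrow> S \<in> seqs s \<Longrightarrow> edts S"
  by (induction s arbitrary: K) auto

text \<open>The induction appends at the end, because the search for an entry sees precisely the
  sequents of the entries before it. These are all among the conclusions derived so far.\<close>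

lemma dedn_valid:
  assumes "script_ok E {} s"
  shows "valid_ded E {} (dedn s) \<and> seqs s \<subseteq> concls (dedn s) \<and>
    (s \<noteq> [] \<and> \<not> fst (last s) \<longrightarrow> dedn s \<noteq> [] \<and> snd (last (dedn s)) = snd (snd (last s)))"
  using assms
proof (induction s rule: rev_induct)
  case Nil
  show ?case by (simp add: dedn_def)
next
  case (snoc e s)
  from snoc.prems have s: "script_ok E {} s" and e: "edts (snd (snd e))"
    and e': "if fst e then eldt_rule E (map msq (fst (snd e))) (msq (snd (snd e))) \<and> set (fst (snd e)) \<subseteq> seqs s
      else found 5 (seqs s) (snd (snd e))"
    by (simp_all add: script_ok_append)
  note IH = snoc.IH[OF s]
  show ?case
  proof (cases "fst e")
    case True
    then have "gen (e # rev s) = [snd e]" by (simp add: gen_def)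
    then show ?thesis using IH e e' True by (auto simp: dedn_snoc valid_ded_append)
  next
    case False
    let ?Ks = "map (\<lambda>e. snd (snd e)) (rev s)"
    have "srch 5 ?Ks (snd (snd e)) \<noteq> None"
      using e' False by (intro srch_found) simp
    then obtain L where L: "srch 5 ?Ks (snd (snd e)) = Some L" by blast
    then have g: "gen (e # rev s) = L" using False by (simp add: gen_def)
    have "valid_ded E (concls (dedn s)) L \<and> snd (snd e) \<in> concls (dedn s) \<union> concls L \<and>
        (0 < (5::nat) \<longrightarrow> L \<noteq> [] \<and> snd (last L) = snd (snd e))"
      by (rule srch_valid[OF L]) (use IH e script_ok_edts[OF s] in auto)
    then show ?thesis using IH by (auto simp: dedn_snoc g valid_ded_append)
  qed
qed

lemma idx_nth: "x \<in> set xs \<Longrightarrow> idx x xs < length xs \<and> xs ! idx x xs = x"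
  by (induction xs) auto

lemma idx_take: "x \<in> set (take k xs) \<Longrightarrow> idx x xs < k"
proof (induction xs arbitrary: k)
  case (Cons y xs)
  then show ?case by (cases k) auto
qed simp

lemma valid_ded_nth:
  "valid_ded E K L \<Longrightarrow> k < length L \<Longrightarrow>
   eldt_rule E (map msq (fst (L ! k))) (msq (snd (L ! k))) \<and> set (fst (L ! k)) \<subseteq> K \<union> concls (take k L) \<and>
   edts (snd (L ! k))"
proof (induction L arbitrary: K k)
  case (Cons d L)
  then show ?case
  proof (cases k)
    case (Suc j)
    then show ?thesis using Cons.IH[of "insert (snd d) K" j] Cons.prems by auto
  qed auto
qed simp

lemma conclusion_fst_snd: "conclusion l = (mset (fst (snd l)), mset (snd (snd l)))"
  by (cases l) simp

lemma conclusion_eq: "conclusion l = msq (snd l)"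
  by (simp add: conclusion_fst_snd msq_def)

lemma prem_ids_eq: "prem_ids l = fst l"
  by (cases l) simp

lemma lines_derives:
  assumes "valid_ded E {} L" "L \<noteq> []"
  shows "derives (eldt_rule E) (lines L) (msq (snd (last L)))"
    and "\<forall>l\<in>set (lines L). \<forall>A\<in>line_formulas l. edt A"
proof -
  let ?C = "map snd L"
  have l: "length (lines L) = length L" by (simp add: lines_def)
  have nth: "lines L ! k = (map (\<lambda>P. idx P ?C) (fst (L ! k)), snd (L ! k))" if "k < length L" for k
    using that by (simp add: lines_def Let_def)
  have "(\<forall>i\<in>set (prem_ids (lines L ! k)). i < k) \<and>
      eldt_rule E (map (\<lambda>i. conclusion (lines L ! i)) (prem_ids (lines L ! k))) (conclusion (lines L ! k))"
    if k: "k < length L" for k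
  proof -
    note v = valid_ded_nth[OF assms(1) k]
    have P: "idx P ?C < k \<and> snd (L ! idx P ?C) = P" if "P \<in> set (fst (L ! k))" for P
    proof -
      have "P \<in> set (take k ?C)" using v that by (auto simp: take_map)
      then have "idx P ?C < k" "?C ! idx P ?C = P"
        by (auto intro: idx_take dest: in_set_takeD idx_nth)
      then show ?thesis using k by simp
    qed
    have "conclusion (lines L ! idx P ?C) = msq P" if "P \<in> set (fst (L ! k))" for P
      using P[OF that] k by (simp add: nth conclusion_eq)
    then have "map (\<lambda>i. conclusion (lines L ! i)) (prem_ids (lines L ! k)) = map msq (fst (L ! k))"
      using k by (simp add: nth prem_ids_eq)
    moreover have "conclusion (lines L ! k) = msq (snd (L ! k))" "\<forall>i\<in>set (prem_ids (lines L ! k)). i < k"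
      using P k by (auto simp: nth conclusion_eq prem_ids_eq)
    ultimately show ?thesis using v by (simp only:)
  qed
  then have "derivation (eldt_rule E) (lines L)" by (simp add: derivation_def l)
  moreover have "lines L \<noteq> []" using assms(2) l by force
  moreover have "conclusion (last (lines L)) = msq (snd (last L))"
    using assms(2) \<open>lines L \<noteq> []\<close> l nth[of "length L - 1"]
    by (simp add: last_conv_nth conclusion_eq)
  ultimately show "derives (eldt_rule E) (lines L) (msq (snd (last L)))" by (simp add: derives_def)
  show "\<forall>l\<in>set (lines L). \<forall>A\<in>line_formulas l. edt A"
  proof
    fix l assume "l \<in> set (lines L)"
    then obtain k where k: "k < length L" "l = lines L ! k" by (metis in_set_conv_nth l)
    then show "\<forall>A\<in>line_formulas l. edt A"
      using valid_ded_nth[OF assms(1) k(1)] nth[OF k(1)] by (cases "snd (L ! k)") (auto simp: edts_def)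
  qed
qed

section \<open>Structure of the branching programs\<close>

primrec kids :: "bfm \<Rightarrow> bfm set" where
  "kids (BLit p) = {}"
| "kids (BAnd A B) = {A, B}"
| "kids (BOr A B) = {A, B}"

lemma its_self: "(C, q, B, X, Y) \<in> set (its C B q X Y)"
  by (cases B) auto

text \<open>Walks down a path and recomputes the subformula and its continuations. So an item is
  determined by its key, and repeated keys are harmless. The value beyond a leaf is
  arbitrary.\<close>

primrec loc :: "bfm \<Rightarrow> bool list \<Rightarrow> bfm \<times> key \<times> key" where
  "loc C [] = (C, k0, k1)"
| "loc C (b # q) = (case loc C q of (B, X, Y) \<Rightarrow> case B of
     BLit p \<Rightarrow> (B, X, Y)
   | BAnd A A' \<Rightarrow> if b then (A', X, Y) else (A, X, (C, True # q))
   | BOr A A' \<Rightarrow> if b then (A', X, Y) else (A, (C, True # q), Y))"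

lemma its_loc:
  "loc C q = (B, X, Y) \<Longrightarrow> it \<in> set (its C B q X Y) \<Longrightarrow>
   fst it = C \<and> loc C (fst (snd it)) = snd (snd it)"
proof (induction B arbitrary: q X Y)
  case (BAnd A B)
  then show ?case
    using BAnd.IH(1)[of "False # q" X "(C, True # q)"] BAnd.IH(2)[of "True # q" X Y] by auto
next
  case (BOr A B)
  then show ?case
    using BOr.IH(1)[of "False # q" "(C, True # q)" Y] BOr.IH(2)[of "True # q" X Y] by auto
qed auto

lemma items_eq:
  assumes "it \<in> set (items C)" "it' \<in> set (items C')" "ikey it = ikey it'"
  shows "it = it'"
proof -
  have "fst it = C \<and> loc C (fst (snd it)) = snd (snd it)" "fst it' = C' \<and> loc C' (fst (snd it')) = snd (snd it')"
    using its_loc[of C "[]" C k0 k1 it] its_loc[of C' "[]" C' k0 k1 it'] assms(1,2)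
    by (auto simp: items_def)
  with assms(3) show ?thesis by (auto simp: ikey_def prod_eq_iff)
qed

text \<open>The only occurrence in a literal has the empty path, whereas \<open>k0\<close> and
  \<open>k1\<close> combine a literal with a nonempty one.\<close>

lemma items_not_const:
  assumes "it \<in> set (items C)"
  shows "ikey it \<noteq> k0" "ikey it \<noteq> k1"
proof -
  have C: "fst it = C"
    using its_loc[of C "[]" C k0 k1 it] assms by (auto simp: items_def)
  show "ikey it \<noteq> k0" "ikey it \<noteq> k1"
    using assms C by (cases C; auto simp: ikey_def k0_def k1_def items_def)+
qed

definition refs :: "item \<Rightarrow> key set" where
  "refs it = (case it of (C, q, B, X, Y) \<Rightarrow> case B of
     BLit p \<Rightarrow> {X, Y} | BAnd A A' \<Rightarrow> {(C, False # q)} | BOr A A' \<Rightarrow> {(C, False # q)})"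

primrec ordered :: "key set \<Rightarrow> item list \<Rightarrow> bool" where
  "ordered S [] \<longleftrightarrow> True"
| "ordered S (it # I) \<longleftrightarrow> refs it \<subseteq> S \<and> ordered (insert (ikey it) S) I"

lemma ordered_append: "ordered S (I @ J) \<longleftrightarrow> ordered S I \<and> ordered (S \<union> ikey ` set I) J"
  by (induction I arbitrary: S) auto

lemma ikey_mem: "(C, q) \<in> ikey ` set (its C B q X Y)"
  using its_self[of C q B X Y] by (force simp: ikey_def)

lemma ordered_its: "X \<in> S \<Longrightarrow> Y \<in> S \<Longrightarrow> ordered S (its C B q X Y)"
proof (induction B arbitrary: q X Y S)
  case (BLit p)
  then show ?case by (simp add: refs_def)
next
  case (BAnd A B)
  then show ?case
    using ikey_mem[of C "True # q" B X Y] ikey_mem[of C "False # q" A X "(C, True # q)"]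
    by (simp add: ordered_append refs_def)
next
  case (BOr A B)
  then show ?case
    using ikey_mem[of C "True # q" B X Y] ikey_mem[of C "False # q" A "(C, True # q)" Y]
    by (simp add: ordered_append refs_def)
qed

lemma ordered_all: "k0 \<in> S \<Longrightarrow> k1 \<in> S \<Longrightarrow> ordered S (concat (map items Cs))"
proof (induction Cs arbitrary: S)
  case (Cons C Cs)
  then show ?case by (simp add: ordered_append items_def ordered_its)
qed simp

lemma ordered_nth:
  "ordered S I \<Longrightarrow> j < length I \<Longrightarrow> refs (I ! j) \<subseteq> S \<union> ikey ` set (take j I)"
proof (induction I arbitrary: S j)
  case (Cons it I)
  then show ?case
  proof (cases j)
    case (Suc i)
    then show ?thesis using Cons.IH[of "insert (ikey it) S" i] Cons.prems by auto
  qed auto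
qed simp

text \<open>The node laws in the program of \<open>C\<close> are derived from the root laws of its
  proper subformulas. It suffices to ask for immediate subformulas, since the set \<open>S\<close>
  of formulas treated so far remains closed under them.\<close>

primrec kids_first :: "bfm set \<Rightarrow> bfm list \<Rightarrow> bool" where
  "kids_first S [] \<longleftrightarrow> True"
| "kids_first S (C # Cs) \<longleftrightarrow> kids C \<subseteq> S \<and> kids_first (insert C S) Cs"

lemma kids_first_append: "kids_first S (Cs @ Ds) \<longleftrightarrow> kids_first S Cs \<and> kids_first (S \<union> set Cs) Ds"
  by (induction Cs arbitrary: S) auto

lemma isub_mem: "B \<in> isub ` set (its C B q X Y)"
  using its_self[of C q B X Y] by (force simp: isub_def)

lemma kids_first_its: "kids_first S (map isub (its C B q X Y))"
proof (induction B arbitrary: q X Y S)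
  case (BLit p)
  then show ?case by (simp add: isub_def)
next
  case (BAnd A B)
  then show ?case
    using isub_mem[of B C "True # q" X Y] isub_mem[of A C "False # q" X "(C, True # q)"]
    by (simp add: kids_first_append isub_def)
next
  case (BOr A B)
  then show ?case
    using isub_mem[of B C "True # q" X Y] isub_mem[of A C "False # q" "(C, True # q)" Y]
    by (simp add: kids_first_append isub_def)
qed

lemma kids_first_roots: "kids_first S (concat (map (\<lambda>A. map isub (items A)) As))"
proof (induction As arbitrary: S)
  case (Cons A As)
  then show ?case by (simp add: kids_first_append items_def kids_first_its)
qed simp

lemma forms_roots: "A \<in> set (forms \<pi>) \<Longrightarrow> A \<in> set (roots \<pi>)"
  unfolding roots_def items_def by (auto intro!: bexI[of _ A] isub_mem)

section \<open>The extension axioms\<close>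

lemma all_itemsE:
  assumes "it \<in> set (all_items \<pi>)" obtains C where "C \<in> set (roots \<pi>)" "it \<in> set (items C)"
  using assms by (auto simp: all_items_def)

definition defines_key :: "efm list \<Rightarrow> key list \<Rightarrow> key \<Rightarrow> efm \<Rightarrow> bool" where
  "defines_key E K k F \<longleftrightarrow> idx k K < length E \<and> E ! idx k K = F"

lemma defines_const: "defines_key (exts \<pi>) (keys \<pi>) k0 c0" "defines_key (exts \<pi>) (keys \<pi>) k1 c1"
  by (simp_all add: defines_key_def keys_def exts_def k0_def k1_def)

lemma defines_item:
  assumes it: "it \<in> set (all_items \<pi>)"
  shows "defines_key (exts \<pi>) (keys \<pi>) (ikey it) (edef (keys \<pi>) it)"
proof -
  let ?I = "all_items \<pi>" and ?K = "keys \<pi>"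
  from it obtain C0 where "it \<in> set (items C0)" by (rule all_itemsE)
  note ne = items_not_const[OF this]
  define j where "j = idx (ikey it) (map ikey ?I)"
  \<comment> \<open>The two constants come first, so items are shifted by two.\<close>
  have i: "idx (ikey it) ?K = Suc (Suc j)" using ne by (simp add: keys_def j_def)
  have "ikey it \<in> set (map ikey ?I)" using it by simp
  from idx_nth[OF this] have j: "j < length ?I" "ikey (?I ! j) = ikey it"
    by (auto simp: j_def)
  obtain C C' where C: "it \<in> set (items C)" "?I ! j \<in> set (items C')"
    using it nth_mem[OF j(1)] by (auto elim!: all_itemsE)
  \<comment> \<open>Position \<open>j\<close> is the first with this key and need not be where
    \<open>it\<close> was found, but the items agree.\<close>
  have "?I ! j = it" by (rule items_eq[OF C(2,1) j(2)])
  with j i show ?thesis by (simp add: defines_key_def exts_def)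
qed

lemma exts_axioms: "extension_axioms (exts \<pi>)"
  unfolding extension_axioms_def
proof (intro allI impI)
  fix i assume i: "i < length (exts \<pi>)"
  let ?I = "all_items \<pi>" and ?K = "keys \<pi>"
  consider "i = 0" | "i = 1" | j where "i = Suc (Suc j)" "j < length ?I"
    using i by (auto simp: exts_def less_Suc_eq_0_disj)
  then show "ext_vars (exts \<pi> ! i) \<subseteq> {..<i}"
  proof cases
    case 3
    have "ordered {k0, k1} ?I" unfolding all_items_def by (rule ordered_all) auto
    from ordered_nth[OF this 3(2)] have sub: "refs (?I ! j) \<subseteq> set (take i ?K)"
      by (auto simp: keys_def 3(1) take_map)
    have "idx k ?K < i" if "k \<in> refs (?I ! j)" for k
      by (rule idx_take) (rule subsetD[OF sub that])
    then have "ext_vars (edef ?K (?I ! j)) \<subseteq> {..<i}"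
      by (auto simp: edef_def refs_def ev_def split: prod.splits bfm.splits)
    then show ?thesis by (simp add: exts_def 3)
  qed (auto simp: exts_def c0_def c1_def)
qed

lemma edt_edef: "edt (edef K it)"
  by (auto simp: edef_def ev_def split: prod.split bfm.split)

lemma exts_edt: "A \<in> set (exts \<pi>) \<Longrightarrow> edt A"
  by (auto simp: exts_def c0_def c1_def edt_edef)

lemma refs_keys:
  assumes "it \<in> set (all_items \<pi>)"
  shows "refs it \<subseteq> {k0, k1} \<union> ikey ` set (all_items \<pi>)"
proof -
  have "ordered {k0, k1} (all_items \<pi>)" unfolding all_items_def by (rule ordered_all) auto
  moreover obtain j where "j < length (all_items \<pi>)" "it = all_items \<pi> ! j"
    using assms by (metis in_set_conv_nth)
  ultimately show ?thesis using ordered_nth by (fastforce dest: in_set_takeD)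
qed

section \<open>Validity of the script\<close>

text \<open>Unary form, so that each application of \<open>cut_left\<close> or
  \<open>cut_right\<close> uses up one \<open>Suc\<close>; \<open>found_ax\<close> then closes the
  goal at whatever depth remains.\<close>

lemma five: "(5::nat) = Suc (Suc (Suc (Suc (Suc 0))))"
  by simp

lemma edts_simps [simp]:
  "edts (\<Gamma>, \<Delta>) \<longleftrightarrow> (\<forall>A\<in>set \<Gamma>. edt A) \<and> (\<forall>A\<in>set \<Delta>. edt A)"
  by (auto simp: edts_def)

lemma edt_ev [simp]: "edt (ev K k)" and edt_tr [simp]: "edt (tr K A)"
  by (simp_all add: ev_def tr_def)

lemma valid_goals:
  "(\<And>S. S \<in> set Ss \<Longrightarrow> edts S \<and> found 5 K S) \<Longrightarrow> script_ok E K (map goal Ss)"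
  by (rule script_ok_map) (simp add: goal_def)

lemma infer2_valid:
  assumes "edts P" "found 5 K P" "edts Q" "found 5 K Q" "edts S"
    "eldt_rule E [msq P, msq Q] (msq S)"
  shows "script_ok E K (infer2 P Q S)"
  using assms found_mono[OF assms(4), of "insert P K"] by (auto simp: infer2_def goal_def)

lemma seqs_infer2 [simp]: "seqs (infer2 P Q S) = {P, Q, S}"
  by (auto simp: infer2_def goal_def)

lemma lit_entries_valid: "script_ok E K (lit_entries p)"
proof -
  have "eldt_rule E [] (msq ([ELit p], [ELit p]))" "eldt_rule E [] (msq ([ELit p, ELit (neg p)], []))"
    "eldt_rule E [] (msq ([], [ELit p, ELit (neg p)]))"
    using literal_axiom.intros[of ELit p] by (auto simp: msq_def intro: eldt_literal)
  then show ?thesis by (simp add: lit_entries_def ax_def)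
qed

lemma ext_entries_valid:
  assumes "defines_key E Ks k F" "edt F"
  shows "script_ok E K (ext_entries (ev Ks k) F)"
proof -
  let ?N = "ev Ks k"
  have r: "eldt_rule E [] (msq ([?N], [F]))" "eldt_rule E [] (msq ([F], [?N]))"
    using assms(1) eldt_ext_l[of "idx k Ks" E] eldt_ext_r[of "idx k Ks" E]
    by (auto simp: msq_def ev_def defines_key_def)
  have "found 5 K' ([?N], [?N])" if "([?N], [F]) \<in> K'" "([F], [?N]) \<in> K'" for K'
    unfolding five by (rule cut_left[OF that(1), where a = F], simp, simp, rule found_ax[OF that(2)], simp_all)
  with r assms(2) show ?thesis by (simp add: ext_entries_def ax_def goal_def)
qed

section \<open>Laws of single nodes and of roots\<close>

definition dec_known :: "seq set \<Rightarrow> efm \<Rightarrow> lit \<Rightarrow> efm \<Rightarrow> bool" where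
  "dec_known K X p Y \<longleftrightarrow> (let P = ELit p; F = EDec X p Y in
     ([F, P], [Y]) \<in> K \<and> ([F], [P, X]) \<in> K \<and> ([P, Y], [F]) \<in> K \<and> ([X], [F, P]) \<in> K)"

lemma dec_entries_known: "seqs (dec_entries X p Y) \<subseteq> K \<Longrightarrow> dec_known K X p Y"
  by (auto simp: dec_entries_def dec_known_def Let_def image_Un)

lemma dec_entries_valid:
  assumes "([ELit p], [ELit p]) \<in> K" "([X], [X]) \<in> K" "([Y], [Y]) \<in> K" "edt X" "edt Y"
  shows "script_ok E K (dec_entries X p Y)"
proof -
  let ?P = "ELit p" let ?F = "EDec X p Y"
  have r: "eldt_rule E [msq ([X, ?P], [?P, Y]), msq ([?P, Y, ?P], [Y])] (msq ([?F, ?P], [Y]))"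
    "eldt_rule E [msq ([X], [?P, ?P, X]), msq ([?P, Y], [?P, X])] (msq ([?F], [?P, X]))"
    "eldt_rule E [msq ([?P, Y], [X, ?P]), msq ([?P, ?P, Y], [Y])] (msq ([?P, Y], [?F]))"
    "eldt_rule E [msq ([X], [X, ?P, ?P]), msq ([?P, X], [Y, ?P])] (msq ([X], [?F, ?P]))"
    using dec_l[of E X "{#?P#}" p "{#Y#}" Y] dec_l[of E X "{#}" p "{#?P, X#}" Y]
      dec_r[of E "{#?P, Y#}" X p "{#}" Y] dec_r[of E "{#X#}" X p "{#?P#}" Y]
    by (simp_all add: msq_def add_mset_commute)
  have f: "found 5 K' ([X, ?P], [?P, Y])" "found 5 K' ([?P, Y, ?P], [Y])"
    "found 5 K' ([X], [?P, ?P, X])" "found 5 K' ([?P, Y], [?P, X])"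
    "found 5 K' ([?P, Y], [X, ?P])" "found 5 K' ([?P, ?P, Y], [Y])"
    "found 5 K' ([X], [X, ?P, ?P])" "found 5 K' ([?P, X], [Y, ?P])" if "K \<subseteq> K'" for K'
    using found_ax[OF subsetD[OF that assms(1)]] found_ax[OF subsetD[OF that assms(2)]]
      found_ax[OF subsetD[OF that assms(3)]] by simp_all
  show ?thesis
    unfolding dec_entries_def Let_def script_ok_append
    by (intro conjI infer2_valid r f) (use assms in auto)
qed

definition nodes_known :: "seq set \<Rightarrow> efm \<Rightarrow> efm \<Rightarrow> efm \<Rightarrow> efm \<Rightarrow> bool" where
  "nodes_known K N B X Y \<longleftrightarrow>
     ([B, N], [Y]) \<in> K \<and> ([B, Y], [N]) \<in> K \<and> ([N], [B, X]) \<in> K \<and> ([X], [B, N]) \<in> K"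

lemma seqs_node_entries: "seqs (node_entries N B X Y) \<subseteq> K \<longleftrightarrow> nodes_known K N B X Y"
  by (auto simp: node_entries_def nodes_known_def goal_def)

lemma nodes_known_flip: "nodes_known (flip ` K) N B X Y \<longleftrightarrow> nodes_known K N B Y X"
  by (auto simp: nodes_known_def)

definition nodes_found :: "seq set \<Rightarrow> efm \<Rightarrow> efm \<Rightarrow> efm \<Rightarrow> efm \<Rightarrow> bool" where
  "nodes_found K N B X Y \<longleftrightarrow>
     found 5 K ([B, N], [Y]) \<and> found 5 K ([B, Y], [N]) \<and> found 5 K ([N], [B, X]) \<and> found 5 K ([X], [B, N])"

lemma nodes_found_flip: "nodes_found (flip ` K) N B X Y \<longleftrightarrow> nodes_found K N B Y X"
  by (auto simp: nodes_found_def found_flip_iff)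

lemma node_entries_valid:
  assumes "nodes_found K N B X Y" "edt N" "edt B" "edt X" "edt Y"
  shows "script_ok E K (node_entries N B X Y)"
proof -
  have "node_entries N B X Y = map goal [([B, N], [Y]), ([B, Y], [N]), ([N], [B, X]), ([X], [B, N])]"
    by (simp add: node_entries_def)
  then show ?thesis using assms by (auto simp: nodes_found_def simp del: list.map intro!: valid_goals)
qed

lemma node_lit_found:
  assumes ev: "([N], [EDec X p Y]) \<in> K" "([EDec X p Y], [N]) \<in> K"
    and dec: "dec_known K X p Y"
    and B: "([B], [ELit p]) \<in> K" "([ELit p], [B]) \<in> K"
  shows "nodes_found K N B X Y"
  unfolding nodes_found_def five
proof (intro conjI)
  let ?P = "ELit p" let ?F = "EDec X p Y" let ?f = "found (Suc (Suc (Suc (Suc (Suc 0)))))"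
  have d: "([?F, ?P], [Y]) \<in> K" "([?F], [?P, X]) \<in> K" "([?P, Y], [?F]) \<in> K" "([X], [?F, ?P]) \<in> K"
    using dec by (simp_all add: dec_known_def Let_def)
  show "?f K ([B, N], [Y])"
    by (rule cut_left[OF B(1), where a = ?P], simp, simp,
        rule cut_left[OF ev(1), where a = ?F], simp, simp, rule found_ax[OF d(1)], simp_all)
  show "?f K ([B, Y], [N])"
    by (rule cut_left[OF B(1), where a = ?P], simp, simp,
        rule cut_right[OF ev(2), where a = ?F], simp, simp, rule found_ax[OF d(3)], simp_all)
  show "?f K ([N], [B, X])"
    by (rule cut_right[OF B(2), where a = ?P], simp, simp,
        rule cut_left[OF ev(1), where a = ?F], simp, simp, rule found_ax[OF d(2)], simp_all)
  show "?f K ([X], [B, N])"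
    by (rule cut_right[OF B(2), where a = ?P], simp, simp,
        rule cut_right[OF ev(2), where a = ?F], simp, simp, rule found_ax[OF d(4)], simp_all)
qed

text \<open>\<open>N\<close> equals \<open>N0\<close>, which acts as \<open>(X A N1)\<close>, and
  \<open>N1\<close> acts as \<open>(X A' Y)\<close>. If \<open>B\<close> is the conjunction of
  \<open>A\<close> and \<open>A'\<close>, both together act as \<open>(X B Y)\<close>. The cuts
  follow this evaluation; no chain in the whole proof is longer than these four.\<close>

lemma node_and_found:
  assumes ev: "([N], [N0]) \<in> K" "([N0], [N]) \<in> K"
    and B: "([B], [A]) \<in> K" "([B], [A']) \<in> K" "([A, A'], [B]) \<in> K"
    and n: "nodes_known K N0 A X N1" "nodes_known K N1 A' X Y"
  shows "nodes_found K N B X Y"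
  unfolding nodes_found_def five
proof (intro conjI)
  let ?f = "found (Suc (Suc (Suc (Suc (Suc 0)))))"
  have l: "([A, N0], [N1]) \<in> K" "([A, N1], [N0]) \<in> K" "([N0], [A, X]) \<in> K" "([X], [A, N0]) \<in> K"
    and r: "([A', N1], [Y]) \<in> K" "([A', Y], [N1]) \<in> K" "([N1], [A', X]) \<in> K" "([X], [A', N1]) \<in> K"
    using n by (simp_all add: nodes_known_def)
  show "?f K ([B, N], [Y])"
    by (rule cut_left[OF ev(1), where a = N0], simp, simp,
        rule cut_left[OF B(1), where a = A], simp, simp,
        rule cut_left[OF l(1), where a = N1], simp, simp,
        rule cut_left[OF B(2), where a = A'], simp, simp, rule found_ax[OF r(1)], simp_all)
  show "?f K ([B, Y], [N])"
    by (rule cut_right[OF ev(2), where a = N0], simp, simp,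
        rule cut_left[OF B(1), where a = A], simp, simp,
        rule cut_left[OF B(2), where a = A'], simp, simp,
        rule cut_left[OF r(2), where a = N1], simp, simp, rule found_ax[OF l(2)], simp_all)
  show "?f K ([N], [B, X])"
    by (rule cut_left[OF ev(1), where a = N0], simp, simp,
        rule cut_left[OF l(3), where a = A], simp, simp,
        rule cut_left[OF l(1), where a = N1], simp, simp,
        rule cut_left[OF r(3), where a = A'], simp, simp, rule found_ax[OF B(3)], simp_all)
  show "?f K ([X], [B, N])"
    by (rule cut_right[OF ev(2), where a = N0], simp, simp,
        rule cut_left[OF l(4), where a = A], simp, simp,
        rule cut_right[OF l(2), where a = N1], simp, simp,
        rule cut_left[OF r(4), where a = A'], simp, simp, rule found_ax[OF B(3)], simp_all)
qed

text \<open>Exchanging the sides of all sequents turns \<open>B\<close> into a conjunction and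
  interchanges the false and the true continuation, so this is the preceding law with
  \<open>X\<close> and \<open>Y\<close> swapped.\<close>

lemma node_or_found:
  assumes "([N], [N0]) \<in> K" "([N0], [N]) \<in> K"
    and "([A], [B]) \<in> K" "([A'], [B]) \<in> K" "([B], [A, A']) \<in> K"
    and "nodes_known K N0 A N1 Y" "nodes_known K N1 A' X Y"
  shows "nodes_found K N B X Y"
  using node_and_found[of N N0 "flip ` K" B A A' Y N1 X] assms
  by (simp add: nodes_known_flip nodes_found_flip)

lemma root_lit_found:
  assumes ev: "([N], [EDec Z p W]) \<in> K" "([EDec Z p W], [N]) \<in> K"
    and dec: "dec_known K Z p W" and const: "([Z], []) \<in> K" "([], [W]) \<in> K"
  shows "found 5 K ([N], [ELit p])" "found 5 K ([ELit p], [N])"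
proof -
  let ?P = "ELit p" let ?F = "EDec Z p W"
  have d: "([?F], [?P, Z]) \<in> K" "([?P, W], [?F]) \<in> K"
    using dec by (simp_all add: dec_known_def Let_def)
  show "found 5 K ([N], [?P])" unfolding five
    by (rule cut_left[OF ev(1), where a = ?F], simp, simp,
        rule cut_right[OF const(1), where a = Z], simp, simp, rule found_ax[OF d(1)], simp_all)
  show "found 5 K ([?P], [N])" unfolding five
    by (rule cut_right[OF ev(2), where a = ?F], simp, simp,
        rule cut_left[OF const(2), where a = W], simp, simp, rule found_ax[OF d(2)], simp_all)
qed

text \<open>With \<open>Z\<close> false and \<open>W\<close> true the program reads
  \<open>(Z A N1)\<close> with \<open>N1\<close> acting as \<open>(Z A' W)\<close>, which is the
  conjunction. At the root the node laws thus become the laws of the connective.\<close>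

lemma root_and_found:
  assumes ev: "([N], [N0]) \<in> K" "([N0], [N]) \<in> K"
    and n: "nodes_known K N0 A Z N1" "nodes_known K N1 A' Z W"
    and const: "([Z], []) \<in> K" "([], [W]) \<in> K"
  shows "found 5 K ([N], [A])" "found 5 K ([N], [A'])" "found 5 K ([A, A'], [N])"
proof -
  have l: "([A, N0], [N1]) \<in> K" "([A, N1], [N0]) \<in> K" "([N0], [A, Z]) \<in> K"
    and r: "([A', W], [N1]) \<in> K" "([N1], [A', Z]) \<in> K"
    using n by (simp_all add: nodes_known_def)
  show "found 5 K ([N], [A])" unfolding five
    by (rule cut_left[OF ev(1), where a = N0], simp, simp,
        rule cut_right[OF const(1), where a = Z], simp, simp, rule found_ax[OF l(3)], simp_all)
  show "found 5 K ([N], [A'])" unfolding five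
    by (rule cut_left[OF ev(1), where a = N0], simp, simp,
        rule cut_right[OF const(1), where a = Z], simp, simp,
        rule cut_left[OF l(3), where a = A], simp, simp,
        rule cut_left[OF l(1), where a = N1], simp, simp, rule found_ax[OF r(2)], simp_all)
  show "found 5 K ([A, A'], [N])" unfolding five
    by (rule cut_right[OF ev(2), where a = N0], simp, simp,
        rule cut_left[OF const(2), where a = W], simp, simp,
        rule cut_left[OF r(1), where a = N1], simp, simp, rule found_ax[OF l(2)], simp_all)
qed

lemma root_or_found:
  assumes "([N], [N0]) \<in> K" "([N0], [N]) \<in> K"
    and "nodes_known K N0 A N1 W" "nodes_known K N1 A' Z W"
    and "([Z], []) \<in> K" "([], [W]) \<in> K"
  shows "found 5 K ([A], [N])" "found 5 K ([A'], [N])" "found 5 K ([N], [A, A'])"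
  using root_and_found[of N N0 "flip ` K" A W N1 A' Z] assms
  by (simp_all add: nodes_known_flip found_flip_iff)

definition lit_known :: "seq set \<Rightarrow> lit \<Rightarrow> bool" where
  "lit_known K p \<longleftrightarrow> ([ELit p], [ELit p]) \<in> K \<and> ([ELit p, ELit (neg p)], []) \<in> K \<and> ([], [ELit p, ELit (neg p)]) \<in> K"

definition base_known :: "seq set \<Rightarrow> key list \<Rightarrow> item set \<Rightarrow> bool" where
  "base_known K Ks I \<longleftrightarrow> ([ev Ks k0], []) \<in> K \<and> ([], [ev Ks k1]) \<in> K \<and>
     (\<forall>it\<in>I. ([ev Ks (ikey it)], [edef Ks it]) \<in> K \<and> ([edef Ks it], [ev Ks (ikey it)]) \<in> K) \<and>
     (\<forall>C q p X Y. (C, q, BLit p, X, Y) \<in> I \<longrightarrow> lit_known K p \<and> dec_known K (ev Ks X) p (ev Ks Y))"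

lemma base_known_mono: "base_known K Ks I \<Longrightarrow> K \<subseteq> K' \<Longrightarrow> base_known K' Ks I"
  unfolding base_known_def dec_known_def lit_known_def Let_def by blast

lemma base_entries_valid:
  fixes \<pi> :: "bfm line list"
  defines "E \<equiv> exts \<pi>" and "Ks \<equiv> keys \<pi>" and "I \<equiv> all_items \<pi>"
  shows "script_ok E {} (base_entries Ks I) \<and> base_known (seqs (base_entries Ks I)) Ks (set I)"
proof -
  let ?P = "Pos 0" and ?N = "Neg 0"
  define s1 where "s1 = concat (map lit_entries (?P # ?N # concat (map (\<lambda>it. icase it (\<lambda>p. [p])) I)))"
  define s2 where "s2 = ext_entries (ev Ks k0) c0 @ ext_entries (ev Ks k1) c1 @
     concat (map (\<lambda>it. ext_entries (ev Ks (ikey it)) (edef Ks it)) I)"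
  define s3 where "s3 = dec_entries (ELit ?P) ?P (ELit ?N) @ dec_entries (ELit ?N) ?P (ELit ?P)"
  define s4 where "s4 = concat (map (\<lambda>it. icase it (\<lambda>p.
       dec_entries (ev Ks (fst (snd (snd (snd it))))) p (ev Ks (snd (snd (snd (snd it))))))) I)"
  define s5 where "s5 = [goal ([ev Ks k0], []), goal ([], [ev Ks k1])]"
  have s: "base_entries Ks I = s1 @ s2 @ s3 @ s4 @ s5"
    by (simp add: base_entries_def s1_def s2_def s3_def s4_def s5_def)
  define K where "K = seqs (s1 @ s2 @ s3 @ s4)"
  have v1: "script_ok E {} s1"
    unfolding s1_def by (intro script_ok_concat lit_entries_valid)
  have v2: "script_ok E (seqs s1) s2"
    unfolding s2_def E_def Ks_def I_def script_ok_append
    by (intro conjI script_ok_concat ext_entries_valid defines_const defines_item)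
      (simp_all add: edt_edef c0_def c1_def)
  have lit: "lit_known (seqs s1) p"
    if "p \<in> set (?P # ?N # concat (map (\<lambda>it. icase it (\<lambda>p. [p])) I))" for p
  proof -
    have "seqs (lit_entries p) \<subseteq> seqs s1" unfolding s1_def using that by (auto 0 3)
    then show ?thesis by (auto simp: lit_entries_def ax_def lit_known_def)
  qed
  have lit': "lit_known (seqs s1) p" if "it \<in> set I" "isub it = BLit p" for it p
    by (rule lit) (use that in \<open>auto simp: icase_def intro!: bexI[of _ it]\<close>)
  have e: "seqs (ext_entries (ev Ks k0) c0) \<subseteq> seqs s2" "seqs (ext_entries (ev Ks k1) c1) \<subseteq> seqs s2"
    "it \<in> set I \<Longrightarrow> seqs (ext_entries (ev Ks (ikey it)) (edef Ks it)) \<subseteq> seqs s2" for it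
    unfolding s2_def by auto
  have id: "([ev Ks k], [ev Ks k]) \<in> seqs s2" if "k \<in> {k0, k1} \<union> ikey ` set I" for k
    using that e by (auto simp: ext_entries_def goal_def ax_def)
  have v3: "script_ok E K' s3" if "seqs s1 \<subseteq> K'" for K'
  proof -
    have "lit_known (seqs s1) ?P" "lit_known (seqs s1) ?N" by (intro lit; simp)+
    then have l: "([ELit ?P], [ELit ?P]) \<in> K''" "([ELit ?N], [ELit ?N]) \<in> K''" if "K' \<subseteq> K''" for K''
      using that \<open>seqs s1 \<subseteq> K'\<close> by (auto simp: lit_known_def)
    show ?thesis unfolding s3_def script_ok_append
      by (intro conjI dec_entries_valid l) auto
  qed
  have v4: "script_ok E K' s4" if "seqs s1 \<subseteq> K'" "seqs s2 \<subseteq> K'" for K'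
    unfolding s4_def
  proof (rule script_ok_concat)
    fix it assume it: "it \<in> set I"
    obtain C q B X Y where eq: "it = (C, q, B, X, Y)" by (cases it)
    show "script_ok E K' (icase it (\<lambda>p.
       dec_entries (ev Ks (fst (snd (snd (snd it))))) p (ev Ks (snd (snd (snd (snd it)))))))"
    proof (cases B)
      case (BLit p)
      have "refs it \<subseteq> {k0, k1} \<union> ikey ` set I" using refs_keys it unfolding I_def by blast
      then have XY: "X \<in> {k0, k1} \<union> ikey ` set I" "Y \<in> {k0, k1} \<union> ikey ` set I"
        by (auto simp: refs_def eq BLit)
      have "([ELit p], [ELit p]) \<in> K'"
        using lit'[OF it, of p] that(1) by (auto simp: lit_known_def eq BLit isub_def)
      moreover have "([ev Ks X], [ev Ks X]) \<in> K'" "([ev Ks Y], [ev Ks Y]) \<in> K'"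
        using id XY that(2) by blast+
      ultimately have "script_ok E K' (dec_entries (ev Ks X) p (ev Ks Y))"
        by (intro dec_entries_valid) auto
      then show ?thesis by (simp add: eq BLit icase_def isub_def)
    qed (simp_all add: eq icase_def isub_def)
  qed
  have v5: "script_ok E K s5"
  proof -
    have n: "([ev Ks k0], [c0]) \<in> K" "([c1], [ev Ks k1]) \<in> K"
      using e(1,2) by (auto simp: K_def ext_entries_def ax_def)
    have "lit_known (seqs s1) ?P" by (intro lit) simp
    then have p: "([ELit ?P, ELit ?N], []) \<in> K" "([], [ELit ?P, ELit ?N]) \<in> K"
      by (auto simp: lit_known_def K_def)
    have "dec_known K (ELit ?P) ?P (ELit ?N)" "dec_known K (ELit ?N) ?P (ELit ?P)"
      by (rule dec_entries_known; force simp: K_def s3_def)+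
    then have d0: "([c0], [ELit ?P, ELit ?P]) \<in> K" "([c0, ELit ?P], [ELit ?N]) \<in> K"
      and d1: "([ELit ?P, ELit ?P], [c1]) \<in> K" "([ELit ?N], [c1, ELit ?P]) \<in> K"
      by (simp_all add: dec_known_def Let_def c0_def c1_def)
    \<comment> \<open>Both branches of \<open>c0\<close> yield the literal, and the literal together
      with \<open>c0\<close> yields its negation, so the axiom for contradictory literals closes the
      derivation. The other case is dual.\<close>
    have "found 5 K ([ev Ks k0], [])" unfolding five
      by (rule cut_left[OF n(1), where a = c0], simp, simp,
          rule cut_left[OF d0(1), where a = "ELit ?P"], simp, simp,
          rule cut_left[OF d0(2), where a = "ELit ?N"], simp, simp, rule found_ax[OF p(1)], simp_all)
    moreover have "found 5 K ([], [ev Ks k1])" unfolding five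
      by (rule cut_right[OF n(2), where a = c1], simp, simp,
          rule cut_right[OF d1(1), where a = "ELit ?P"], simp, simp,
          rule cut_right[OF d1(2), where a = "ELit ?N"], simp, simp, rule found_ax[OF p(2)], simp_all)
    ultimately have "script_ok E K (map goal [([ev Ks k0], []), ([], [ev Ks k1])])"
      by (intro valid_goals) auto
    then show ?thesis by (simp add: s5_def)
  qed
  have v4': "script_ok E (seqs s1 \<union> seqs s2 \<union> seqs s3) s4" by (rule v4) auto
  have "script_ok E {} (base_entries Ks I)"
    using v1 v2 v3[of "seqs s1 \<union> seqs s2"] v4' v5
    by (simp add: s script_ok_append K_def image_Un Un_assoc)
  moreover have "base_known (seqs (base_entries Ks I)) Ks (set I)"
    unfolding base_known_def
  proof (intro conjI allI impI ballI)
    show "([ev Ks k0], []) \<in> seqs (base_entries Ks I)" "([], [ev Ks k1]) \<in> seqs (base_entries Ks I)"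
      by (simp_all add: s s5_def goal_def)
    fix it assume "it \<in> set I"
    from e(3)[OF this] show "([ev Ks (ikey it)], [edef Ks it]) \<in> seqs (base_entries Ks I)"
      "([edef Ks it], [ev Ks (ikey it)]) \<in> seqs (base_entries Ks I)"
      by (auto simp: s ext_entries_def ax_def)
  next
    fix C q p X Y assume it: "(C, q, BLit p, X, Y) \<in> set I"
    then have "lit_known (seqs s1) p" by (rule lit') (simp add: isub_def)
    then show "lit_known (seqs (base_entries Ks I)) p" by (auto simp: lit_known_def s)
    have "seqs (dec_entries (ev Ks X) p (ev Ks Y)) \<subseteq> seqs s4"
      unfolding s4_def using it by (force simp: icase_def isub_def)
    then show "dec_known (seqs (base_entries Ks I)) (ev Ks X) p (ev Ks Y)"
      by (intro dec_entries_known) (auto simp: s)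
  qed
  ultimately show ?thesis ..
qed

section \<open>Laws of all programs, by induction on formulas\<close>

lemma seqs_root_entries:
  "seqs (root_entries Ks (BLit p)) \<subseteq> K \<longleftrightarrow>
     ([tr Ks (BLit p)], [ELit p]) \<in> K \<and> ([ELit p], [tr Ks (BLit p)]) \<in> K"
  "seqs (root_entries Ks (BAnd A B)) \<subseteq> K \<longleftrightarrow> ([tr Ks (BAnd A B)], [tr Ks A]) \<in> K \<and>
     ([tr Ks (BAnd A B)], [tr Ks B]) \<in> K \<and> ([tr Ks A, tr Ks B], [tr Ks (BAnd A B)]) \<in> K"
  "seqs (root_entries Ks (BOr A B)) \<subseteq> K \<longleftrightarrow> ([tr Ks A], [tr Ks (BOr A B)]) \<in> K \<and>
     ([tr Ks B], [tr Ks (BOr A B)]) \<in> K \<and> ([tr Ks (BOr A B)], [tr Ks A, tr Ks B]) \<in> K"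
  by (simp_all add: root_entries_def goal_def)

definition root_known :: "seq set \<Rightarrow> key list \<Rightarrow> bfm \<Rightarrow> bool" where
  "root_known K Ks C \<longleftrightarrow> seqs (root_entries Ks C) \<subseteq> K"

lemma root_known_mono: "root_known K Ks C \<Longrightarrow> K \<subseteq> K' \<Longrightarrow> root_known K' Ks C"
  by (auto simp: root_known_def)

lemma item_entries_node:
  "q \<noteq> [] \<Longrightarrow> item_entries Ks (C, q, B, X, Y) = node_entries (ev Ks (C, q)) (tr Ks B) (ev Ks X) (ev Ks Y)"
  by (cases q) (simp_all add: item_entries_def)

lemma nodes_known_its:
  assumes "q \<noteq> []" "seqs (concat (map (item_entries Ks) (its C B q X Y))) \<subseteq> K"
  shows "nodes_known K (ev Ks (C, q)) (tr Ks B) (ev Ks X) (ev Ks Y)"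
proof -
  have "seqs (item_entries Ks (C, q, B, X, Y)) \<subseteq> K"
    using assms(2) its_self[of C q B X Y] by auto
  then show ?thesis by (simp add: item_entries_node[OF assms(1)] seqs_node_entries)
qed

lemma base_known_item:
  assumes "base_known K Ks I" "(C, q, B, X, Y) \<in> I"
  shows "([ev Ks (C, q)], [edef Ks (C, q, B, X, Y)]) \<in> K" "([edef Ks (C, q, B, X, Y)], [ev Ks (C, q)]) \<in> K"
  using assms unfolding base_known_def by (force simp: ikey_def)+

lemma item_and_valid:
  assumes "([ev Ks (C, q)], [ev Ks (C, False # q)]) \<in> K" "([ev Ks (C, False # q)], [ev Ks (C, q)]) \<in> K"
    and "nodes_known K (ev Ks (C, False # q)) (tr Ks A) (ev Ks X) (ev Ks (C, True # q))"
    and "nodes_known K (ev Ks (C, True # q)) (tr Ks A') (ev Ks X) (ev Ks Y)"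
    and "([ev Ks k0], []) \<in> K" "([], [ev Ks k1]) \<in> K"
    and "q \<noteq> [] \<Longrightarrow> root_known K Ks (BAnd A A')" "q = [] \<Longrightarrow> C = BAnd A A' \<and> X = k0 \<and> Y = k1"
  shows "script_ok E K (item_entries Ks (C, q, BAnd A A', X, Y))"
proof (cases q)
  case Nil
  with assms have "script_ok E K (map goal [([tr Ks C], [tr Ks A]), ([tr Ks C], [tr Ks A']), ([tr Ks A, tr Ks A'], [tr Ks C])])"
    using root_and_found[of "tr Ks C" "ev Ks (C, [False])" K "tr Ks A" "ev Ks k0" "ev Ks (C, [True])" "tr Ks A'" "ev Ks k1"]
    by (intro valid_goals) (auto simp: tr_def)
  then show ?thesis using Nil assms(8) by (simp add: item_entries_def root_entries_def)
next
  case (Cons b r)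
  then show ?thesis using assms
    by (auto simp: item_entries_node root_known_def seqs_root_entries intro!: node_entries_valid
        node_and_found[where A = "tr Ks A" and A' = "tr Ks A'"])
qed

lemma item_or_valid:
  assumes "([ev Ks (C, q)], [ev Ks (C, False # q)]) \<in> K" "([ev Ks (C, False # q)], [ev Ks (C, q)]) \<in> K"
    and "nodes_known K (ev Ks (C, False # q)) (tr Ks A) (ev Ks (C, True # q)) (ev Ks Y)"
    and "nodes_known K (ev Ks (C, True # q)) (tr Ks A') (ev Ks X) (ev Ks Y)"
    and "([ev Ks k0], []) \<in> K" "([], [ev Ks k1]) \<in> K"
    and "q \<noteq> [] \<Longrightarrow> root_known K Ks (BOr A A')" "q = [] \<Longrightarrow> C = BOr A A' \<and> X = k0 \<and> Y = k1"
  shows "script_ok E K (item_entries Ks (C, q, BOr A A', X, Y))"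
proof (cases q)
  case Nil
  with assms have "script_ok E K (map goal [([tr Ks A], [tr Ks C]), ([tr Ks A'], [tr Ks C]), ([tr Ks C], [tr Ks A, tr Ks A'])])"
    using root_or_found[of "tr Ks C" "ev Ks (C, [False])" K "tr Ks A" "ev Ks (C, [True])" "ev Ks k1" "tr Ks A'" "ev Ks k0"]
    by (intro valid_goals) (auto simp: tr_def)
  then show ?thesis using Nil assms(8) by (simp add: item_entries_def root_entries_def)
next
  case (Cons b r)
  then show ?thesis using assms
    by (auto simp: item_entries_node root_known_def seqs_root_entries intro!: node_entries_valid
        node_or_found[where A = "tr Ks A" and A' = "tr Ks A'"])
qed

text \<open>Below the root the law of \<open>B\<close> in its own program is available because
  \<open>B\<close> lies in \<open>S\<close>. At the root \<open>B\<close> is \<open>C\<close>, whose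
  law is only about to be derived; there the laws of the two operand nodes, just obtained, and the
  constants suffice.\<close>

lemma its_valid:
  assumes "base_known K Ks I" "set (its C B q X Y) \<subseteq> I"
    "q = [] \<longrightarrow> B = C \<and> X = k0 \<and> Y = k1" "q \<noteq> [] \<longrightarrow> B \<in> S" "kids B \<subseteq> S"
    "\<forall>B\<in>S. kids B \<subseteq> S" "\<forall>B\<in>S. root_known K Ks B"
  shows "script_ok E K (concat (map (item_entries Ks) (its C B q X Y)))"
  using assms
proof (induction B arbitrary: q X Y K)
  case (BLit p)
  have it: "(C, q, BLit p, X, Y) \<in> I" using BLit.prems(2) by simp
  have d: "dec_known K (ev Ks X) p (ev Ks Y)"
    using BLit.prems(1) it unfolding base_known_def by blast
  have c: "([ev Ks k0], []) \<in> K" "([], [ev Ks k1]) \<in> K"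
    using BLit.prems(1) by (simp_all add: base_known_def)
  have e: "([ev Ks (C, q)], [EDec (ev Ks X) p (ev Ks Y)]) \<in> K" "([EDec (ev Ks X) p (ev Ks Y)], [ev Ks (C, q)]) \<in> K"
    using base_known_item[OF BLit.prems(1) it] by (simp_all add: edef_def)
  show ?case
  proof (cases "q = []")
    case True
    with BLit.prems(3) e d c have "script_ok E K (map goal [([tr Ks C], [ELit p]), ([ELit p], [tr Ks C])])"
      by (intro valid_goals) (auto simp: tr_def intro: root_lit_found)
    with True BLit.prems(3) show ?thesis by (auto simp: item_entries_def root_entries_def)
  next
    case False
    then have "root_known K Ks (BLit p)" using BLit.prems by blast
    then have "script_ok E K (node_entries (ev Ks (C, q)) (tr Ks (BLit p)) (ev Ks X) (ev Ks Y))"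
      using e d by (intro node_entries_valid node_lit_found) (auto simp: root_known_def seqs_root_entries)
    with False show ?thesis by (simp add: item_entries_node)
  qed
next
  case (BAnd A A')
  define r where "r = concat (map (item_entries Ks) (its C A' (True # q) X Y))"
  define l where "l = concat (map (item_entries Ks) (its C A (False # q) X (C, True # q)))"
  let ?K = "K \<union> seqs r \<union> seqs l"
  have it: "(C, q, BAnd A A', X, Y) \<in> I" using BAnd.prems(2) by simp
  have r: "script_ok E K r"
    unfolding r_def by (rule BAnd.IH(2)) (use BAnd.prems in auto)
  have l: "script_ok E (K \<union> seqs r) l"
    unfolding l_def by (rule BAnd.IH(1)) (use BAnd.prems in
      \<open>auto intro: base_known_mono root_known_mono\<close>)
  have "script_ok E ?K (item_entries Ks (C, q, BAnd A A', X, Y))"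
  proof (rule item_and_valid)
    show "([ev Ks (C, q)], [ev Ks (C, False # q)]) \<in> ?K" "([ev Ks (C, False # q)], [ev Ks (C, q)]) \<in> ?K"
      using base_known_item[OF BAnd.prems(1) it] by (auto simp: edef_def)
    show "nodes_known ?K (ev Ks (C, False # q)) (tr Ks A) (ev Ks X) (ev Ks (C, True # q))"
      "nodes_known ?K (ev Ks (C, True # q)) (tr Ks A') (ev Ks X) (ev Ks Y)"
      by (rule nodes_known_its; auto simp: l_def r_def)+
  qed (use BAnd.prems in \<open>auto simp: base_known_def intro: root_known_mono\<close>)
  with l r show ?case by (simp add: script_ok_append r_def l_def Un_assoc)
next
  case (BOr A A')
  define r where "r = concat (map (item_entries Ks) (its C A' (True # q) X Y))"
  define l where "l = concat (map (item_entries Ks) (its C A (False # q) (C, True # q) Y))"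
  let ?K = "K \<union> seqs r \<union> seqs l"
  have it: "(C, q, BOr A A', X, Y) \<in> I" using BOr.prems(2) by simp
  have r: "script_ok E K r"
    unfolding r_def by (rule BOr.IH(2)) (use BOr.prems in auto)
  have l: "script_ok E (K \<union> seqs r) l"
    unfolding l_def by (rule BOr.IH(1)) (use BOr.prems in
      \<open>auto intro: base_known_mono root_known_mono\<close>)
  have "script_ok E ?K (item_entries Ks (C, q, BOr A A', X, Y))"
  proof (rule item_or_valid)
    show "([ev Ks (C, q)], [ev Ks (C, False # q)]) \<in> ?K" "([ev Ks (C, False # q)], [ev Ks (C, q)]) \<in> ?K"
      using base_known_item[OF BOr.prems(1) it] by (auto simp: edef_def)
    show "nodes_known ?K (ev Ks (C, False # q)) (tr Ks A) (ev Ks (C, True # q)) (ev Ks Y)"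
      "nodes_known ?K (ev Ks (C, True # q)) (tr Ks A') (ev Ks X) (ev Ks Y)"
      by (rule nodes_known_its; auto simp: l_def r_def)+
  qed (use BOr.prems in \<open>auto simp: base_known_def intro: root_known_mono\<close>)
  with l r show ?case by (simp add: script_ok_append r_def l_def Un_assoc)
qed

lemma root_known_items: "root_known (seqs (concat (map (item_entries Ks) (items C)))) Ks C"
proof -
  have "item_entries Ks (C, [], C, k0, k1) = root_entries Ks C"
    by (simp add: item_entries_def)
  moreover have "(C, [], C, k0, k1) \<in> set (items C)" by (simp add: items_def its_self)
  ultimately show ?thesis by (force simp: root_known_def)
qed

lemma roots_valid:
  assumes "kids_first S Cs" "\<forall>B\<in>S. kids B \<subseteq> S" "\<forall>B\<in>S. root_known K Ks B"
    "base_known K Ks I" "\<forall>C\<in>set Cs. set (items C) \<subseteq> I"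
  shows "script_ok E K (concat (map (item_entries Ks) (concat (map items Cs)))) \<and>
    (\<forall>C\<in>set Cs. root_known (K \<union> seqs (concat (map (item_entries Ks) (concat (map items Cs))))) Ks C)"
  using assms
proof (induction Cs arbitrary: S K)
  case (Cons C Cs)
  define s where "s = concat (map (item_entries Ks) (items C))"
  define t where "t = concat (map (item_entries Ks) (concat (map items Cs)))"
  have C: "script_ok E K s" "root_known (seqs s) Ks C"
    unfolding s_def using root_known_items Cons.prems
    by (auto simp: items_def intro!: its_valid[where S = S and I = I])
  have "script_ok E (K \<union> seqs s) t \<and> (\<forall>C\<in>set Cs. root_known ((K \<union> seqs s) \<union> seqs t) Ks C)"
    unfolding t_def
  proof (rule Cons.IH)
    show "kids_first (insert C S) Cs" using Cons.prems(1) by simp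
    show "\<forall>B\<in>insert C S. kids B \<subseteq> insert C S" using Cons.prems(1,2) by auto
    show "\<forall>B\<in>insert C S. root_known (K \<union> seqs s) Ks B"
      using C(2) Cons.prems(3) by (auto intro: root_known_mono)
    show "base_known (K \<union> seqs s) Ks I" by (rule base_known_mono[OF Cons.prems(4)]) simp
    show "\<forall>C\<in>set Cs. set (items C) \<subseteq> I" using Cons.prems(5) by simp
  qed
  moreover have "concat (map (item_entries Ks) (concat (map items (C # Cs)))) = s @ t"
    by (simp add: s_def t_def)
  moreover have "root_known (K \<union> (seqs s \<union> seqs t)) Ks C" using C(2) by (rule root_known_mono) auto
  ultimately show ?case using C(1) by (simp add: script_ok_append image_Un Un_assoc)
qed simp

section \<open>Simulation of the LK inferences\<close>

text \<open>Only the sets of formulas matter, since the search ignores order and multiplicity.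
  Positions in the LK proof and the listing of a cedent disappear from the simulation.\<close>

definition repr :: "seq set \<Rightarrow> key list \<Rightarrow> bfm sequent \<Rightarrow> bool" where
  "repr K Ks P \<longleftrightarrow> (\<exists>G D. (G, D) \<in> K \<and> set G = tr Ks ` set_mset (fst P) \<and> set D = tr Ks ` set_mset (snd P))"

lemma set_eq_insert: "mset xs = add_mset x M \<Longrightarrow> set xs = insert x (set_mset M)"
  by (metis set_mset_add_mset_insert set_mset_mset)

text \<open>On sets of formulas both contraction and weakening are inclusions, so cut is the only
  structural rule with content.\<close>

lemma structural_cases:
  assumes "structural_rule Ps (mset \<Gamma>, mset \<Delta>)"
  shows "(\<exists>P\<in>set Ps. set_mset (fst P) \<subseteq> set \<Gamma> \<and> set_mset (snd P) \<subseteq> set \<Delta>) \<or>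
    (\<exists>A. Ps = [(mset \<Gamma>, add_mset A (mset \<Delta>)), (add_mset A (mset \<Gamma>), mset \<Delta>)])"
  using assms by cases (auto dest!: set_eq_insert)

text \<open>Each logical rule becomes cuts of the translated premises against the root laws of its
  principal formula. That formula stands in the conclusion, so \<open>known\<close> need not speak
  of premises; a cut formula is used only through its root variable.\<close>

lemma lk_step:
  assumes rule: "lk_rule Ps (mset \<Gamma>, mset \<Delta>)" and prems: "\<forall>P\<in>set Ps. repr K Ks P"
    and known: "\<forall>A\<in>set \<Gamma> \<union> set \<Delta>. root_known K Ks A"
    and lit: "\<forall>p. BLit p \<in> set \<Gamma> \<union> set \<Delta> \<longrightarrow> lit_known K p"
  shows "found 5 K (map (tr Ks) \<Gamma>, map (tr Ks) \<Delta>)"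
  using rule
proof cases
  case lk_literal
  from lk_literal(2) show ?thesis
  proof cases
    case (1 p)
    then have s: "set \<Gamma> = {BLit p}" "set \<Delta> = {BLit p}" by (metis set_mset_add_mset_insert set_mset_empty set_mset_mset)+
    then have "root_known K Ks (BLit p)" using known by auto
    then have k: "([tr Ks (BLit p)], [ELit p]) \<in> K" "([ELit p], [tr Ks (BLit p)]) \<in> K"
      unfolding root_known_def seqs_root_entries by auto
    show ?thesis unfolding five
      by (rule cut_left[OF k(1), where a = "ELit p"], simp add: s, simp, rule found_ax[OF k(2)], simp_all add: s)
  next
    case (2 p)
    then have s: "set \<Gamma> = {BLit p, BLit (neg p)}" "set \<Delta> = {}" by (metis set_mset_add_mset_insert set_mset_empty set_mset_mset)+
    then have "root_known K Ks (BLit p)" "root_known K Ks (BLit (neg p))" "lit_known K p" using known lit by auto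
    then have k: "([tr Ks (BLit p)], [ELit p]) \<in> K" "([tr Ks (BLit (neg p))], [ELit (neg p)]) \<in> K"
       "([ELit p, ELit (neg p)], []) \<in> K"
      unfolding root_known_def seqs_root_entries lit_known_def by auto
    show ?thesis unfolding five
      by (rule cut_left[OF k(1), where a = "ELit p"], simp add: s, simp,
          rule cut_left[OF k(2), where a = "ELit (neg p)"], simp add: s, simp,
          rule found_ax[OF k(3)], simp_all add: s)
  next
    case (3 p)
    then have s: "set \<Delta> = {BLit p, BLit (neg p)}" "set \<Gamma> = {}" by (metis set_mset_add_mset_insert set_mset_empty set_mset_mset)+
    then have "root_known K Ks (BLit p)" "root_known K Ks (BLit (neg p))" "lit_known K p" using known lit by auto
    then have k: "([ELit p], [tr Ks (BLit p)]) \<in> K" "([ELit (neg p)], [tr Ks (BLit (neg p))]) \<in> K"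
       "([], [ELit p, ELit (neg p)]) \<in> K"
      unfolding root_known_def seqs_root_entries lit_known_def by auto
    show ?thesis unfolding five
      by (rule cut_right[OF k(1), where a = "ELit p"], simp, simp add: s,
          rule cut_right[OF k(2), where a = "ELit (neg p)"], simp, simp add: s,
          rule found_ax[OF k(3)], simp_all add: s)
  qed
next
  case lk_structural
  from structural_cases[OF lk_structural] show ?thesis
  proof
    assume "\<exists>P\<in>set Ps. set_mset (fst P) \<subseteq> set \<Gamma> \<and> set_mset (snd P) \<subseteq> set \<Delta>"
    then obtain P where "P \<in> set Ps" "set_mset (fst P) \<subseteq> set \<Gamma>" "set_mset (snd P) \<subseteq> set \<Delta>"
      by blast
    moreover from this prems obtain G D where P: "(G, D) \<in> K"
      "set G = tr Ks ` set_mset (fst P)" "set D = tr Ks ` set_mset (snd P)"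
      by (auto simp: repr_def)
    ultimately show ?thesis by (intro found_ax[OF P(1)]) auto
  next
    assume "\<exists>A. Ps = [(mset \<Gamma>, add_mset A (mset \<Delta>)), (add_mset A (mset \<Gamma>), mset \<Delta>)]"
    then obtain A G1 D1 G2 D2 where P: "(G1, D1) \<in> K" "set G1 = tr Ks ` set \<Gamma>"
      "set D1 = insert (tr Ks A) (tr Ks ` set \<Delta>)"
      "(G2, D2) \<in> K" "set G2 = insert (tr Ks A) (tr Ks ` set \<Gamma>)" "set D2 = tr Ks ` set \<Delta>"
      using prems by (auto simp: repr_def)
    show ?thesis unfolding five
      by (rule cut_left[OF P(1), where a = "tr Ks A"], simp add: P, simp add: P,
          rule found_ax[OF P(4)], simp_all add: P)
  qed
next
  case (and_l A B G)
  from prems obtain G' D' where P: "(G', D') \<in> K" "set G' = insert (tr Ks A) (insert (tr Ks B) (tr Ks ` set_mset G))"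
    "set D' = tr Ks ` set \<Delta>"
    unfolding and_l repr_def by auto
  have s: "set \<Gamma> = insert (BAnd A B) (set_mset G)"
    using and_l by (auto dest!: set_eq_insert)
  then have "root_known K Ks (BAnd A B)" using known by auto
  then have k: "([tr Ks (BAnd A B)], [tr Ks A]) \<in> K" "([tr Ks (BAnd A B)], [tr Ks B]) \<in> K"
    unfolding root_known_def seqs_root_entries by auto
  show ?thesis unfolding five
    by (rule cut_left[OF k(1), where a = "tr Ks A"], simp add: s, simp,
        rule cut_left[OF k(2), where a = "tr Ks B"], simp add: s, simp,
        rule found_ax[OF P(1)], use P s in auto)
next
  case (and_r A D B)
  from prems obtain G1 D1 G2 D2 where P: "(G1, D1) \<in> K" "set G1 = tr Ks ` set \<Gamma>"
    "set D1 = insert (tr Ks A) (tr Ks ` set_mset D)"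
    "(G2, D2) \<in> K" "set G2 = tr Ks ` set \<Gamma>" "set D2 = insert (tr Ks B) (tr Ks ` set_mset D)"
    unfolding and_r repr_def by auto
  have s: "set \<Delta> = insert (BAnd A B) (set_mset D)"
    using and_r by (auto dest!: set_eq_insert)
  then have "root_known K Ks (BAnd A B)" using known by auto
  then have k: "([tr Ks A, tr Ks B], [tr Ks (BAnd A B)]) \<in> K"
    unfolding root_known_def seqs_root_entries by auto
  show ?thesis unfolding five
    by (rule cut_left[OF P(1), where a = "tr Ks A"], use P s in force, use P s in force,
        rule cut_left[OF P(4), where a = "tr Ks B"], use P s in force, use P s in force,
        rule found_ax[OF k], simp_all add: s)
next
  case (or_l A G B)
  from prems obtain G1 D1 G2 D2 where P: "(G1, D1) \<in> K" "set G1 = insert (tr Ks A) (tr Ks ` set_mset G)"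
    "set D1 = tr Ks ` set \<Delta>"
    "(G2, D2) \<in> K" "set G2 = insert (tr Ks B) (tr Ks ` set_mset G)" "set D2 = tr Ks ` set \<Delta>"
    unfolding or_l repr_def by auto
  have s: "set \<Gamma> = insert (BOr A B) (set_mset G)"
    using or_l by (auto dest!: set_eq_insert)
  then have "root_known K Ks (BOr A B)" using known by auto
  then have k: "([tr Ks (BOr A B)], [tr Ks A, tr Ks B]) \<in> K"
    unfolding root_known_def seqs_root_entries by auto
  show ?thesis unfolding five
    by (rule cut_right[OF P(1), where a = "tr Ks A"], use P s in force, use P s in force,
        rule cut_right[OF P(4), where a = "tr Ks B"], use P s in force, use P s in force,
        rule found_ax[OF k], simp_all add: s)
next
  case (or_r A B D)
  from prems obtain G' D' where P: "(G', D') \<in> K" "set D' = insert (tr Ks A) (insert (tr Ks B) (tr Ks ` set_mset D))"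
    "set G' = tr Ks ` set \<Gamma>"
    unfolding or_r repr_def by auto
  have s: "set \<Delta> = insert (BOr A B) (set_mset D)"
    using or_r by (auto dest!: set_eq_insert)
  then have "root_known K Ks (BOr A B)" using known by auto
  then have k: "([tr Ks A], [tr Ks (BOr A B)]) \<in> K" "([tr Ks B], [tr Ks (BOr A B)]) \<in> K"
    unfolding root_known_def seqs_root_entries by auto
  show ?thesis unfolding five
    by (rule cut_right[OF k(1), where a = "tr Ks A"], simp, simp add: s,
        rule cut_right[OF k(2), where a = "tr Ks B"], simp, simp add: s,
        rule found_ax[OF P(1)], use P s in auto)
qed

lemma lk_lines_valid:
  assumes "derivation lk_rule \<pi>" "\<forall>A\<in>set (forms \<pi>). root_known K Ks A"
    "\<forall>p. BLit p \<in> set (forms \<pi>) \<longrightarrow> lit_known K p"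
  shows "script_ok E K (map (\<lambda>l. goal (map (tr Ks) (fst (snd l)), map (tr Ks) (snd (snd l)))) \<pi>)"
proof -
  let ?g = "\<lambda>l :: bfm line. (map (tr Ks) (fst (snd l)), map (tr Ks) (snd (snd l)))"
  have "script_ok E K (map (\<lambda>l. goal (?g l)) (take n \<pi>))" if "n \<le> length \<pi>" for n
    using that
  proof (induction n)
    case (Suc n)
    let ?K = "K \<union> ?g ` set (take n \<pi>)"
    obtain ps \<Gamma> \<Delta> where l: "\<pi> ! n = (ps, \<Gamma>, \<Delta>)" by (cases "\<pi> ! n")
    have n: "n < length \<pi>" using Suc.prems by simp
    then have mem: "(ps, \<Gamma>, \<Delta>) \<in> set \<pi>" using l nth_mem by metis
    have step: "\<forall>i\<in>set ps. i < n" "lk_rule (map (\<lambda>i. conclusion (\<pi> ! i)) ps) (mset \<Gamma>, mset \<Delta>)"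
      using assms(1) n l unfolding derivation_def by (metis conclusion.simps prem_ids.simps)+
    have fm: "A \<in> set (forms \<pi>)" if "A \<in> set \<Gamma> \<union> set \<Delta>" for A
      using that mem by (force simp: forms_def)
    have "found 5 ?K (map (tr Ks) \<Gamma>, map (tr Ks) \<Delta>)"
    proof (rule lk_step[OF step(2)])
      show "\<forall>P\<in>set (map (\<lambda>i. conclusion (\<pi> ! i)) ps). repr ?K Ks P"
      proof
        fix P assume "P \<in> set (map (\<lambda>i. conclusion (\<pi> ! i)) ps)"
        then obtain i where i: "i < n" "P = conclusion (\<pi> ! i)" using step(1) by auto
        then have "\<pi> ! i \<in> set (take n \<pi>)" using n by (auto simp: in_set_conv_nth)
        then have "?g (\<pi> ! i) \<in> ?K" by blast
        then show "repr ?K Ks P"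
          unfolding repr_def i(2)
          by (intro exI[of _ "fst (?g (\<pi> ! i))"] exI[of _ "snd (?g (\<pi> ! i))"]) (simp add: conclusion_fst_snd)
      qed
      show "\<forall>A\<in>set \<Gamma> \<union> set \<Delta>. root_known ?K Ks A"
        using fm assms(2) by (auto intro: root_known_mono)
      show "\<forall>p. BLit p \<in> set \<Gamma> \<union> set \<Delta> \<longrightarrow> lit_known ?K p"
        using fm assms(3) by (auto simp: lit_known_def)
    qed
    moreover have "seqs (map (\<lambda>l. goal (?g l)) (take n \<pi>)) = ?g ` set (take n \<pi>)"
      by (auto simp: goal_def image_image)
    ultimately have "script_ok E (K \<union> seqs (map (\<lambda>l. goal (?g l)) (take n \<pi>))) [goal (?g (\<pi> ! n))]"
      by (auto simp: goal_def l)
    then show ?case using Suc n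
      by (simp only: take_Suc_conv_app_nth map_append list.map script_ok_append)
  qed simp
  from this[of "length \<pi>"] show ?thesis by simp
qed

section \<open>The final sequent\<close>

primrec is_junct :: "bool \<Rightarrow> bfm \<Rightarrow> bool" where
  "is_junct d (BLit p) \<longleftrightarrow> True"
| "is_junct d (BAnd A B) \<longleftrightarrow> \<not> d \<and> is_junct d A \<and> is_junct d B"
| "is_junct d (BOr A B) \<longleftrightarrow> d \<and> is_junct d A \<and> is_junct d B"

lemma disjunction_of_lits: "disjunction_of ps A \<Longrightarrow> is_junct True A \<and> lits A = ps"
  by (induction rule: disjunction_of.induct) auto

lemma conjunction_of_lits: "conjunction_of ps A \<Longrightarrow> is_junct False A \<and> lits A = ps"
  by (induction rule: conjunction_of.induct) auto

lemma is_junct_its: "is_junct d B \<Longrightarrow> it \<in> set (its C B q X Y) \<Longrightarrow> is_junct d (isub it)"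
  by (induction B arbitrary: q X Y) (auto simp: isub_def)

lemma lits_sub: "p \<in> set (lits B) \<Longrightarrow> BLit p \<in> isub ` set (its C B q X Y)"
proof (induction B arbitrary: q X Y)
  case (BLit r)
  then show ?case by (simp add: isub_def)
next
  case (BAnd A B)
  then show ?case
    using BAnd.IH(1)[of "False # q" X "(C, True # q)"] BAnd.IH(2)[of "True # q" X Y]
    unfolding its.simps lits.simps set_append image_Un by blast
next
  case (BOr A B)
  then show ?case
    using BOr.IH(1)[of "False # q" "(C, True # q)" Y] BOr.IH(2)[of "True # q" X Y]
    unfolding its.simps lits.simps set_append image_Un by blast
qed

lemma lits_ne: "lits A \<noteq> []"
  by (induction A) auto

lemma edt_Disj: "ps \<noteq> [] \<Longrightarrow> edt (Disj ps)"
  by (induction ps rule: Disj.induct) auto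

lemma edt_Conj: "ps \<noteq> [] \<Longrightarrow> edt (Conj ps)"
  by (induction ps rule: Conj.induct) auto

lemma edt_junct: "ps \<noteq> [] \<Longrightarrow> edt (junct d ps)"
  by (simp add: junct_def edt_Disj edt_Conj)

lemma edts_orient [simp]: "edts (orient d S) \<longleftrightarrow> edts S"
  by (auto simp: orient_def flip_def edts_def)

text \<open>Each literal implies every disjunction that contains it, by one cut through the operand
  in which it lies. Operands come earlier by \<open>kids_first\<close>. For \<open>d\<close> false
  the sequents are reversed and speak of conjunctions.\<close>

lemma lits_junct_valid:
  fixes Ks :: "key list"
  defines "f \<equiv> \<lambda>d B. map (\<lambda>p. goal (orient d ([ELit p], [tr Ks B]))) (lits B)"
  assumes "kids_first S Bs" "\<forall>B\<in>S. \<forall>p\<in>set (lits B). orient d ([ELit p], [tr Ks B]) \<in> K"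
    "\<forall>B\<in>set Bs. is_junct d B \<and> root_known K Ks B"
  shows "script_ok E K (concat (map (f d) Bs)) \<and>
    (\<forall>B\<in>set Bs. \<forall>p\<in>set (lits B). orient d ([ELit p], [tr Ks B]) \<in> seqs (concat (map (f d) Bs)))"
  using assms(2-)
proof (induction Bs arbitrary: S K)
  case (Cons B Bs)
  have s: "seqs (f d B) = (\<lambda>p. orient d ([ELit p], [tr Ks B])) ` set (lits B)"
    by (auto simp: f_def goal_def image_image)
  have B: "is_junct d B" "root_known K Ks B" using Cons.prems(3) by auto
  have "found 5 K (orient d ([ELit p], [tr Ks B]))" if p: "p \<in> set (lits B)" for p
  proof -
    \<comment> \<open>Turning the known sequents around instead of the goal lets one argument serve
      both values of \<open>d\<close>.\<close>
    let ?K = "orient d ` K"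
    have step: "found 5 ?K ([ELit p], [tr Ks B])"
      if "A \<in> kids B" "p \<in> set (lits A)" "orient d ([tr Ks A], [tr Ks B]) \<in> K" for A
    proof -
      have c: "([ELit p], [tr Ks A]) \<in> ?K" and k: "([tr Ks A], [tr Ks B]) \<in> ?K"
        using Cons.prems(1,2) that by (auto simp: orient_mem[symmetric])
      show ?thesis unfolding five
        by (rule cut_left[OF c, where a = "tr Ks A"], simp, simp, rule found_ax[OF k], simp_all)
    qed
    have "found 5 ?K ([ELit p], [tr Ks B])"
    proof (cases B)
      case (BLit q)
      with B(2) p have "orient d ([ELit p], [tr Ks B]) \<in> K"
        by (auto simp: root_known_def seqs_root_entries orient_def)
      then have "([ELit p], [tr Ks B]) \<in> ?K" by (simp only: orient_mem)
      then show ?thesis by (rule found_ax) simp_all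
    next
      case (BAnd A A')
      with B p show ?thesis
        by (intro step[of "if p \<in> set (lits A) then A else A'"])
          (auto simp: root_known_def seqs_root_entries orient_def flip_def)
    next
      case (BOr A A')
      with B p show ?thesis
        by (intro step[of "if p \<in> set (lits A) then A else A'"])
          (auto simp: root_known_def seqs_root_entries orient_def)
    qed
    then show ?thesis by (simp add: found_orient)
  qed
  then have v: "script_ok E K (f d B)"
    unfolding f_def by (intro script_ok_map) (simp add: goal_def)
  have "script_ok E (K \<union> seqs (f d B)) (concat (map (f d) Bs)) \<and>
    (\<forall>B\<in>set Bs. \<forall>p\<in>set (lits B). orient d ([ELit p], [tr Ks B]) \<in> seqs (concat (map (f d) Bs)))"
  proof (rule Cons.IH)
    show "kids_first (insert B S) Bs" using Cons.prems(1) by simp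
    show "\<forall>A\<in>insert B S. \<forall>p\<in>set (lits A). orient d ([ELit p], [tr Ks A]) \<in> K \<union> seqs (f d B)"
      using Cons.prems(2) s by auto
    show "\<forall>A\<in>set Bs. is_junct d A \<and> root_known (K \<union> seqs (f d B)) Ks A"
      using Cons.prems(3) by (auto intro: root_known_mono)
  qed
  with v s show ?case by (simp add: script_ok_append image_Un)
qed simp

text \<open>By induction on suffixes, each adding one decision. Only one direction is derived: the
  disjunction must imply its root variable on the left, and be dually implied on the right, for the
  old formula to be cut out.\<close>

lemma junct_suffs_valid:
  assumes "\<forall>p\<in>set ps. orient d ([ELit p], [T]) \<in> K \<and> ([ELit p], [ELit p]) \<in> K" "edt T" "ps \<noteq> []"
  defines "f \<equiv> \<lambda>s. case s of [] \<Rightarrow> [] | p # r \<Rightarrow> (case r of [] \<Rightarrow> [] | q # t \<Rightarrow>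
       (let P = orient d ([junct d r], [ELit p, T]); Q = orient d ([ELit p, ELit p], [T]);
         S = orient d ([junct d s], [T])
       in if d then infer2 P Q S else infer2 Q P S))"
  shows "script_ok E K (concat (map f (suffs ps))) \<and>
    orient d ([junct d ps], [T]) \<in> K \<union> seqs (concat (map f (suffs ps)))"
  using assms(1,3)
proof (induction ps)
  case (Cons p r)
  show ?case
  proof (cases r)
    case Nil
    then show ?thesis using Cons.prems by (cases d) (simp_all add: f_def junct_def)
  next
    case (Cons q t)
    define s where "s = concat (map f (suffs r))"
    let ?K = "K \<union> seqs s"
    let ?P = "orient d ([junct d r], [ELit p, T])" let ?Q = "orient d ([ELit p, ELit p], [T])"
    let ?S = "orient d ([junct d (p # r)], [T])"
    have IH: "script_ok E K s" "orient d ([junct d r], [T]) \<in> ?K"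
      using Cons.IH Cons.prems(1) Cons unfolding s_def by auto
    have D: "Disj (p # r) = EDec (Disj r) p (ELit p)" "Conj (p # r) = EDec (ELit p) p (Conj r)"
      using Cons by (auto intro: Disj_Cons Conj_Cons simp del: Disj.simps Conj.simps)
    have e: "edts ?P" "edts ?Q" "edts ?S" using assms(2) Cons by (simp_all add: edt_junct)
    have "orient d ([ELit p], [T]) \<in> ?K" using Cons.prems by simp
    then have m: "([junct d r], [T]) \<in> orient d ` ?K" "([ELit p], [T]) \<in> orient d ` ?K"
      using IH(2) by (simp_all only: orient_mem)
    have f: "found 5 ?K ?P" "found 5 ?K ?Q"
      unfolding found_orient using found_ax[OF m(1)] found_ax[OF m(2)] by simp_all
    \<comment> \<open>The literal is the true branch of \<open>Disj\<close> but the false branch of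
      \<open>Conj\<close>, so the two premises change places.\<close>
    have "d \<Longrightarrow> eldt_rule E [msq ?P, msq ?Q] (msq ?S)" "\<not> d \<Longrightarrow> eldt_rule E [msq ?Q, msq ?P] (msq ?S)"
      using dec_l[of E "Disj r" "{#}" p "{#T#}" "ELit p"] dec_r[of E "{#T#}" "ELit p" p "{#}" "Conj r"]
      by (simp_all add: msq_def D orient_def flip_def junct_def del: Disj.simps Conj.simps)
    then have "script_ok E ?K (if d then infer2 ?P ?Q ?S else infer2 ?Q ?P ?S)"
      using e f by (auto intro!: infer2_valid)
    moreover have "f (p # r) = (if d then infer2 ?P ?Q ?S else infer2 ?Q ?P ?S)"
      by (simp add: f_def Cons)
    moreover have "concat (map f (suffs (p # r))) = s @ f (p # r)" by (simp add: s_def)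
    ultimately show ?thesis using IH by (auto simp: script_ok_append image_Un)
  qed
qed simp

lemma junct_entries_valid:
  assumes "is_junct d A" "\<forall>B\<in>isub ` set (items A). root_known K Ks B" "\<forall>p\<in>set (lits A). lit_known K p"
  shows "script_ok E K (junct_entries d Ks A) \<and>
    orient d ([junct d (lits A)], [tr Ks A]) \<in> K \<union> seqs (junct_entries d Ks A)"
proof -
  define s where "s = concat (map (\<lambda>B. map (\<lambda>p. goal (orient d ([ELit p], [tr Ks B]))) (lits B)) (map isub (items A)))"
  have 1: "script_ok E K s \<and>
      (\<forall>B\<in>set (map isub (items A)). \<forall>p\<in>set (lits B). orient d ([ELit p], [tr Ks B]) \<in> seqs s)"
    unfolding s_def
  proof (rule lits_junct_valid)
    show "kids_first {} (map isub (items A))" unfolding items_def by (rule kids_first_its)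
    show "\<forall>B\<in>set (map isub (items A)). is_junct d B \<and> root_known K Ks B"
      using assms is_junct_its[of d A _ A "[]" k0 k1] by (auto simp: items_def)
  qed simp
  have "A \<in> set (map isub (items A))" by (simp add: items_def isub_mem)
  then have "\<forall>p\<in>set (lits A). orient d ([ELit p], [tr Ks A]) \<in> K \<union> seqs s \<and> ([ELit p], [ELit p]) \<in> K \<union> seqs s"
    using 1 assms(3) by (auto simp: lit_known_def)
  from junct_suffs_valid[OF this edt_tr lits_ne, of E] 1 show ?thesis
    unfolding junct_entries_def s_def[symmetric] by (simp add: script_ok_append image_Un Un_assoc)
qed

lemma exchange_valid:
  assumes "found 5 K (orient d (G @ map (tr Ks) U, D))" "edts (G, D)"
    "\<forall>A\<in>set U. junct d (lits A) \<in> set G \<and> orient d ([junct d (lits A)], [tr Ks A]) \<in> K"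
  defines "f \<equiv> \<lambda>s. goal (orient d (G @ map (tr Ks) s, D))"
  shows "script_ok E K (map f (rev ([] # suffs U))) \<and> orient d (G, D) \<in> seqs (map f (rev ([] # suffs U)))"
  using assms(1-3)
proof (induction U arbitrary: K)
  case Nil
  then show ?case by (simp add: f_def goal_def)
next
  case (Cons A U)
  let ?S = "(G @ map (tr Ks) (A # U), D)" and ?J = "junct d (lits A)"
  let ?K = "insert (orient d ?S) K"
  have "orient d ([?J], [tr Ks A]) \<in> ?K" "orient d ?S \<in> ?K" using Cons.prems(3) by auto
  then have k: "([?J], [tr Ks A]) \<in> orient d ` ?K" "?S \<in> orient d ` ?K"
    by (simp_all only: orient_mem)
  \<comment> \<open>The replacement \<open>?J\<close> already stands in \<open>G\<close>, so one cut
    on \<open>tr Ks A\<close> removes the old formula.\<close>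
  have "found 5 ?K (orient d (G @ map (tr Ks) U, D))" unfolding found_orient five
    by (rule cut_left[OF k(1), where a = "tr Ks A"], use Cons.prems(3) in simp, simp,
        rule found_ax[OF k(2)], auto)
  with Cons.IH[of ?K] Cons.prems show ?case by (auto simp: f_def goal_def)
qed

lemma seqs_concat_mono: "x \<in> set xs \<Longrightarrow> seqs (f x) \<subseteq> seqs (concat (map f xs))"
  by auto

lemma final_entries_valid:
  assumes last: "(map (tr Ks) \<Gamma>, map (tr Ks) \<Delta>) \<in> K"
    and junct: "\<forall>A\<in>set \<Gamma>. is_junct True A" "\<forall>A\<in>set \<Delta>. is_junct False A"
    and sub: "\<forall>A\<in>set \<Gamma> \<union> set \<Delta>. (\<forall>B\<in>isub ` set (items A). root_known K Ks B) \<and> (\<forall>p\<in>set (lits A). lit_known K p)"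
  shows "script_ok E K (final_entries Ks \<Gamma> \<Delta>)"
proof -
  define j where "j = (\<lambda>d A. junct d (lits A))"
  define s where "s = (\<lambda>d \<Theta>. concat (map (junct_entries d Ks) \<Theta>))"
  let ?G = "map (j True) \<Gamma>" let ?D = "map (j False) \<Delta>"
  let ?K1 = "K \<union> seqs (s True \<Gamma>)" let ?K2 = "?K1 \<union> seqs (s False \<Delta>)"
  define s3 where "s3 = map (\<lambda>s. goal (orient True (?G @ map (tr Ks) s, map (tr Ks) \<Delta>))) (rev ([] # suffs \<Gamma>))"
  define s4 where "s4 = map (\<lambda>s. goal (orient False (?D @ map (tr Ks) s, ?G))) (rev ([] # suffs \<Delta>))"
  have v: "script_ok E K (s d \<Theta>) \<and> (\<forall>A\<in>set \<Theta>. orient d ([j d A], [tr Ks A]) \<in> K \<union> seqs (s d \<Theta>))"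
    if J: "\<forall>A\<in>set \<Theta>. is_junct d A" and T: "set \<Theta> \<subseteq> set \<Gamma> \<union> set \<Delta>" for d \<Theta>
  proof -
    have e: "script_ok E K (junct_entries d Ks A)"
      "orient d ([j d A], [tr Ks A]) \<in> K \<union> seqs (junct_entries d Ks A)" if "A \<in> set \<Theta>" for A
      unfolding j_def using junct_entries_valid[of d A K Ks E] that J subsetD[OF T that] sub by blast+
    have "script_ok E K (s d \<Theta>)" unfolding s_def by (intro script_ok_concat e)
    moreover have "orient d ([j d A], [tr Ks A]) \<in> K \<union> seqs (s d \<Theta>)" if "A \<in> set \<Theta>" for A
      using e(2)[OF that] seqs_concat_mono[OF that, of "junct_entries d Ks"] unfolding s_def by blast
    ultimately show ?thesis by blast
  qed
  note v1 = v[OF junct(1) Un_upper1] and v2 = v[OF junct(2) Un_upper2]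
  have edt: "edt (j d A)" for d A by (simp add: j_def edt_junct lits_ne)
  have v3: "script_ok E ?K2 s3 \<and> orient True (?G, map (tr Ks) \<Delta>) \<in> seqs s3"
    unfolding s3_def
  proof (rule exchange_valid)
    have "(map (tr Ks) \<Gamma>, map (tr Ks) \<Delta>) \<in> ?K2" using last by simp
    then show "found 5 ?K2 (orient True (?G @ map (tr Ks) \<Gamma>, map (tr Ks) \<Delta>))"
      unfolding orient_def if_True by (rule found_ax) auto
    show "\<forall>A\<in>set \<Gamma>. junct True (lits A) \<in> set ?G \<and> orient True ([junct True (lits A)], [tr Ks A]) \<in> ?K2"
      using v1 by (auto simp: j_def)
  qed (simp add: edt)
  have v4: "script_ok E (?K2 \<union> seqs s3) s4 \<and> orient False (?D, ?G) \<in> seqs s4"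
    unfolding s4_def
  proof (rule exchange_valid)
    have "(?G, map (tr Ks) \<Delta>) \<in> ?K2 \<union> seqs s3" using v3 by (simp add: orient_def)
    then show "found 5 (?K2 \<union> seqs s3) (orient False (?D @ map (tr Ks) \<Delta>, ?G))"
      unfolding orient_def flip_def if_False fst_conv snd_conv by (rule found_ax) auto
    show "\<forall>A\<in>set \<Delta>. junct False (lits A) \<in> set ?D \<and> orient False ([junct False (lits A)], [tr Ks A]) \<in> ?K2 \<union> seqs s3"
      using v2 by (auto simp: j_def)
  qed (simp add: edt)
  have "final_entries Ks \<Gamma> \<Delta> = s True \<Gamma> @ s False \<Delta> @ s3 @ s4"
    by (simp only: final_entries_def Let_def s_def s3_def s4_def j_def)
  moreover have "script_ok E ?K1 (s False \<Delta>)" by (rule script_ok_mono[of _ K]) (use v2 in auto)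
  ultimately show ?thesis using v1 v3 v4 by (simp add: script_ok_append Un_assoc)
qed

lemma final_entries_last:
  "final_entries Ks \<Gamma> \<Delta> \<noteq> [] \<and>
   last (final_entries Ks \<Gamma> \<Delta>) = goal (map (\<lambda>A. Disj (lits A)) \<Gamma>, map (\<lambda>A. Conj (lits A)) \<Delta>)"
  by (simp add: final_entries_def Let_def orient_def flip_def junct_def)

lemma script_eq:
  assumes "\<pi> \<noteq> []" "last \<pi> = (ps, \<Gamma>, \<Delta>)"
  shows "script \<pi> = base_entries (keys \<pi>) (all_items \<pi>) @ concat (map (item_entries (keys \<pi>)) (all_items \<pi>)) @
     map (\<lambda>l. goal (map (tr (keys \<pi>)) (fst (snd l)), map (tr (keys \<pi>)) (snd (snd l)))) \<pi> @
     final_entries (keys \<pi>) \<Gamma> \<Delta>"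
proof -
  have "rev \<pi> = (ps, \<Gamma>, \<Delta>) # rev (butlast \<pi>)"
    using assms by (metis append_butlast_last_id rev_eq_Cons_iff rev_rev_ident)
  then show ?thesis unfolding script_def Let_def by (simp only: list.case fst_conv snd_conv)
qed

lemma sub_roots: "A \<in> set (forms \<pi>) \<Longrightarrow> isub ` set (items A) \<subseteq> set (roots \<pi>)"
  by (auto simp: roots_def)

lemma script_valid:
  assumes \<pi>: "derivation lk_rule \<pi>" "\<pi> \<noteq> []" "last \<pi> = (ps, \<Gamma>, \<Delta>)"
    and junct: "\<forall>A\<in>set \<Gamma>. is_junct True A" "\<forall>A\<in>set \<Delta>. is_junct False A"
  shows "script_ok (exts \<pi>) {} (script \<pi>)"
proof -
  let ?E = "exts \<pi>" let ?Ks = "keys \<pi>" let ?I = "all_items \<pi>"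
  define s1 where "s1 = base_entries ?Ks ?I"
  define s2 where "s2 = concat (map (item_entries ?Ks) ?I)"
  define s3 where "s3 = map (\<lambda>l. goal (map (tr ?Ks) (fst (snd l)), map (tr ?Ks) (snd (snd l)))) \<pi>"
  have v1: "script_ok ?E {} s1" and base: "base_known (seqs s1) ?Ks (set ?I)"
    using base_entries_valid unfolding s1_def by auto
  let ?K1 = "seqs s1" let ?K2 = "?K1 \<union> seqs s2" let ?K3 = "?K2 \<union> seqs s3"
  have items: "set (items C) \<subseteq> set ?I" if "C \<in> set (roots \<pi>)" for C
    using that by (auto simp: all_items_def)
  have "kids_first {} (roots \<pi>)" unfolding roots_def by (rule kids_first_roots)
  from roots_valid[OF this _ _ base, of ?E] items
  have v2: "script_ok ?E ?K1 s2" and known: "\<forall>C\<in>set (roots \<pi>). root_known ?K2 ?Ks C"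
    unfolding s2_def all_items_def by auto
  have lit: "lit_known ?K1 p" if "BLit p \<in> set (roots \<pi>)" for p
  proof -
    have "(BLit p, [], BLit p, k0, k1) \<in> set ?I"
      using items[OF that] by (simp add: items_def)
    then show ?thesis using base unfolding base_known_def by blast
  qed
  have v3: "script_ok ?E ?K2 s3" unfolding s3_def
  proof (rule lk_lines_valid[OF \<pi>(1)])
    show "\<forall>A\<in>set (forms \<pi>). root_known ?K2 ?Ks A" using known forms_roots by blast
    show "\<forall>p. BLit p \<in> set (forms \<pi>) \<longrightarrow> lit_known ?K2 p"
      using lit forms_roots unfolding lit_known_def by blast
  qed
  have mem: "(ps, \<Gamma>, \<Delta>) \<in> set \<pi>" using \<pi>(2,3) last_in_set by metis
  then have fm: "A \<in> set (forms \<pi>)" if "A \<in> set \<Gamma> \<union> set \<Delta>" for A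
    using that by (force simp: forms_def)
  have v4: "script_ok ?E ?K3 (final_entries ?Ks \<Gamma> \<Delta>)"
  proof (rule final_entries_valid[OF _ junct])
    have "(map (tr ?Ks) \<Gamma>, map (tr ?Ks) \<Delta>) \<in> seqs s3"
      unfolding s3_def using mem by (force simp: goal_def)
    then show "(map (tr ?Ks) \<Gamma>, map (tr ?Ks) \<Delta>) \<in> ?K3" by simp
    show "\<forall>A\<in>set \<Gamma> \<union> set \<Delta>. (\<forall>B\<in>isub ` set (items A). root_known ?K3 ?Ks B) \<and>
        (\<forall>p\<in>set (lits A). lit_known ?K3 p)"
    proof (intro ballI conjI)
      fix A B assume "A \<in> set \<Gamma> \<union> set \<Delta>" "B \<in> isub ` set (items A)"
      then have "B \<in> set (roots \<pi>)" using fm sub_roots by blast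
      with known have "root_known ?K2 ?Ks B" by blast
      then show "root_known ?K3 ?Ks B" by (rule root_known_mono) simp
    next
      fix A p assume A: "A \<in> set \<Gamma> \<union> set \<Delta>" and p: "p \<in> set (lits A)"
      have "BLit p \<in> isub ` set (items A)" unfolding items_def by (rule lits_sub[OF p])
      then have "lit_known ?K1 p" using lit fm[OF A] sub_roots by blast
      then show "lit_known ?K3 p" by (auto simp: lit_known_def)
    qed
  qed
  show ?thesis
    unfolding script_eq[OF \<pi>(2,3)] s1_def[symmetric] s2_def[symmetric] s3_def[symmetric]
    using v1 v2 v3 v4 by (simp add: script_ok_append Un_assoc)
qed

lemma trans_correct:
  assumes "list_all2 disjunction_of as \<Gamma>" "list_all2 conjunction_of bs \<Delta>"
    and "lk_proof \<pi> (mset \<Gamma>, mset \<Delta>)"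
  shows "eldt_proof (trans \<pi>) (mset (map Disj as), mset (map Conj bs))"
proof -
  have \<pi>: "derivation lk_rule \<pi>" "\<pi> \<noteq> []" "conclusion (last \<pi>) = (mset \<Gamma>, mset \<Delta>)"
    using assms(3) by (auto simp: lk_proof_def derives_def)
  obtain ps \<Gamma>' \<Delta>' where l: "last \<pi> = (ps, \<Gamma>', \<Delta>')" by (cases "last \<pi>")
  \<comment> \<open>The last line may list its cedents in another order than \<open>\<Gamma>\<close>
    and \<open>\<Delta>\<close>. The translation follows the listed order, and only multisets are
    compared in the end.\<close>
  then have m: "mset \<Gamma>' = mset \<Gamma>" "mset \<Delta>' = mset \<Delta>" using \<pi>(3) by auto
  have a: "map Disj as = map (\<lambda>A. Disj (lits A)) \<Gamma> \<and> (\<forall>A\<in>set \<Gamma>. is_junct True A)"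
    using assms(1) by (induction rule: list_all2_induct) (auto dest: disjunction_of_lits)
  have b: "map Conj bs = map (\<lambda>A. Conj (lits A)) \<Delta> \<and> (\<forall>A\<in>set \<Delta>. is_junct False A)"
    using assms(2) by (induction rule: list_all2_induct) (auto dest: conjunction_of_lits)
  have "\<forall>A\<in>set \<Gamma>'. is_junct True A" "\<forall>A\<in>set \<Delta>'. is_junct False A"
    using a b m by (metis mset_eq_setD)+
  note v = script_valid[OF \<pi>(1,2) l this]
  have "script \<pi> \<noteq> []" "last (script \<pi>) = goal (map (\<lambda>A. Disj (lits A)) \<Gamma>', map (\<lambda>A. Conj (lits A)) \<Delta>')"
    using final_entries_last[of "keys \<pi>" \<Gamma>' \<Delta>'] by (auto simp: script_eq[OF \<pi>(2) l])
  then have d: "valid_ded (exts \<pi>) {} (dedn (script \<pi>))" "dedn (script \<pi>) \<noteq> []"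
    "snd (last (dedn (script \<pi>))) = (map (\<lambda>A. Disj (lits A)) \<Gamma>', map (\<lambda>A. Conj (lits A)) \<Delta>')"
    using dedn_valid[OF v] by (auto simp: goal_def)
  have "msq (map (\<lambda>A. Disj (lits A)) \<Gamma>', map (\<lambda>A. Conj (lits A)) \<Delta>') = (mset (map Disj as), mset (map Conj bs))"
    using a b m by (simp add: msq_def)
  with lines_derives[OF d(1,2)] d(3) show ?thesis
    by (simp add: trans_def exts_axioms exts_edt)
qed

lemma eldt_elndt: "eldt_proof \<rho> S \<Longrightarrow> elndt_proof \<rho> S"
  by (cases \<rho>) (auto simp: derives_def derivation_def intro: elndt_eldt)

lemma encode_lk_enc: "encode_lk \<pi> = bits_of_tree (enc \<pi>)"
proof -
  have n: "tree_nat = enc" and f: "tree_bfm = enc"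
    by (simp_all add: fun_eq_iff enc_nat_def enc_bfm_def)
  have "tree_line tree_bfm = (enc :: bfm line \<Rightarrow> tree)"
    by (rule ext) (auto simp: enc_prod_def enc_list_def n f)
  then show ?thesis by (simp add: encode_lk_def enc_list_def)
qed

lemma encode_eproof_enc: "encode_eproof \<rho> = bits_of_tree (enc \<rho>)"
proof -
  have n: "tree_nat = enc" and f: "tree_efm = enc"
    by (simp_all add: fun_eq_iff enc_nat_def enc_efm_def)
  have "tree_line tree_efm = (enc :: efm line \<Rightarrow> tree)"
    by (rule ext) (auto simp: enc_prod_def enc_list_def n f)
  then show ?thesis by (cases \<rho>) (simp add: enc_list_def enc_prod_def f)
qed

theorem theorem6p1:
  "\<exists>(c :: prog) (p :: nat poly).
     \<forall>(\<pi> :: bfm line list) (as :: lit list list) (bs :: lit list list) (\<Gamma> :: bfm list) (\<Delta> :: bfm list).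
       [] \<notin> set as \<longrightarrow> [] \<notin> set bs \<longrightarrow>
       list_all2 disjunction_of as \<Gamma> \<longrightarrow> list_all2 conjunction_of bs \<Delta> \<longrightarrow>
       lk_proof \<pi> (mset \<Gamma>, mset \<Delta>) \<longrightarrow>
       (\<exists>\<rho> :: eproof.
          outputs_within c (encode_lk \<pi>) (poly p (length (encode_lk \<pi>))) (encode_eproof \<rho>) \<and>
          eldt_proof \<rho> (mset (map Disj as), mset (map Conj bs)) \<and>
          elndt_proof \<rho> (mset (map Disj as), mset (map Conj bs)))"
proof -
  obtain c k t where c: "4 \<le> k" "pbound t" "computes c k trans t"
    using pt_trans by (rule ptE)
  then obtain p where p: "\<And>\<pi>. t \<pi> \<le> poly p (sz \<pi>)" unfolding pbound_def by blast
  have "outputs_within c (encode_lk \<pi>) (poly p (length (encode_lk \<pi>))) (encode_eproof (trans \<pi>))" for \<pi>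
  proof -
    let ?s = "(\<lambda>_. [])(0 := bits_of_tree (enc \<pi>) @ [])"
    have "runs c ?s (t \<pi>) (?s(0 := enc_bits (trans \<pi>) @ []))"
      by (rule doesD[OF computesD[OF c(3)]]) (auto simp: aux_empty_def)
    from runs_mono[OF this p] show ?thesis
      unfolding outputs_within_def runs_def encode_lk_enc encode_eproof_enc sz_def by fastforce
  qed
  then show ?thesis
    using trans_correct eldt_elndt by (intro exI[of _ c] exI[of _ p]) blast
qed

end
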